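(* Let $H < G$ be groups, where $H$ is infinite, amenable, and hyperbolically embedded in $G$. Then $\mathcal{L}(H)$ is a maximal amenable von Neumann subalgebra of $\mathcal{L}(G)$, i.e. $\mathcal L(H)$ is amenable and any amenable von Neumann subalgebra of $\mathcal L(G)$ containing $\mathcal L(H)$ equals $\mathcal L(H)$.
   Context: Groups are discrete. $\mathcal{L}(G)\subset\mathfrak B(\ell^2G)$ is the group von Neumann algebra of $G$, generated by the left regular representation unitaries $u_g$, $g\in G$; for $H\leqslant G$, $\mathcal L(H)$ is identified with $\{u_h\mid h\in H\}''\subset\mathcal L(G)$. Von Neumann subalgebras contain the unit of the ambient algebra. Hyperbolically embedded subgroups: Let $H$ be a subgroup of a group $G$ and $X\subset G$ a set such that $X\cup H$ generates $G$. Let $\mathrm{Cay}(G,X\sqcup H)$ be the Cayley graph in which, for $a\in X\cap H$ and $g\in G$, there are two edges from $g$ to $ga$: one labeled by the copy of $a$ in $X$ and one by the copy of $a$ in $H$. Let $\mathrm{Cay}(H,H)$ be the Cayley graph of $H$ with respect to the generating set $H$, viewed naturally as a complete subgraph of $\mathrm{Cay}(G,X\sqcup H)$. The subgroup $H$ is hyperbolically embedded in $G$ if there is $X\subset G$ such that: (i) $X\cup H$ generates $G$; (ii) $\mathrm{Cay}(G,X\sqcup H)$ is a (Gromov) hyperbolic metric space; (iii) for every $n\in\mathbb N$, there are only finitely many $h\in H$ that can be connected to $1$ in $\mathrm{Cay}(G,X\sqcup H)$ by a path of length at most $n$ avoiding edges of $\mathrm{Cay}(H,H)$. *)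

theory Defs
  imports "HOL-Analysis.Analysis" "HOL-Algebra.Generated_Groups"
begin

section \<open>Bounded operators on the Hilbert space of square-summable functions\<close>

text \<open>
  Functions in the Hilbert space vanish off the index set \<open>A\<close>, and operators on it are
  extended by \<open>0\<close> to arguments outside the space.  Hence HOL equality of such functions and
  operators is the intended equality, and composition is ordinary function composition.
\<close>

definition ell2 :: "'a set \<Rightarrow> ('a \<Rightarrow> complex) set" where
  "ell2 A = {f. (\<forall>x. x \<notin> A \<longrightarrow> f x = 0) \<and> (\<lambda>x. (cmod (f x))\<^sup>2) summable_on A}"

definition ell2_inner :: "'a set \<Rightarrow> ('a \<Rightarrow> complex) \<Rightarrow> ('a \<Rightarrow> complex) \<Rightarrow> complex" where
  "ell2_inner A f g = (\<Sum>\<^sub>\<infinity>x\<in>A. f x * cnj (g x))"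

definition ell2_norm :: "'a set \<Rightarrow> ('a \<Rightarrow> complex) \<Rightarrow> real" where
  "ell2_norm A f = sqrt (\<Sum>\<^sub>\<infinity>x\<in>A. (cmod (f x))\<^sup>2)"

type_synonym 'a oper = "('a \<Rightarrow> complex) \<Rightarrow> ('a \<Rightarrow> complex)"

definition bounded_ops :: "'a set \<Rightarrow> 'a oper set" where
  "bounded_ops A = {T.
     (\<forall>f\<in>ell2 A. T f \<in> ell2 A) \<and>
     (\<forall>f. f \<notin> ell2 A \<longrightarrow> T f = (\<lambda>_. 0)) \<and>
     (\<forall>f\<in>ell2 A. \<forall>g\<in>ell2 A. T (\<lambda>x. f x + g x) = (\<lambda>x. T f x + T g x)) \<and>
     (\<forall>c. \<forall>f\<in>ell2 A. T (\<lambda>x. c * f x) = (\<lambda>x. c * T f x)) \<and>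
     (\<exists>K. \<forall>f\<in>ell2 A. ell2_norm A (T f) \<le> K * ell2_norm A f)}"

definition is_adjoint :: "'a set \<Rightarrow> 'a oper \<Rightarrow> 'a oper \<Rightarrow> bool" where
  "is_adjoint A T S \<longleftrightarrow>
     (\<forall>f\<in>ell2 A. \<forall>g\<in>ell2 A. ell2_inner A (T f) g = ell2_inner A f (S g))"

definition positive_op :: "'a set \<Rightarrow> 'a oper \<Rightarrow> bool" where
  "positive_op A T \<longleftrightarrow> (\<forall>f\<in>ell2 A. ell2_inner A (T f) f \<in> \<real>\<^sub>\<ge>\<^sub>0)"


section \<open>Von Neumann algebras and amenability\<close>

definition commutant :: "'a set \<Rightarrow> 'a oper set \<Rightarrow> 'a oper set" where
  "commutant A M = {T \<in> bounded_ops A. \<forall>S\<in>M. T \<circ> S = S \<circ> T}"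

definition von_neumann_algebra :: "'a set \<Rightarrow> 'a oper set \<Rightarrow> bool" where
  "von_neumann_algebra A M \<longleftrightarrow>
     M \<subseteq> bounded_ops A \<and>
     (\<forall>T\<in>M. \<exists>S\<in>M. is_adjoint A T S) \<and>
     commutant A (commutant A M) = M"

text \<open>
  The unit of every von Neumann algebra in this sense is the identity operator, so inclusion of
  such algebras is automatically unital.
\<close>

definition von_neumann_subalgebra :: "'a set \<Rightarrow> 'a oper set \<Rightarrow> 'a oper set \<Rightarrow> bool" where
  "von_neumann_subalgebra A M N \<longleftrightarrow>
     von_neumann_algebra A M \<and> von_neumann_algebra A N \<and> M \<subseteq> N"

text \<open>No normality (ultraweak continuity) is required of a conditional expectation.\<close>

definition conditional_expectation ::
    "'a set \<Rightarrow> 'a oper set \<Rightarrow> 'a oper set \<Rightarrow> ('a oper \<Rightarrow> 'a oper) \<Rightarrow> bool" where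
  "conditional_expectation A N M E \<longleftrightarrow>
     (\<forall>T\<in>N. E T \<in> M) \<and>
     (\<forall>S\<in>N. \<forall>T\<in>N. E (\<lambda>f x. S f x + T f x) = (\<lambda>f x. E S f x + E T f x)) \<and>
     (\<forall>c. \<forall>T\<in>N. E (\<lambda>f x. c * T f x) = (\<lambda>f x. c * E T f x)) \<and>
     (\<forall>T\<in>N. positive_op A T \<longrightarrow> positive_op A (E T)) \<and>
     (\<forall>T\<in>M. E T = T) \<and>
     (\<forall>S\<in>M. \<forall>R\<in>M. \<forall>T\<in>N. E (S \<circ> T \<circ> R) = S \<circ> E T \<circ> R)"

definition amenable_vN :: "'a set \<Rightarrow> 'a oper set \<Rightarrow> bool" where
  "amenable_vN A M \<longleftrightarrow>
     von_neumann_algebra A M \<and> (\<exists>E. conditional_expectation A (bounded_ops A) M E)"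

definition maximal_amenable_subalgebra :: "'a set \<Rightarrow> 'a oper set \<Rightarrow> 'a oper set \<Rightarrow> bool" where
  "maximal_amenable_subalgebra A M N \<longleftrightarrow>
     von_neumann_subalgebra A M N \<and> amenable_vN A M \<and>
     (\<forall>Q. von_neumann_subalgebra A Q N \<and> amenable_vN A Q \<and> M \<subseteq> Q \<longrightarrow> Q = M)"


section \<open>Group von Neumann algebras\<close>

definition left_regular :: "('a, 'm) monoid_scheme \<Rightarrow> 'a \<Rightarrow> 'a oper" where
  "left_regular G g = (\<lambda>f. if f \<in> ell2 (carrier G)
     then (\<lambda>x. if x \<in> carrier G then f (inv\<^bsub>G\<^esub> g \<otimes>\<^bsub>G\<^esub> x) else 0)
     else (\<lambda>_. 0))"

text \<open>
  The algebra of a subgroup \<open>H\<close>, acting on the Hilbert space of the whole group \<open>G\<close>.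
\<close>

definition subgroup_vN :: "('a, 'm) monoid_scheme \<Rightarrow> 'a set \<Rightarrow> 'a oper set" where
  "subgroup_vN G H =
     commutant (carrier G) (commutant (carrier G) (left_regular G ` H))"

abbreviation group_vN :: "('a, 'm) monoid_scheme \<Rightarrow> 'a oper set" where
  "group_vN G \<equiv> subgroup_vN G (carrier G)"


section \<open>Amenable groups\<close>

text \<open>
  Existence of a left-invariant mean on the bounded real functions.  Linearity and
  positivity on the carrier force \<open>m f\<close> to depend only on the values of \<open>f\<close> on the carrier.
\<close>

definition amenable_group :: "('a, 'm) monoid_scheme \<Rightarrow> bool" where
  "amenable_group G \<longleftrightarrow> (\<exists>m :: ('a \<Rightarrow> real) \<Rightarrow> real.
     (\<forall>f g. bounded (f ` carrier G) \<and> bounded (g ` carrier G) \<longrightarrow>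
        m (\<lambda>x. f x + g x) = m f + m g) \<and>
     (\<forall>c f. bounded (f ` carrier G) \<longrightarrow> m (\<lambda>x. c * f x) = c * m f) \<and>
     (\<forall>f. bounded (f ` carrier G) \<and> (\<forall>x\<in>carrier G. 0 \<le> f x) \<longrightarrow> 0 \<le> m f) \<and>
     m (\<lambda>_. 1) = 1 \<and>
     (\<forall>g\<in>carrier G. \<forall>f. bounded (f ` carrier G) \<longrightarrow> m (\<lambda>x. f (g \<otimes>\<^bsub>G\<^esub> x)) = m f))"


section \<open>Hyperbolically embedded subgroups\<close>

text \<open>
  The edge \<open>(g, l)\<close> joins \<open>g\<close> to \<open>ga\<close>, where \<open>a\<close> is the group element underlying the
  label \<open>l\<close>; labels range over the disjoint union \<open>X <+> H\<close>.
\<close>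

type_synonym 'a cayley_edge = "'a \<times> ('a + 'a)"

definition cayley_edges ::
    "('a, 'm) monoid_scheme \<Rightarrow> 'a set \<Rightarrow> 'a set \<Rightarrow> 'a cayley_edge set" where
  "cayley_edges G X H = carrier G \<times> (X <+> H)"

text \<open>The edges of the complete subgraph \<open>Cay(H,H)\<close>; only \<open>H\<close>-labelled edges count.\<close>

definition subgroup_edges :: "'a set \<Rightarrow> 'a cayley_edge set" where
  "subgroup_edges H = H \<times> ({} <+> H)"

definition edge_source :: "'a cayley_edge \<Rightarrow> 'a" where
  "edge_source e = fst e"

definition edge_target :: "('a, 'm) monoid_scheme \<Rightarrow> 'a cayley_edge \<Rightarrow> 'a" where
  "edge_target G e = fst e \<otimes>\<^bsub>G\<^esub> (case snd e of Inl a \<Rightarrow> a | Inr a \<Rightarrow> a)"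

text \<open>
  \<open>edge_path G E u n v\<close>: there is a path of length \<open>n\<close> from \<open>u\<close> to \<open>v\<close> using only edges from
  \<open>E\<close>.  Edges may be traversed in both directions.
\<close>

inductive edge_path ::
    "('a, 'm) monoid_scheme \<Rightarrow> 'a cayley_edge set \<Rightarrow> 'a \<Rightarrow> nat \<Rightarrow> 'a \<Rightarrow> bool"
  for G E u where
  edge_path_Nil: "u \<in> carrier G \<Longrightarrow> edge_path G E u 0 u"
| edge_path_forward:
    "edge_path G E u n (edge_source e) \<Longrightarrow> e \<in> E \<Longrightarrow> edge_path G E u (Suc n) (edge_target G e)"
| edge_path_backward:
    "edge_path G E u n (edge_target G e) \<Longrightarrow> e \<in> E \<Longrightarrow> edge_path G E u (Suc n) (edge_source e)"

definition cayley_dist ::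
    "('a, 'm) monoid_scheme \<Rightarrow> 'a set \<Rightarrow> 'a set \<Rightarrow> 'a \<Rightarrow> 'a \<Rightarrow> real" where
  "cayley_dist G X H u v = real (LEAST n. edge_path G (cayley_edges G X H) u n v)"

definition gromov_product :: "('p \<Rightarrow> 'p \<Rightarrow> real) \<Rightarrow> 'p \<Rightarrow> 'p \<Rightarrow> 'p \<Rightarrow> real" where
  "gromov_product d w x y = (d x w + d y w - d x y) / 2"

definition gromov_hyperbolic :: "'p set \<Rightarrow> ('p \<Rightarrow> 'p \<Rightarrow> real) \<Rightarrow> bool" where
  "gromov_hyperbolic P d \<longleftrightarrow> (\<exists>\<delta>\<ge>0. \<forall>w\<in>P. \<forall>x\<in>P. \<forall>y\<in>P. \<forall>z\<in>P.
     gromov_product d w x z \<ge> min (gromov_product d w x y) (gromov_product d w y z) - \<delta>)"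

text \<open>
  The Cayley graph is treated as a metric space through its vertices with the combinatorial path
  metric.  The generation condition makes the graph connected, so distances are genuine minima.
\<close>

definition hyperbolically_embedded :: "'a set \<Rightarrow> ('a, 'm) monoid_scheme \<Rightarrow> bool" where
  "hyperbolically_embedded H G \<longleftrightarrow> subgroup H G \<and>
     (\<exists>X\<subseteq>carrier G.
        generate G (X \<union> H) = carrier G \<and>
        gromov_hyperbolic (carrier G) (cayley_dist G X H) \<and>
        (\<forall>n. finite {h \<in> H. \<exists>k\<le>n.
           edge_path G (cayley_edges G X H - subgroup_edges H) \<one>\<^bsub>G\<^esub> k h}))"

end

(*
  Let Q be amenable with L(H) <= Q <= L(G), and let E be a conditional expectation onto Q.
  The restriction of E to L(G) need not be normal, so E is first composed with a normal
  completely positive map Theta(T) = sum V* T V, where the V run over a family in the commutant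
  Q' with values in the closure K of Q delta and sum V* V = 1.  By the commutation theorem on K,
  Theta maps L(G) onto Q and preserves the trace, so phi = tau o E o Theta is a Q-central state
  on all bounded operators with phi(x u_g) = tau(x u_g) for x in Q.

  Restricted to multiplication operators, phi is an H-invariant finitely additive measure on G.
  By thinness of triangles, nearest-point projections of a point to H form uniformly finite sets,
  and for g outside H all points except those projecting into a fixed finite set F are moved by g
  into the exceptional set.  As H is infinite, the exceptional set has arbitrarily many disjoint
  H-translates, so it is null; Cauchy-Schwarz then gives tau(x u_g) = 0, and x is in L(H).

  The same map Theta (with Q = L(H)), applied after averaging over right translations by H with
  an invariant mean, is a conditional expectation onto L(H).
*)
theory Submission
  imports Defs
begin

text \<open>Two demands on \<open>\<Theta>\<close> pull against each other. It has to be
  \<open>Q\<close>-bimodular on all bounded operators, so the \<open>V\<close> lie in the commutant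
  of \<open>Q\<close>; and it has to send the group algebra into \<open>Q\<close>, although a sum of
  V^* y V has no evident reason to lie there. Compression by the projection \<open>e\<close> onto
  \<open>K\<close> is the natural candidate, but its values live on \<open>K\<close> only. On
  \<open>K\<close>, conjugation by \<open>J\<close> carries the compressed commutant of
  \<open>Q\<close> into its own commutant. Hence \<open>e y e\<close> commutes with every product of
  one member of the family and the adjoint of another, which forces each \<open>V\<close> to
  intertwine \<open>\<Theta> y\<close> with \<open>e y e\<close>; membership in \<open>Q\<close>
  then follows from the bicommutant. Since \<open>\<Theta> (u g)\<close> already lies in
  \<open>Q\<close>, \<open>E\<close> leaves it alone: this is how a possibly singular
  \<open>E\<close> still yields the trace. Operators are produced from bounded sesquilinear forms.
  Projections and the family \<open>F\<close> both come from one Zorn argument on families whose sum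
  of V^* V is at most 1, in place of partial isometries and limits.\<close>

lemma discriminant_bound:
  fixes a d :: real and b :: complex
  assumes pos: "\<And>c. 0 \<le> a + 2 * Re (c * b) + (cmod c)\<^sup>2 * d" and d: "0 \<le> d"
  shows "(cmod b)\<^sup>2 \<le> a * d"
proof (cases "d = 0")
  case True
  have "b = 0"
  proof (rule ccontr)
    assume "b \<noteq> 0"
    then have b: "(cmod b)\<^sup>2 > 0" by simp
    \<comment> \<open>With this \<open>t\<close> the expression takes the value -1 at
      \<open>c = - t * cnj b\<close>: a nonzero linear term without a quadratic one is unbounded
      below.\<close>
    define t where "t = (a + 1) / (2 * (cmod b)\<^sup>2)"
    have "Re (- complex_of_real t * cnj b * b) = - t * (cmod b)\<^sup>2"
      by (simp add: cmod_power2) (simp add: power2_eq_square algebra_simps)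
    with pos[of "- complex_of_real t * cnj b"] True have "0 \<le> a - 2 * t * (cmod b)\<^sup>2" by simp
    moreover have "2 * t * (cmod b)\<^sup>2 = a + 1" using b by (simp add: t_def)
    ultimately show False by simp
  qed
  with True show ?thesis by simp
next
  case False
  with d have d: "d > 0" by simp
  \<comment> \<open>\<open>c = - cnj b / d\<close> minimises the expression, and the minimum is a -
    |b|^2 / d.\<close>
  have 1: "Re (- (cnj b / complex_of_real d) * b) = - (cmod b)\<^sup>2 / d"
    by (simp add: cmod_power2) (simp add: power2_eq_square add_divide_distrib diff_divide_distrib)
  have 2: "(cmod (- (cnj b / complex_of_real d)))\<^sup>2 * d = (cmod b)\<^sup>2 / d"
    using d by (simp add: norm_divide power2_eq_square)
  from pos[of "- (cnj b / complex_of_real d)"] have "0 \<le> a - (cmod b)\<^sup>2 / d"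
    unfolding 1 2 by simp
  with d show ?thesis by (simp add: field_simps)
qed

section \<open>Square-summable functions\<close>

lemma ell2_outside: "f \<in> ell2 A \<Longrightarrow> x \<notin> A \<Longrightarrow> f x = 0"
  by (simp add: ell2_def)

lemma ell2_summable: "f \<in> ell2 A \<Longrightarrow> (\<lambda>x. (cmod (f x))\<^sup>2) summable_on A"
  by (simp add: ell2_def)

lemma ell2_boundedI:
  assumes "\<And>x. x \<notin> A \<Longrightarrow> f x = 0"
    and "\<And>S. finite S \<Longrightarrow> S \<subseteq> A \<Longrightarrow> (\<Sum>x\<in>S. (cmod (f x))\<^sup>2) \<le> K"
  shows "f \<in> ell2 A"
proof -
  have "(\<lambda>x. (cmod (f x))\<^sup>2) summable_on A"
    by (rule nonneg_bounded_partial_sums_imp_summable_on[where C = K])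
       (auto simp: eventually_finite_subsets_at_top intro!: exI[of _ "{}"] assms(2))
  with assms(1) show ?thesis by (simp add: ell2_def)
qed

lemma zero_in_ell2 [simp]: "(\<lambda>_. 0) \<in> ell2 A"
  by (simp add: ell2_def)

lemma ell2_scale [intro, simp]: "f \<in> ell2 A \<Longrightarrow> (\<lambda>x. c * f x) \<in> ell2 A"
  by (simp add: ell2_def norm_mult power_mult_distrib summable_on_cmult_right)

lemma ell2_add [intro, simp]:
  assumes "f \<in> ell2 A" "g \<in> ell2 A" shows "(\<lambda>x. f x + g x) \<in> ell2 A"
proof -
  have "(\<lambda>x. 2 * (cmod (f x))\<^sup>2 + 2 * (cmod (g x))\<^sup>2) summable_on A"
    by (intro summable_on_add summable_on_cmult_right ell2_summable assms)
  then have "(\<lambda>x. (cmod (f x + g x))\<^sup>2) summable_on A"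
  proof (rule summable_on_comparison_test)
    fix x
    have "(cmod (f x + g x))\<^sup>2 \<le> (cmod (f x) + cmod (g x))\<^sup>2"
      by (intro power_mono norm_triangle_ineq) simp
    also have "\<dots> \<le> 2 * (cmod (f x))\<^sup>2 + 2 * (cmod (g x))\<^sup>2"
      using sum_squares_bound[of "cmod (f x)" "cmod (g x)"] by (simp add: power2_sum)
    finally show "(cmod (f x + g x))\<^sup>2 \<le> 2 * (cmod (f x))\<^sup>2 + 2 * (cmod (g x))\<^sup>2" .
  qed simp
  with assms show ?thesis by (simp add: ell2_def)
qed

lemma ell2_diff [intro, simp]:
  "f \<in> ell2 A \<Longrightarrow> g \<in> ell2 A \<Longrightarrow> (\<lambda>x. f x - g x) \<in> ell2 A"
  using ell2_add[OF _ ell2_scale[of g A "-1"], of f] by simp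

lemma ell2_finite_support:
  assumes "finite S" "S \<subseteq> A" "\<And>x. x \<notin> S \<Longrightarrow> f x = 0"
  shows "f \<in> ell2 A"
proof -
  have "(\<lambda>x. (cmod (f x))\<^sup>2) summable_on A"
    by (rule finite_nonzero_values_imp_summable_on, rule finite_subset[OF _ assms(1)])
       (use assms(3) in force)
  then show ?thesis using assms by (auto simp: ell2_def)
qed

definition kron :: "'a \<Rightarrow> 'a \<Rightarrow> complex" where
  "kron x = (\<lambda>y. if y = x then 1 else 0)"

lemma kron_ell2 [intro, simp]: "x \<in> A \<Longrightarrow> kron x \<in> ell2 A"
  by (rule ell2_finite_support[of "{x}"]) (auto simp: kron_def)

lemma inner_abs_summable:
  assumes "f \<in> ell2 A" "g \<in> ell2 A"
  shows "(\<lambda>x. norm (f x * cnj (g x))) summable_on A"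
proof -
  have "(\<lambda>x. (cmod (f x))\<^sup>2 + (cmod (g x))\<^sup>2) summable_on A"
    by (intro summable_on_add ell2_summable assms)
  then show ?thesis
  proof (rule summable_on_comparison_test)
    fix x
    show "cmod (f x * cnj (g x)) \<le> (cmod (f x))\<^sup>2 + (cmod (g x))\<^sup>2"
      using sum_squares_bound[of "cmod (f x)" "cmod (g x)"]
        mult_nonneg_nonneg[of "cmod (f x)" "cmod (g x)"]
      by (simp add: norm_mult del: mult_nonneg_nonneg)
  qed simp
qed

lemma inner_summable:
  "f \<in> ell2 A \<Longrightarrow> g \<in> ell2 A \<Longrightarrow> (\<lambda>x. f x * cnj (g x)) summable_on A"
  by (rule abs_summable_summable[OF inner_abs_summable])

lemma inner_add_left:
  "f \<in> ell2 A \<Longrightarrow> f' \<in> ell2 A \<Longrightarrow> g \<in> ell2 A \<Longrightarrow>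
    ell2_inner A (\<lambda>x. f x + f' x) g = ell2_inner A f g + ell2_inner A f' g"
  by (simp add: ell2_inner_def distrib_right infsum_add inner_summable)

lemma inner_scale_left: "ell2_inner A (\<lambda>x. c * f x) g = c * ell2_inner A f g"
  unfolding ell2_inner_def mult.assoc by (rule infsum_cmult_right')

lemma inner_commute: "ell2_inner A g f = cnj (ell2_inner A f g)"
  unfolding ell2_inner_def infsum_cnj[symmetric] by (simp add: mult.commute)

lemma inner_add_right:
  "f \<in> ell2 A \<Longrightarrow> g \<in> ell2 A \<Longrightarrow> g' \<in> ell2 A \<Longrightarrow>
    ell2_inner A f (\<lambda>x. g x + g' x) = ell2_inner A f g + ell2_inner A f g'"
  by (simp add: ell2_inner_def distrib_left infsum_add inner_summable)

lemma inner_scale_right: "ell2_inner A f (\<lambda>x. c * g x) = cnj c * ell2_inner A f g"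
  by (subst (1 2) inner_commute) (simp add: inner_scale_left)

lemma inner_diff_left:
  "f \<in> ell2 A \<Longrightarrow> f' \<in> ell2 A \<Longrightarrow> g \<in> ell2 A \<Longrightarrow>
    ell2_inner A (\<lambda>x. f x - f' x) g = ell2_inner A f g - ell2_inner A f' g"
  using inner_add_left[of f A "\<lambda>x. -1 * f' x" g] inner_scale_left[of A "-1" f' g]
    ell2_scale[of f' A "-1"] by simp

lemma inner_zero_left [simp]: "ell2_inner A (\<lambda>_. 0) g = 0"
  by (simp add: ell2_inner_def)

lemma inner_zero_right [simp]: "ell2_inner A f (\<lambda>_. 0) = 0"
  by (simp add: ell2_inner_def)

lemma norm_nonneg [simp]: "0 \<le> ell2_norm A f"
  by (simp add: ell2_norm_def infsum_nonneg)

lemma norm_sq: "(ell2_norm A f)\<^sup>2 = (\<Sum>\<^sub>\<infinity>x\<in>A. (cmod (f x))\<^sup>2)"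
  by (simp add: ell2_norm_def infsum_nonneg)

lemma norm_zero [simp]: "ell2_norm A (\<lambda>_. 0) = 0"
  by (simp add: ell2_norm_def)

lemma infsum_complex_of_real:
  "(\<Sum>\<^sub>\<infinity>x\<in>A. complex_of_real (f x)) = complex_of_real (\<Sum>\<^sub>\<infinity>x\<in>A. f x)"
proof (rule infsum_bounded_linear_strong)
  show "(\<lambda>x. complex_of_real (f x)) summable_on A \<longleftrightarrow> f summable_on A"
    by (rule summable_on_bounded_linear_iff[of _ Re]) (auto intro: bounded_linear_of_real bounded_linear_Re)
qed (rule bounded_linear_of_real)

lemma inner_self: "ell2_inner A f f = complex_of_real ((ell2_norm A f)\<^sup>2)"
proof -
  have "(\<lambda>x. f x * cnj (f x)) = (\<lambda>x. complex_of_real ((cmod (f x))\<^sup>2))"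
    by (simp add: complex_norm_square del: of_real_power)
  then show ?thesis
    unfolding ell2_inner_def norm_sq
    by (simp only:) (rule infsum_complex_of_real)
qed

lemma inner_self_nonneg [simp]: "ell2_inner A f f \<in> \<real>\<^sub>\<ge>\<^sub>0"
  by (simp add: inner_self del: of_real_power)

lemma norm_add_scale_sq:
  assumes "f \<in> ell2 A" "g \<in> ell2 A"
  shows "(ell2_norm A (\<lambda>x. f x + c * g x))\<^sup>2 =
    (ell2_norm A f)\<^sup>2 + 2 * Re (c * ell2_inner A g f) + (cmod c)\<^sup>2 * (ell2_norm A g)\<^sup>2"
proof -
  have *: "(ell2_norm A h)\<^sup>2 = Re (ell2_inner A h h)" for h
    by (simp add: inner_self del: of_real_power)
  have 1: "ell2_inner A f g = cnj (ell2_inner A g f)" by (rule inner_commute)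
  have 2: "ell2_inner A (\<lambda>x. f x + c * g x) (\<lambda>x. f x + c * g x)
      = ell2_inner A f f + c * ell2_inner A g f + cnj (c * ell2_inner A g f)
        + (c * cnj c) * ell2_inner A g g"
    using assms
    by (simp add: inner_add_left inner_add_right inner_scale_left inner_scale_right 1 algebra_simps)
  show ?thesis unfolding * 2
    by (simp only: plus_complex.sel cnj.sel)
       (simp add: complex_mult_cnj cmod_power2 inner_self del: of_real_power)
qed

lemma inner_Cauchy_Schwarz:
  assumes "f \<in> ell2 A" "g \<in> ell2 A"
  shows "cmod (ell2_inner A f g) \<le> ell2_norm A f * ell2_norm A g"
proof -
  have "(cmod (ell2_inner A g f))\<^sup>2 \<le> (ell2_norm A f)\<^sup>2 * (ell2_norm A g)\<^sup>2"
    by (rule discriminant_bound) (simp_all only: norm_add_scale_sq[OF assms, symmetric] zero_le_power2)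
  then have "cmod (ell2_inner A g f) \<le> ell2_norm A f * ell2_norm A g"
    by (simp flip: power_mult_distrib) 
  then show ?thesis by (subst inner_commute) simp
qed

lemma inner_kron: "x \<in> A \<Longrightarrow> ell2_inner A f (kron x) = f x"
proof -
  assume x: "x \<in> A"
  have "(\<Sum>\<^sub>\<infinity>y\<in>A. f y * cnj (kron x y)) = (\<Sum>\<^sub>\<infinity>y\<in>{x}. f y * cnj (kron x y))"
    by (rule infsum_cong_neutral) (use x in \<open>auto simp: kron_def\<close>)
  then show ?thesis by (simp add: ell2_inner_def kron_def)
qed

lemma norm_kron [simp]: "x \<in> A \<Longrightarrow> ell2_norm A (kron x) = 1"
proof -
  assume "x \<in> A"
  then have "complex_of_real ((ell2_norm A (kron x))\<^sup>2) = 1"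
    by (simp only: inner_self[symmetric] inner_kron) (simp add: kron_def)
  then show ?thesis by (simp only: of_real_eq_1_iff) (use norm_nonneg[of A "kron x"] in \<open>auto simp: power2_eq_1_iff simp del: norm_nonneg\<close>)
qed

lemma ell2_eqI:
  assumes "f \<in> ell2 A" "g \<in> ell2 A"
    and "\<And>h. h \<in> ell2 A \<Longrightarrow> ell2_inner A f h = ell2_inner A g h"
  shows "f = g"
proof
  fix x show "f x = g x"
    using assms(3)[of "kron x"] assms(1,2)
    by (cases "x \<in> A") (auto simp: inner_kron ell2_outside)
qed

lemma ell2_ext:
  assumes "f \<in> ell2 A" "g \<in> ell2 A" "\<And>x. x \<in> A \<Longrightarrow> f x = g x"
  shows "f = g"
proof
  fix x show "f x = g x"
    using assms by (cases "x \<in> A") (auto simp: ell2_outside)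
qed

lemma norm_eq_zero: "f \<in> ell2 A \<Longrightarrow> ell2_norm A f = 0 \<Longrightarrow> f = (\<lambda>_. 0)"
  by (rule ell2_eqI) (use inner_Cauchy_Schwarz[of f A] in auto)

lemma norm_scale: "ell2_norm A (\<lambda>x. c * f x) = cmod c * ell2_norm A f"
  by (simp add: ell2_norm_def norm_mult power_mult_distrib infsum_cmult_right' real_sqrt_mult)

lemma norm_sq_finite_support:
  assumes "finite S" "S \<subseteq> A" "\<And>x. x \<notin> S \<Longrightarrow> f x = 0"
  shows "(ell2_norm A f)\<^sup>2 = (\<Sum>x\<in>S. (cmod (f x))\<^sup>2)"
proof -
  have "(\<Sum>\<^sub>\<infinity>x\<in>A. (cmod (f x))\<^sup>2) = (\<Sum>\<^sub>\<infinity>x\<in>S. (cmod (f x))\<^sup>2)"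
    by (rule infsum_cong_neutral) (use assms in auto)
  with assms(1) show ?thesis by (simp add: norm_sq)
qed

lemma norm_sq_truncation:
  assumes f: "f \<in> ell2 A" and S: "finite S" "S \<subseteq> A"
  shows "(ell2_norm A (\<lambda>x. f x - (if x \<in> S then f x else 0)))\<^sup>2
    = (ell2_norm A f)\<^sup>2 - (\<Sum>x\<in>S. (cmod (f x))\<^sup>2)"
proof -
  let ?F = "\<lambda>x. (cmod (f x))\<^sup>2"
  have 1: "(\<Sum>\<^sub>\<infinity>x\<in>A. (cmod (f x - (if x \<in> S then f x else 0)))\<^sup>2) = infsum ?F (A - S)"
    by (rule infsum_cong_neutral) auto
  have 2: "infsum ?F A = infsum ?F (A - S) + infsum ?F S"
    using infsum_Un_disjoint[of ?F "A - S" S] S ell2_summable[OF f]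
      summable_on_subset_banach[of ?F A "A - S"]
    by (simp add: Un_absorb2 Diff_Int_distrib2 Diff_disjoint[THEN Int_commute[THEN trans]])
  show ?thesis using S by (simp add: norm_sq 1 2)
qed

text \<open>It lets an identity between bounded forms be checked on finitely supported
  vectors.\<close>

lemma truncation_approx:
  assumes f: "f \<in> ell2 A" and e: "0 < e"
  obtains S where "finite S" "S \<subseteq> A" "ell2_norm A (\<lambda>x. f x - (if x \<in> S then f x else 0)) < e"
proof -
  let ?F = "\<lambda>x. (cmod (f x))\<^sup>2"
  have e2: "0 < e\<^sup>2 / 2" using e by simp
  obtain S where S: "finite S" "S \<subseteq> A" "dist (sum ?F S) (infsum ?F A) \<le> e\<^sup>2 / 2"
    using infsum_finite_approximation[OF ell2_summable[OF f] e2] by blast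
  have "(ell2_norm A f)\<^sup>2 - sum ?F S < e\<^sup>2"
    using S(3) e2 unfolding norm_sq dist_real_def by linarith
  then have "(ell2_norm A (\<lambda>x. f x - (if x \<in> S then f x else 0)))\<^sup>2 < e\<^sup>2"
    by (simp only: norm_sq_truncation[OF f S(1,2)])
  with e have "ell2_norm A (\<lambda>x. f x - (if x \<in> S then f x else 0)) < e"
    by (simp add: power_less_imp_less_base)
  with S that show thesis by blast
qed

section \<open>Bounded operators and bounded forms\<close>

lemma op_in: "T \<in> bounded_ops A \<Longrightarrow> f \<in> ell2 A \<Longrightarrow> T f \<in> ell2 A"
  by (simp add: bounded_ops_def)

lemma op_outside: "T \<in> bounded_ops A \<Longrightarrow> f \<notin> ell2 A \<Longrightarrow> T f = (\<lambda>_. 0)"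
  by (simp add: bounded_ops_def)

lemma op_add:
  "T \<in> bounded_ops A \<Longrightarrow> f \<in> ell2 A \<Longrightarrow> g \<in> ell2 A \<Longrightarrow>
    T (\<lambda>x. f x + g x) = (\<lambda>x. T f x + T g x)"
  by (simp add: bounded_ops_def)

lemma op_scale: "T \<in> bounded_ops A \<Longrightarrow> f \<in> ell2 A \<Longrightarrow> T (\<lambda>x. c * f x) = (\<lambda>x. c * T f x)"
  by (simp add: bounded_ops_def)

lemma op_zero: "T \<in> bounded_ops A \<Longrightarrow> T (\<lambda>_. 0) = (\<lambda>_. 0)"
  using op_scale[of T A "\<lambda>_. 0" 0] by simp

lemma op_ell2: "T \<in> bounded_ops A \<Longrightarrow> T f \<in> ell2 A"
  by (cases "f \<in> ell2 A") (simp_all add: op_in op_outside)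

lemma op_bound:
  assumes "T \<in> bounded_ops A"
  shows "\<exists>K>0. \<forall>f\<in>ell2 A. ell2_norm A (T f) \<le> K * ell2_norm A f"
proof -
  have "\<exists>K. \<forall>f\<in>ell2 A. ell2_norm A (T f) \<le> K * ell2_norm A f"
    using assms by (simp add: bounded_ops_def)
  then obtain K where K: "\<And>f. f \<in> ell2 A \<Longrightarrow> ell2_norm A (T f) \<le> K * ell2_norm A f"
    by blast
  have "K * ell2_norm A f \<le> max K 1 * ell2_norm A f" for f
    by (rule mult_right_mono) auto
  with K have "\<forall>f\<in>ell2 A. ell2_norm A (T f) \<le> max K 1 * ell2_norm A f"
    by (meson order_trans)
  then show ?thesis by (intro exI[of _ "max K 1"]) auto
qed

lemma bounded_opsI:
  assumes "\<And>f. f \<in> ell2 A \<Longrightarrow> T f \<in> ell2 A"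
    and "\<And>f. f \<notin> ell2 A \<Longrightarrow> T f = (\<lambda>_. 0)"
    and "\<And>f g. f \<in> ell2 A \<Longrightarrow> g \<in> ell2 A \<Longrightarrow> T (\<lambda>x. f x + g x) = (\<lambda>x. T f x + T g x)"
    and "\<And>c f. f \<in> ell2 A \<Longrightarrow> T (\<lambda>x. c * f x) = (\<lambda>x. c * T f x)"
    and "\<And>f. f \<in> ell2 A \<Longrightarrow> ell2_norm A (T f) \<le> K * ell2_norm A f"
  shows "T \<in> bounded_ops A"
  unfolding bounded_ops_def by (intro CollectI conjI ballI allI impI exI[of _ K]) (rule assms; assumption)+

lemma op_eqI:
  assumes "T \<in> bounded_ops A" "S \<in> bounded_ops A"
    and "\<And>f g. f \<in> ell2 A \<Longrightarrow> g \<in> ell2 A \<Longrightarrow> ell2_inner A (T f) g = ell2_inner A (S f) g"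
  shows "T = S"
proof
  fix f show "T f = S f"
    by (cases "f \<in> ell2 A")
       (use assms(1,2) in \<open>simp_all add: op_outside ell2_eqI[OF _ _ assms(3)] op_in\<close>)
qed

lemma comp_bounded [intro]:
  assumes T: "T \<in> bounded_ops A" and S: "S \<in> bounded_ops A"
  shows "T \<circ> S \<in> bounded_ops A"
proof -
  obtain K where K: "0 < K" "\<And>f. f \<in> ell2 A \<Longrightarrow> ell2_norm A (T f) \<le> K * ell2_norm A f"
    using op_bound[OF T] by blast
  obtain L where L: "0 < L" "\<And>f. f \<in> ell2 A \<Longrightarrow> ell2_norm A (S f) \<le> L * ell2_norm A f"
    using op_bound[OF S] by blast
  have "ell2_norm A (T (S f)) \<le> (K * L) * ell2_norm A f" if "f \<in> ell2 A" for f
    using order_trans[OF K(2)[OF op_in[OF S that]] mult_left_mono[OF L(2)[OF that], of K]] K(1)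
    by (simp add: mult.assoc)
  then show ?thesis
    by (intro bounded_opsI[where K = "K * L"])
       (auto simp: op_in[OF T] op_in[OF S] op_outside[OF S] op_add[OF S] op_add[OF T]
          op_scale[OF S] op_scale[OF T] op_zero[OF T])
qed

definition id_op :: "'a set \<Rightarrow> 'a oper" where
  "id_op A = (\<lambda>f. if f \<in> ell2 A then f else (\<lambda>_. 0))"

lemma id_op_bounded [simp]: "id_op A \<in> bounded_ops A"
  by (rule bounded_opsI[where K = 1]) (auto simp: id_op_def)

lemma id_op_apply [simp]: "f \<in> ell2 A \<Longrightarrow> id_op A f = f"
  by (simp add: id_op_def)

lemma id_op_comp: "T \<in> bounded_ops A \<Longrightarrow> id_op A \<circ> T = T"
  by (auto simp: op_ell2)

lemma comp_id_op: "T \<in> bounded_ops A \<Longrightarrow> T \<circ> id_op A = T"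
  by (rule ext) (simp add: id_op_def op_outside op_zero)

section \<open>Bounded sesquilinear forms and the operators representing them\<close>

definition bounded_form :: "'a set \<Rightarrow> (('a \<Rightarrow> complex) \<Rightarrow> ('a \<Rightarrow> complex) \<Rightarrow> complex) \<Rightarrow> bool" where
  "bounded_form A B \<longleftrightarrow>
    (\<forall>f\<in>ell2 A. \<forall>f'\<in>ell2 A. \<forall>g\<in>ell2 A. B (\<lambda>x. f x + f' x) g = B f g + B f' g) \<and>
    (\<forall>c. \<forall>f\<in>ell2 A. \<forall>g\<in>ell2 A. B (\<lambda>x. c * f x) g = c * B f g) \<and>
    (\<forall>f\<in>ell2 A. \<forall>g\<in>ell2 A. \<forall>g'\<in>ell2 A. B f (\<lambda>x. g x + g' x) = B f g + B f g') \<and>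
    (\<forall>c. \<forall>f\<in>ell2 A. \<forall>g\<in>ell2 A. B f (\<lambda>x. c * g x) = cnj c * B f g) \<and>
    (\<exists>C. \<forall>f\<in>ell2 A. \<forall>g\<in>ell2 A. cmod (B f g) \<le> C * (ell2_norm A f * ell2_norm A g))"

text \<open>Termwise estimates over a family of operators produce a sum of two squares on the right,
  not a product. Rescaling both arguments to unit vectors turns one into the other at the price of a
  factor 2; vectors of norm 0 cannot be rescaled and are treated apart.\<close>

lemma bounded_formI:
  assumes add_left: "\<And>f f' g. f \<in> ell2 A \<Longrightarrow> f' \<in> ell2 A \<Longrightarrow> g \<in> ell2 A \<Longrightarrow>
      B (\<lambda>x. f x + f' x) g = B f g + B f' g"
    and scale_left: "\<And>c f g. f \<in> ell2 A \<Longrightarrow> g \<in> ell2 A \<Longrightarrow> B (\<lambda>x. c * f x) g = c * B f g"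
    and add_right: "\<And>f g g'. f \<in> ell2 A \<Longrightarrow> g \<in> ell2 A \<Longrightarrow> g' \<in> ell2 A \<Longrightarrow>
      B f (\<lambda>x. g x + g' x) = B f g + B f g'"
    and scale_right: "\<And>c f g. f \<in> ell2 A \<Longrightarrow> g \<in> ell2 A \<Longrightarrow> B f (\<lambda>x. c * g x) = cnj c * B f g"
    and bound: "\<And>f g. f \<in> ell2 A \<Longrightarrow> g \<in> ell2 A \<Longrightarrow>
      cmod (B f g) \<le> C * ((ell2_norm A f)\<^sup>2 + (ell2_norm A g)\<^sup>2)"
  shows "bounded_form A B"
proof -
  have "cmod (B f g) \<le> (2 * C) * (ell2_norm A f * ell2_norm A g)" if f: "f \<in> ell2 A" and g: "g \<in> ell2 A" for f g
  proof (cases "ell2_norm A f = 0 \<or> ell2_norm A g = 0")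
    case True
    have "B (\<lambda>_. 0) g = 0" "B f (\<lambda>_. 0) = 0"
      using scale_left[of "\<lambda>_. 0" g 0] scale_right[of f "\<lambda>_. 0" 0] f g by auto
    moreover have "f = (\<lambda>_. 0) \<or> g = (\<lambda>_. 0)"
      using True norm_eq_zero[OF f] norm_eq_zero[OF g] by blast
    ultimately have "B f g = 0" by (elim disjE) (simp_all only:)
    with True show ?thesis by auto
  next
    case False
    define a where "a = ell2_norm A f"
    define b where "b = ell2_norm A g"
    have ab: "a > 0" "b > 0" using False by (simp_all add: a_def b_def order_less_le)
    let ?f = "\<lambda>x. complex_of_real (1/a) * f x" and ?g = "\<lambda>x. complex_of_real (1/b) * g x"
    have n: "ell2_norm A ?f = 1" "ell2_norm A ?g = 1"
      using ab unfolding norm_scale by (simp_all add: norm_divide a_def b_def)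
    have "B ?f ?g = complex_of_real (1/a) * (complex_of_real (1/b) * B f g)"
      using f g by (simp only: scale_left scale_right ell2_scale complex_cnj_complex_of_real)
    then have "cmod (B ?f ?g) = cmod (B f g) / (a * b)"
      using ab by (simp add: norm_mult norm_divide)
    moreover have "cmod (B ?f ?g) \<le> 2 * C"
      using bound[of ?f ?g] f g n by (simp del: of_real_divide)
    ultimately show ?thesis using ab by (simp add: field_simps a_def b_def)
  qed
  with add_left scale_left add_right scale_right show ?thesis unfolding bounded_form_def
    by (intro conjI ballI allI exI[of _ "2 * C"]) simp_all
qed

text \<open>Riesz representation by coordinates: the value at \<open>x\<close> has to be the pairing
  with \<open>kron x\<close>, so no limit is taken to produce the operator.\<close>

definition form_op :: "'a set \<Rightarrow> (('a \<Rightarrow> complex) \<Rightarrow> ('a \<Rightarrow> complex) \<Rightarrow> complex) \<Rightarrow> 'a oper" where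
  "form_op A B = (\<lambda>f. if f \<in> ell2 A then (\<lambda>x. if x \<in> A then B f (kron x) else 0) else (\<lambda>_. 0))"

context
  fixes A :: "'a set" and B
  assumes B: "bounded_form A B"
begin

lemma form_add_left: "f \<in> ell2 A \<Longrightarrow> f' \<in> ell2 A \<Longrightarrow> g \<in> ell2 A \<Longrightarrow>
      B (\<lambda>x. f x + f' x) g = B f g + B f' g"
  using B by (simp add: bounded_form_def)

lemma form_scale_left: "f \<in> ell2 A \<Longrightarrow> g \<in> ell2 A \<Longrightarrow> B (\<lambda>x. c * f x) g = c * B f g"
  using B by (simp add: bounded_form_def)

lemma form_add_right: "f \<in> ell2 A \<Longrightarrow> g \<in> ell2 A \<Longrightarrow> g' \<in> ell2 A \<Longrightarrow>
      B f (\<lambda>x. g x + g' x) = B f g + B f g'"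
  using B by (simp add: bounded_form_def)

lemma form_scale_right: "f \<in> ell2 A \<Longrightarrow> g \<in> ell2 A \<Longrightarrow> B f (\<lambda>x. c * g x) = cnj c * B f g"
  using B by (simp add: bounded_form_def)

lemma form_bound:
  "\<exists>C>0. \<forall>f\<in>ell2 A. \<forall>g\<in>ell2 A. cmod (B f g) \<le> C * (ell2_norm A f * ell2_norm A g)"
proof -
  have "\<exists>C. \<forall>f\<in>ell2 A. \<forall>g\<in>ell2 A. cmod (B f g) \<le> C * (ell2_norm A f * ell2_norm A g)"
    using B by (simp add: bounded_form_def)
  then obtain C where C: "\<And>f g. f \<in> ell2 A \<Longrightarrow> g \<in> ell2 A \<Longrightarrow>
      cmod (B f g) \<le> C * (ell2_norm A f * ell2_norm A g)"
    by blast
  have "C * (ell2_norm A f * ell2_norm A g) \<le> max C 1 * (ell2_norm A f * ell2_norm A g)" for f g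
    by (rule mult_right_mono) auto
  with C have "\<forall>f\<in>ell2 A. \<forall>g\<in>ell2 A.
      cmod (B f g) \<le> max C 1 * (ell2_norm A f * ell2_norm A g)"
    by (meson order_trans)
  then show ?thesis by (intro exI[of _ "max C 1"]) auto
qed

lemma form_finite_sum:
  assumes "f \<in> ell2 A" "finite S" "S \<subseteq> A"
  shows "B f (\<lambda>x. if x \<in> S then g x else 0) = (\<Sum>x\<in>S. B f (kron x) * cnj (g x))"
  using assms(2,3)
proof (induction S rule: finite_induct)
  case empty
  then show ?case using form_scale_right[of f "\<lambda>_. 0" 0] assms(1) by simp
next
  case (insert y S)
  have eq: "(\<lambda>x. if x \<in> insert y S then g x else 0)
      = (\<lambda>x. g y * kron y x + (if x \<in> S then g x else 0))"
    using insert.hyps by (auto simp: kron_def)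
  have "(\<lambda>x. if x \<in> S then g x else 0) \<in> ell2 A"
    using insert by (intro ell2_finite_support[of S]) auto
  with insert assms(1) show ?case
    unfolding eq by (simp add: form_add_right form_scale_right)
qed

lemma form_op_bounded [intro]: "form_op A B \<in> bounded_ops A"
  and inner_form_op: "f \<in> ell2 A \<Longrightarrow> g \<in> ell2 A \<Longrightarrow> ell2_inner A (form_op A B f) g = B f g"
proof -
  obtain C where C: "0 < C" "\<And>f g. f \<in> ell2 A \<Longrightarrow> g \<in> ell2 A \<Longrightarrow>
      cmod (B f g) \<le> C * (ell2_norm A f * ell2_norm A g)"
    using form_bound by blast
  have fin: "(\<Sum>x\<in>S. (cmod (B f (kron x)))\<^sup>2) \<le> (C * ell2_norm A f)\<^sup>2"
    if f: "f \<in> ell2 A" and S: "finite S" "S \<subseteq> A" for f S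
  proof -
    \<comment> \<open>Testing the form against its own truncated coefficients returns the squared
      norm of \<open>g\<close>; cancelling one factor bounds every finite partial sum.\<close>
    define g where "g = (\<lambda>x. if x \<in> S then B f (kron x) else 0)"
    have g: "g \<in> ell2 A" unfolding g_def by (rule ell2_finite_support[of S]) (use S in auto)
    have n: "(ell2_norm A g)\<^sup>2 = (\<Sum>x\<in>S. (cmod (B f (kron x)))\<^sup>2)"
      using norm_sq_finite_support[of S A g] S by (simp add: g_def)
    have "B f g = (\<Sum>x\<in>S. B f (kron x) * cnj (B f (kron x)))"
      unfolding g_def by (rule form_finite_sum[OF f S])
    also have "\<dots> = complex_of_real ((ell2_norm A g)\<^sup>2)"
      unfolding n of_real_sum by (simp add: complex_norm_square del: of_real_power)
    finally have "(ell2_norm A g)\<^sup>2 \<le> C * (ell2_norm A f * ell2_norm A g)"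
      using C(2)[OF f g] by (simp del: of_real_power)
    then have "ell2_norm A g \<le> C * ell2_norm A f"
      using C(1) by (cases "ell2_norm A g = 0")
        (auto simp: power2_eq_square mult.assoc[symmetric] order_less_le)
    then show ?thesis unfolding n[symmetric] by (rule power_mono) simp
  qed
  have mem: "form_op A B f \<in> ell2 A" if "f \<in> ell2 A" for f
  proof (rule ell2_boundedI[where K = "(C * ell2_norm A f)\<^sup>2"])
    fix S assume S: "finite S" "S \<subseteq> A"
    have "(\<Sum>x\<in>S. (cmod (form_op A B f x))\<^sup>2) = (\<Sum>x\<in>S. (cmod (B f (kron x)))\<^sup>2)"
      by (rule sum.cong) (use S that in \<open>auto simp: form_op_def\<close>)
    also have "\<dots> \<le> (C * ell2_norm A f)\<^sup>2" by (rule fin[OF that S])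
    finally show "(\<Sum>x\<in>S. (cmod (form_op A B f x))\<^sup>2) \<le> (C * ell2_norm A f)\<^sup>2" .
  qed (simp add: form_op_def)
  have bd: "ell2_norm A (form_op A B f) \<le> C * ell2_norm A f" if f: "f \<in> ell2 A" for f
  proof (rule power2_le_imp_le)
    have "infsum (\<lambda>x. (cmod (form_op A B f x))\<^sup>2) A \<le> (C * ell2_norm A f)\<^sup>2"
    proof (rule infsum_le_finite_sums)
      fix S assume S: "finite S" "S \<subseteq> A"
      have "(\<Sum>x\<in>S. (cmod (form_op A B f x))\<^sup>2) = (\<Sum>x\<in>S. (cmod (B f (kron x)))\<^sup>2)"
        by (rule sum.cong) (use S that in \<open>auto simp: form_op_def\<close>)
      then show "(\<Sum>x\<in>S. (cmod (form_op A B f x))\<^sup>2) \<le> (C * ell2_norm A f)\<^sup>2"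
        using fin[OF f S] by simp
    qed (rule ell2_summable[OF mem[OF f]])
    then show "(ell2_norm A (form_op A B f))\<^sup>2 \<le> (C * ell2_norm A f)\<^sup>2"
      by (simp only: norm_sq)
  qed (use C in simp)
  show "form_op A B \<in> bounded_ops A"
  proof (rule bounded_opsI[where K = C])
    fix f g assume "f \<in> ell2 A" "g \<in> ell2 A"
    then show "form_op A B (\<lambda>x. f x + g x) = (\<lambda>x. form_op A B f x + form_op A B g x)"
      by (auto simp: form_op_def form_add_left)
  next
    fix c f assume "f \<in> ell2 A"
    then show "form_op A B (\<lambda>x. c * f x) = (\<lambda>x. c * form_op A B f x)"
      by (auto simp: form_op_def form_scale_left)
  qed (use mem bd in \<open>auto simp: form_op_def\<close>)
  show "ell2_inner A (form_op A B f) g = B f g" if f: "f \<in> ell2 A" and g: "g \<in> ell2 A"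
  proof (rule ccontr)
    assume "ell2_inner A (form_op A B f) g \<noteq> B f g"
    define r where "r = cmod (ell2_inner A (form_op A B f) g - B f g)"
    have r: "r > 0" using \<open>_ \<noteq> _\<close> by (simp add: r_def)
    \<comment> \<open>\<open>D\<close> dominates the norm of the functional that maps
      \<open>g\<close> to the difference of the two sides; the summand 1 keeps the division by
      \<open>D\<close> legitimate when \<open>f\<close> is zero.\<close>
    define D where "D = 2 * C * ell2_norm A f + 1"
    have D: "D > 0" using C by (simp add: D_def add_nonneg_pos)
    obtain S where S: "finite S" "S \<subseteq> A"
      and small: "ell2_norm A (\<lambda>x. g x - (if x \<in> S then g x else 0)) < r / D"
      using truncation_approx[OF g, of "r / D"] r D by auto
    define g1 where "g1 = (\<lambda>x. if x \<in> S then g x else 0)"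
    define g2 where "g2 = (\<lambda>x. g x - (if x \<in> S then g x else 0))"
    have g1: "g1 \<in> ell2 A" unfolding g1_def by (rule ell2_finite_support[of S]) (use S in auto)
    have g2: "g2 \<in> ell2 A" using ell2_diff[OF g g1] by (simp add: g1_def g2_def)
    have g12: "g = (\<lambda>x. g1 x + g2 x)" by (simp add: g1_def g2_def)
    have "ell2_inner A (form_op A B f) g1 = (\<Sum>x\<in>S. form_op A B f x * cnj (g x))"
      unfolding ell2_inner_def
      by (subst infsum_cong_neutral[where T = S and g = "\<lambda>x. form_op A B f x * cnj (g x)"])
         (use S in \<open>auto simp: g1_def\<close>)
    also have "\<dots> = (\<Sum>x\<in>S. B f (kron x) * cnj (g x))"
      by (rule sum.cong) (use S f in \<open>auto simp: form_op_def\<close>)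
    also have "\<dots> = B f g1" unfolding g1_def by (rule form_finite_sum[OF f S, symmetric])
    finally have "ell2_inner A (form_op A B f) g - B f g = ell2_inner A (form_op A B f) g2 - B f g2"
      using f g1 g2 mem[OF f] unfolding g12 by (simp add: inner_add_right form_add_right)
    then have "r \<le> cmod (ell2_inner A (form_op A B f) g2) + cmod (B f g2)"
      unfolding r_def by (simp add: norm_triangle_ineq4)
    also have "\<dots> \<le> ell2_norm A (form_op A B f) * ell2_norm A g2 + C * (ell2_norm A f * ell2_norm A g2)"
      by (intro add_mono inner_Cauchy_Schwarz C mem f g2)
    also have "\<dots> \<le> (C * ell2_norm A f) * ell2_norm A g2 + C * (ell2_norm A f * ell2_norm A g2)"
      by (intro add_mono mult_right_mono bd f) auto
    also have "\<dots> \<le> D * ell2_norm A g2" by (simp add: D_def algebra_simps)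
    also have "\<dots> < D * (r / D)" using small D unfolding g2_def by (intro mult_strict_left_mono)
    also have "\<dots> = r" using D by simp
    finally show False by simp
  qed
qed

end

lemma inner_op_bounded_form:
  assumes T: "T \<in> bounded_ops A" and S: "S \<in> bounded_ops A"
  shows "bounded_form A (\<lambda>f g. ell2_inner A (T f) (S g))"
proof -
  obtain K where K: "0 < K" "\<And>f. f \<in> ell2 A \<Longrightarrow> ell2_norm A (T f) \<le> K * ell2_norm A f"
    using op_bound[OF T] by blast
  obtain L where L: "0 < L" "\<And>f. f \<in> ell2 A \<Longrightarrow> ell2_norm A (S f) \<le> L * ell2_norm A f"
    using op_bound[OF S] by blast
  have "cmod (ell2_inner A (T f) (S g)) \<le> (K * L) * (ell2_norm A f * ell2_norm A g)"
    if "f \<in> ell2 A" "g \<in> ell2 A" for f g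
  proof -
    have "cmod (ell2_inner A (T f) (S g)) \<le> ell2_norm A (T f) * ell2_norm A (S g)"
      by (intro inner_Cauchy_Schwarz op_ell2 T S)
    also have "\<dots> \<le> (K * ell2_norm A f) * (L * ell2_norm A g)"
      using K(1) by (intro mult_mono K L that) auto
    finally show ?thesis by (simp add: mult_ac)
  qed
  then show ?thesis
    by (auto simp: bounded_form_def op_add[OF T] op_add[OF S] op_scale[OF T] op_scale[OF S]
        inner_add_left inner_add_right inner_scale_left inner_scale_right op_ell2[OF T] op_ell2[OF S])
qed

section \<open>Adjoints and linear combinations of operators\<close>

definition adj :: "'a set \<Rightarrow> 'a oper \<Rightarrow> 'a oper" where
  "adj A T = form_op A (\<lambda>f g. ell2_inner A f (T g))"

lemma id_op_bounded_form: "T \<in> bounded_ops A \<Longrightarrow> bounded_form A (\<lambda>f g. ell2_inner A f (T g))"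
  using inner_op_bounded_form[OF id_op_bounded, of T A] unfolding bounded_form_def
  by (simp add: op_add op_scale)

lemma adj_bounded [intro, simp]: "T \<in> bounded_ops A \<Longrightarrow> adj A T \<in> bounded_ops A"
  unfolding adj_def by (intro form_op_bounded id_op_bounded_form)

lemma inner_adj_left:
  "T \<in> bounded_ops A \<Longrightarrow> f \<in> ell2 A \<Longrightarrow> g \<in> ell2 A \<Longrightarrow>
    ell2_inner A (adj A T f) g = ell2_inner A f (T g)"
  unfolding adj_def by (rule inner_form_op[OF id_op_bounded_form])

lemma inner_adj_right:
  "T \<in> bounded_ops A \<Longrightarrow> f \<in> ell2 A \<Longrightarrow> g \<in> ell2 A \<Longrightarrow>
    ell2_inner A f (adj A T g) = ell2_inner A (T f) g"
  by (subst (1 2) inner_commute) (simp add: inner_adj_left)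

lemma adj_unique:
  assumes "T \<in> bounded_ops A" "S \<in> bounded_ops A"
    and "\<And>f g. f \<in> ell2 A \<Longrightarrow> g \<in> ell2 A \<Longrightarrow> ell2_inner A (S f) g = ell2_inner A f (T g)"
  shows "adj A T = S"
  by (rule op_eqI) (use assms in \<open>auto simp: inner_adj_left\<close>)

lemma adj_adj [simp]: "T \<in> bounded_ops A \<Longrightarrow> adj A (adj A T) = T"
  by (rule adj_unique) (auto simp: inner_adj_right)

lemma adj_comp:
  "T \<in> bounded_ops A \<Longrightarrow> S \<in> bounded_ops A \<Longrightarrow> adj A (T \<circ> S) = adj A S \<circ> adj A T"
  by (rule adj_unique) (auto simp: inner_adj_left op_ell2)

lemma is_adjoint_adj: "T \<in> bounded_ops A \<Longrightarrow> is_adjoint A T (adj A T)"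
  by (simp add: is_adjoint_def inner_adj_right)

lemma is_adjoint_unique:
  "T \<in> bounded_ops A \<Longrightarrow> S \<in> bounded_ops A \<Longrightarrow> is_adjoint A T S \<Longrightarrow> S = adj A T"
  by (rule op_eqI)
     (auto simp: is_adjoint_def inner_adj_left, subst (1 2) inner_commute, simp)

lemma norm_triangle:
  assumes "f \<in> ell2 A" "g \<in> ell2 A"
  shows "ell2_norm A (\<lambda>x. f x + g x) \<le> ell2_norm A f + ell2_norm A g"
proof (rule power2_le_imp_le)
  have "Re (ell2_inner A g f) \<le> ell2_norm A f * ell2_norm A g"
    using inner_Cauchy_Schwarz[OF assms(2,1)] complex_Re_le_cmod[of "ell2_inner A g f"]
    by (simp add: mult.commute)
  then show "(ell2_norm A (\<lambda>x. f x + g x))\<^sup>2 \<le> (ell2_norm A f + ell2_norm A g)\<^sup>2"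
    using norm_add_scale_sq[OF assms, of 1] by (simp add: power2_sum)
qed simp

lemma add_op_bounded [intro]:
  assumes T: "T \<in> bounded_ops A" and S: "S \<in> bounded_ops A"
  shows "(\<lambda>f x. T f x + S f x) \<in> bounded_ops A"
proof -
  obtain K where K: "0 < K" "\<And>f. f \<in> ell2 A \<Longrightarrow> ell2_norm A (T f) \<le> K * ell2_norm A f"
    using op_bound[OF T] by blast
  obtain L where L: "0 < L" "\<And>f. f \<in> ell2 A \<Longrightarrow> ell2_norm A (S f) \<le> L * ell2_norm A f"
    using op_bound[OF S] by blast
  show ?thesis
  proof (rule bounded_opsI[where K = "K + L"])
    fix f assume f: "f \<in> ell2 A"
    show "ell2_norm A (\<lambda>x. T f x + S f x) \<le> (K + L) * ell2_norm A f"
      using norm_triangle[OF op_ell2[OF T] op_ell2[OF S], of f f] K(2)[OF f] L(2)[OF f]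
      by (simp add: distrib_right)
  qed (auto simp: op_ell2[OF T] op_outside[OF T] op_add[OF T] op_scale[OF T] distrib_left
         op_ell2[OF S] op_outside[OF S] op_add[OF S] op_scale[OF S])
qed

lemma scale_op_bounded [intro]:
  assumes T: "T \<in> bounded_ops A"
  shows "(\<lambda>f x. c * T f x) \<in> bounded_ops A"
proof -
  obtain K where K: "0 < K" "\<And>f. f \<in> ell2 A \<Longrightarrow> ell2_norm A (T f) \<le> K * ell2_norm A f"
    using op_bound[OF T] by blast
  show ?thesis
  proof (rule bounded_opsI[where K = "cmod c * K"])
    fix f assume "f \<in> ell2 A"
    from mult_left_mono[OF K(2)[OF this], of "cmod c"]
    show "ell2_norm A (\<lambda>x. c * T f x) \<le> cmod c * K * ell2_norm A f"
      by (simp add: norm_scale)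
  qed (auto simp: op_ell2[OF T] op_outside[OF T] op_add[OF T] op_scale[OF T] distrib_left)
qed

lemma diff_op_bounded [intro]:
  assumes "T \<in> bounded_ops A" "S \<in> bounded_ops A"
  shows "(\<lambda>f x. T f x - S f x) \<in> bounded_ops A"
proof -
  have "(\<lambda>f x. T f x + - 1 * S f x) \<in> bounded_ops A"
    by (intro add_op_bounded scale_op_bounded assms)
  then show ?thesis by simp
qed

section \<open>Families of operators and the associated completely positive maps\<close>

text \<open>The condition that the sum of V^* V is at most 1, phrased by finite sums of squared
  norms so that no operator topology occurs. The family is a set, so each operator counts
  once.\<close>

definition subunital :: "'a set \<Rightarrow> 'a oper set \<Rightarrow> bool" where
  "subunital A F \<longleftrightarrow> F \<subseteq> bounded_ops A \<and>
    (\<forall>f\<in>ell2 A. \<forall>F'. finite F' \<longrightarrow> F' \<subseteq> F \<longrightarrow>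
      (\<Sum>V\<in>F'. (ell2_norm A (V f))\<^sup>2) \<le> (ell2_norm A f)\<^sup>2)"

text \<open>The weak form of the sum of V^* T V. At \<open>T = id_op A\<close> it is the sum of V^*
  V, and \<open>defect\<close> is what that sum lacks of the identity.\<close>

definition cp_map :: "'a set \<Rightarrow> 'a oper set \<Rightarrow> 'a oper \<Rightarrow> 'a oper" where
  "cp_map A F T = form_op A (\<lambda>f g. \<Sum>\<^sub>\<infinity>V\<in>F. ell2_inner A (T (V f)) (V g))"

definition defect :: "'a set \<Rightarrow> 'a oper set \<Rightarrow> 'a oper" where
  "defect A F = (\<lambda>f x. id_op A f x - cp_map A F (id_op A) f x)"

context
  fixes A :: "'a set" and F
  assumes F: "subunital A F"
begin

lemma family_bounded: "V \<in> F \<Longrightarrow> V \<in> bounded_ops A"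
  using F by (auto simp: subunital_def)

lemma family_summable:
  assumes "f \<in> ell2 A"
  shows "(\<lambda>V. (ell2_norm A (V f))\<^sup>2) summable_on F"
    and "(\<Sum>\<^sub>\<infinity>V\<in>F. (ell2_norm A (V f))\<^sup>2) \<le> (ell2_norm A f)\<^sup>2"
proof -
  show *: "(\<lambda>V. (ell2_norm A (V f))\<^sup>2) summable_on F"
    by (rule nonneg_bounded_partial_sums_imp_summable_on[where C = "(ell2_norm A f)\<^sup>2"])
       (use F assms in \<open>auto simp: subunital_def eventually_finite_subsets_at_top intro!: exI[of _ "{}"]\<close>)
  show "(\<Sum>\<^sub>\<infinity>V\<in>F. (ell2_norm A (V f))\<^sup>2) \<le> (ell2_norm A f)\<^sup>2"
    by (rule infsum_le_finite_sums[OF *]) (use F assms in \<open>auto simp: subunital_def\<close>)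
qed

text \<open>Splitting the product of norms into squares matches what \<open>family_summable\<close>
  can sum over \<open>F\<close> and the shape of \<open>bounded_formI\<close>.\<close>

lemma cp_term_bound:
  assumes T: "T \<in> bounded_ops A"
  shows "\<exists>K>0. \<forall>f\<in>ell2 A. \<forall>g\<in>ell2 A. \<forall>V\<in>F. cmod (ell2_inner A (T (V f)) (V g))
      \<le> K * ((ell2_norm A (V f))\<^sup>2 + (ell2_norm A (V g))\<^sup>2)"
proof -
  obtain K where K: "0 < K" "\<And>f. f \<in> ell2 A \<Longrightarrow> ell2_norm A (T f) \<le> K * ell2_norm A f"
    using op_bound[OF T] by blast
  have "cmod (ell2_inner A (T (V f)) (V g)) \<le> K * ((ell2_norm A (V f))\<^sup>2 + (ell2_norm A (V g))\<^sup>2)"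
    if "V \<in> F" for f g V
  proof -
    have V: "V h \<in> ell2 A" for h by (rule op_ell2[OF family_bounded[OF that]])
    have "cmod (ell2_inner A (T (V f)) (V g)) \<le> ell2_norm A (T (V f)) * ell2_norm A (V g)"
      by (intro inner_Cauchy_Schwarz op_ell2 T V)
    also have "\<dots> \<le> (K * ell2_norm A (V f)) * ell2_norm A (V g)"
      by (intro mult_right_mono K V) simp
    also have "\<dots> \<le> K * ((ell2_norm A (V f))\<^sup>2 + (ell2_norm A (V g))\<^sup>2)"
    proof -
      have "0 \<le> ell2_norm A (V f) * ell2_norm A (V g)" by simp
      then have "ell2_norm A (V f) * ell2_norm A (V g) \<le> (ell2_norm A (V f))\<^sup>2 + (ell2_norm A (V g))\<^sup>2"
        using sum_squares_bound[of "ell2_norm A (V f)" "ell2_norm A (V g)"] by linarith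
      with K(1) show ?thesis by (simp add: mult.assoc)
    qed
    finally show ?thesis .
  qed
  with K(1) show ?thesis by blast
qed

lemma cp_summable:
  assumes T: "T \<in> bounded_ops A" and f: "f \<in> ell2 A" and g: "g \<in> ell2 A"
  shows "(\<lambda>V. cmod (ell2_inner A (T (V f)) (V g))) summable_on F"
    and "(\<lambda>V. ell2_inner A (T (V f)) (V g)) summable_on F"
proof -
  obtain K where K: "0 < K" "\<And>f g V. f \<in> ell2 A \<Longrightarrow> g \<in> ell2 A \<Longrightarrow> V \<in> F \<Longrightarrow>
      cmod (ell2_inner A (T (V f)) (V g)) \<le> K * ((ell2_norm A (V f))\<^sup>2 + (ell2_norm A (V g))\<^sup>2)"
    using cp_term_bound[OF T] by blast
  have "(\<lambda>V. K * ((ell2_norm A (V f))\<^sup>2 + (ell2_norm A (V g))\<^sup>2)) summable_on F"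
    by (intro summable_on_cmult_right summable_on_add family_summable f g)
  then show "(\<lambda>V. cmod (ell2_inner A (T (V f)) (V g))) summable_on F"
    by (rule summable_on_comparison_test) (use K f g in auto)
  then show "(\<lambda>V. ell2_inner A (T (V f)) (V g)) summable_on F"
    by (rule abs_summable_summable)
qed

lemma cp_bounded_form:
  assumes T: "T \<in> bounded_ops A"
  shows "bounded_form A (\<lambda>f g. \<Sum>\<^sub>\<infinity>V\<in>F. ell2_inner A (T (V f)) (V g))"
proof -
  obtain K where K: "0 < K" "\<And>f g V. f \<in> ell2 A \<Longrightarrow> g \<in> ell2 A \<Longrightarrow> V \<in> F \<Longrightarrow>
      cmod (ell2_inner A (T (V f)) (V g)) \<le> K * ((ell2_norm A (V f))\<^sup>2 + (ell2_norm A (V g))\<^sup>2)"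
    using cp_term_bound[OF T] by blast
  note V = family_bounded
  have mem: "V f \<in> ell2 A" "T (V f) \<in> ell2 A" if "V \<in> F" for V f
    using op_ell2[OF V[OF that]] op_ell2[OF T] by auto
  show ?thesis
  proof (rule bounded_formI[where C = K])
    fix f f' g assume *: "f \<in> ell2 A" "f' \<in> ell2 A" "g \<in> ell2 A"
    have "(\<Sum>\<^sub>\<infinity>V\<in>F. ell2_inner A (T (V (\<lambda>x. f x + f' x))) (V g))
      = (\<Sum>\<^sub>\<infinity>V\<in>F. ell2_inner A (T (V f)) (V g) + ell2_inner A (T (V f')) (V g))"
      by (rule infsum_cong) (simp add: op_add[OF V] op_add[OF T] inner_add_left mem *)
    then show "(\<Sum>\<^sub>\<infinity>V\<in>F. ell2_inner A (T (V (\<lambda>x. f x + f' x))) (V g))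
      = (\<Sum>\<^sub>\<infinity>V\<in>F. ell2_inner A (T (V f)) (V g)) + (\<Sum>\<^sub>\<infinity>V\<in>F. ell2_inner A (T (V f')) (V g))"
      by (simp only: infsum_add[OF cp_summable(2)[OF T *(1,3)] cp_summable(2)[OF T *(2,3)]])
  next
    fix c f g assume *: "f \<in> ell2 A" "g \<in> ell2 A"
    have "(\<Sum>\<^sub>\<infinity>V\<in>F. ell2_inner A (T (V (\<lambda>x. c * f x))) (V g))
      = (\<Sum>\<^sub>\<infinity>V\<in>F. c * ell2_inner A (T (V f)) (V g))"
      by (rule infsum_cong) (simp add: op_scale[OF V] op_scale[OF T] inner_scale_left mem *)
    then show "(\<Sum>\<^sub>\<infinity>V\<in>F. ell2_inner A (T (V (\<lambda>x. c * f x))) (V g))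
      = c * (\<Sum>\<^sub>\<infinity>V\<in>F. ell2_inner A (T (V f)) (V g))"
      by (simp only: infsum_cmult_right')
  next
    fix f g g' assume *: "f \<in> ell2 A" "g \<in> ell2 A" "g' \<in> ell2 A"
    have "(\<Sum>\<^sub>\<infinity>V\<in>F. ell2_inner A (T (V f)) (V (\<lambda>x. g x + g' x)))
      = (\<Sum>\<^sub>\<infinity>V\<in>F. ell2_inner A (T (V f)) (V g) + ell2_inner A (T (V f)) (V g'))"
      by (rule infsum_cong) (simp add: op_add[OF V] inner_add_right mem *)
    then show "(\<Sum>\<^sub>\<infinity>V\<in>F. ell2_inner A (T (V f)) (V (\<lambda>x. g x + g' x)))
      = (\<Sum>\<^sub>\<infinity>V\<in>F. ell2_inner A (T (V f)) (V g)) + (\<Sum>\<^sub>\<infinity>V\<in>F. ell2_inner A (T (V f)) (V g'))"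
      by (simp only: infsum_add[OF cp_summable(2)[OF T *(1,2)] cp_summable(2)[OF T *(1,3)]])
  next
    fix c f g assume *: "f \<in> ell2 A" "g \<in> ell2 A"
    have "(\<Sum>\<^sub>\<infinity>V\<in>F. ell2_inner A (T (V f)) (V (\<lambda>x. c * g x)))
      = (\<Sum>\<^sub>\<infinity>V\<in>F. cnj c * ell2_inner A (T (V f)) (V g))"
      by (rule infsum_cong) (simp add: op_scale[OF V] inner_scale_right mem *)
    then show "(\<Sum>\<^sub>\<infinity>V\<in>F. ell2_inner A (T (V f)) (V (\<lambda>x. c * g x)))
      = cnj c * (\<Sum>\<^sub>\<infinity>V\<in>F. ell2_inner A (T (V f)) (V g))"
      by (simp only: infsum_cmult_right')
  next
    fix f g assume *: "f \<in> ell2 A" "g \<in> ell2 A"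
    note S = family_summable(1)[OF *(1)] family_summable(1)[OF *(2)]
    have "cmod (\<Sum>\<^sub>\<infinity>V\<in>F. ell2_inner A (T (V f)) (V g))
        \<le> (\<Sum>\<^sub>\<infinity>V\<in>F. cmod (ell2_inner A (T (V f)) (V g)))"
      by (rule norm_infsum_bound) (rule cp_summable(1)[OF T *])
    also have "\<dots> \<le> (\<Sum>\<^sub>\<infinity>V\<in>F. K * ((ell2_norm A (V f))\<^sup>2 + (ell2_norm A (V g))\<^sup>2))"
      by (intro infsum_mono summable_on_cmult_right summable_on_add S cp_summable T * K)
    also have "\<dots> = K * ((\<Sum>\<^sub>\<infinity>V\<in>F. (ell2_norm A (V f))\<^sup>2) + (\<Sum>\<^sub>\<infinity>V\<in>F. (ell2_norm A (V g))\<^sup>2))"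
      by (simp only: infsum_cmult_right' infsum_add[OF S])
    also have "\<dots> \<le> K * ((ell2_norm A f)\<^sup>2 + (ell2_norm A g)\<^sup>2)"
      using K(1) by (intro mult_left_mono add_mono family_summable *) auto
    finally show "cmod (\<Sum>\<^sub>\<infinity>V\<in>F. ell2_inner A (T (V f)) (V g))
        \<le> K * ((ell2_norm A f)\<^sup>2 + (ell2_norm A g)\<^sup>2)" .
  qed
qed

lemma cp_map_bounded: "T \<in> bounded_ops A \<Longrightarrow> cp_map A F T \<in> bounded_ops A"
  unfolding cp_map_def by (intro form_op_bounded cp_bounded_form)

lemma inner_cp_map:
  "T \<in> bounded_ops A \<Longrightarrow> f \<in> ell2 A \<Longrightarrow> g \<in> ell2 A \<Longrightarrow>
    ell2_inner A (cp_map A F T f) g = (\<Sum>\<^sub>\<infinity>V\<in>F. ell2_inner A (T (V f)) (V g))"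
  unfolding cp_map_def by (rule inner_form_op[OF cp_bounded_form])

lemma inner_cp_map_id:
  assumes "f \<in> ell2 A" "g \<in> ell2 A"
  shows "ell2_inner A (cp_map A F (id_op A) f) g = (\<Sum>\<^sub>\<infinity>V\<in>F. ell2_inner A (V f) (V g))"
  unfolding inner_cp_map[OF id_op_bounded assms]
  by (rule infsum_cong) (simp add: op_ell2[OF family_bounded])

lemma cp_map_positive:
  assumes T: "T \<in> bounded_ops A" "positive_op A T"
  shows "positive_op A (cp_map A F T)"
  unfolding positive_op_def
proof
  fix f assume f: "f \<in> ell2 A"
  have "ell2_inner A (T (V f)) (V f) \<in> \<real>\<^sub>\<ge>\<^sub>0" if "V \<in> F" for V
    using T(2) op_ell2[OF family_bounded[OF that]] by (auto simp: positive_op_def)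
  then have "0 \<le> (\<Sum>\<^sub>\<infinity>V\<in>F. ell2_inner A (T (V f)) (V f))"
    by (intro infsum_nonneg_complex cp_summable T f) 
      (auto simp: complex_nonneg_Reals_iff less_eq_complex_def)
  then show "ell2_inner A (cp_map A F T f) f \<in> \<real>\<^sub>\<ge>\<^sub>0"
    unfolding inner_cp_map[OF T(1) f f] by (auto simp: complex_nonneg_Reals_iff less_eq_complex_def)
qed

lemma cp_map_add:
  assumes T: "T \<in> bounded_ops A" and S: "S \<in> bounded_ops A"
  shows "cp_map A F (\<lambda>f x. T f x + S f x) = (\<lambda>f x. cp_map A F T f x + cp_map A F S f x)"
proof (rule op_eqI)
  fix f g assume fg: "f \<in> ell2 A" "g \<in> ell2 A"
  note V = op_ell2[OF family_bounded]
  have "(\<Sum>\<^sub>\<infinity>V\<in>F. ell2_inner A (\<lambda>x. T (V f) x + S (V f) x) (V g))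
    = (\<Sum>\<^sub>\<infinity>V\<in>F. ell2_inner A (T (V f)) (V g) + ell2_inner A (S (V f)) (V g))"
    by (rule infsum_cong) (simp add: inner_add_left op_ell2[OF T] op_ell2[OF S] V)
  also have "\<dots> = ell2_inner A (cp_map A F T f) g + ell2_inner A (cp_map A F S f) g"
    by (simp only: infsum_add[OF cp_summable(2)[OF T fg] cp_summable(2)[OF S fg]]
      inner_cp_map[OF T fg] inner_cp_map[OF S fg])
  finally show "ell2_inner A (cp_map A F (\<lambda>f x. T f x + S f x) f) g
      = ell2_inner A (\<lambda>x. cp_map A F T f x + cp_map A F S f x) g"
    by (simp add: inner_cp_map[OF add_op_bounded[OF T S] fg] inner_add_left fg
      op_ell2[OF cp_map_bounded[OF T]] op_ell2[OF cp_map_bounded[OF S]])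
qed (intro cp_map_bounded add_op_bounded T S)+

lemma cp_map_scale:
  assumes T: "T \<in> bounded_ops A"
  shows "cp_map A F (\<lambda>f x. c * T f x) = (\<lambda>f x. c * cp_map A F T f x)"
proof (rule op_eqI)
  fix f g assume fg: "f \<in> ell2 A" "g \<in> ell2 A"
  show "ell2_inner A (cp_map A F (\<lambda>f x. c * T f x) f) g = ell2_inner A (\<lambda>x. c * cp_map A F T f x) g"
    by (simp add: inner_cp_map[OF scale_op_bounded[OF T] fg] inner_cp_map[OF T fg] inner_scale_left
       infsum_cmult_right')
qed (intro cp_map_bounded scale_op_bounded T)+

text \<open>\<open>b\<close> passes through \<open>V\<close> in the first argument of the inner
  product, while \<open>a\<close> reaches the second argument as its adjoint; hence the form of the
  two commutation hypotheses.\<close>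

lemma cp_map_bimodule:
  assumes T: "T \<in> bounded_ops A" and a: "a \<in> bounded_ops A" and b: "b \<in> bounded_ops A"
    and comm: "\<And>V. V \<in> F \<Longrightarrow> adj A a \<circ> V = V \<circ> adj A a" "\<And>V. V \<in> F \<Longrightarrow> b \<circ> V = V \<circ> b"
  shows "cp_map A F (a \<circ> T \<circ> b) = a \<circ> cp_map A F T \<circ> b"
proof (rule op_eqI)
  fix f g assume fg: "f \<in> ell2 A" "g \<in> ell2 A"
  note aTb = comp_bounded[OF comp_bounded[OF a T] b]
  have bf: "b f \<in> ell2 A" "adj A a g \<in> ell2 A" using a b by (auto intro: op_ell2)
  have "(\<Sum>\<^sub>\<infinity>V\<in>F. ell2_inner A ((a \<circ> T \<circ> b) (V f)) (V g))
     = (\<Sum>\<^sub>\<infinity>V\<in>F. ell2_inner A (T (V (b f))) (V (adj A a g)))"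
  proof (rule infsum_cong)
    fix V assume V: "V \<in> F"
    have "b (V f) = V (b f)" "adj A a (V g) = V (adj A a g)"
      using comm[OF V] by (auto dest: fun_cong)
    moreover have "ell2_inner A (a (T (V (b f)))) (V g) = ell2_inner A (T (V (b f))) (adj A a (V g))"
      by (rule inner_adj_right[OF a op_ell2[OF T] op_ell2[OF family_bounded[OF V]], symmetric])
    ultimately show "ell2_inner A ((a \<circ> T \<circ> b) (V f)) (V g) = ell2_inner A (T (V (b f))) (V (adj A a g))"
      by simp
  qed
  then show "ell2_inner A (cp_map A F (a \<circ> T \<circ> b) f) g = ell2_inner A ((a \<circ> cp_map A F T \<circ> b) f) g"
    using inner_adj_right[OF a op_ell2[OF cp_map_bounded[OF T]] fg(2), of "b f", symmetric]
    by (simp only: o_apply inner_cp_map[OF aTb fg] inner_cp_map[OF T bf])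
qed (intro cp_map_bounded comp_bounded a b T)+

lemma defect_bounded: "defect A F \<in> bounded_ops A"
  unfolding defect_def by (intro diff_op_bounded cp_map_bounded id_op_bounded)

lemma defect_apply: "f \<in> ell2 A \<Longrightarrow> defect A F f = (\<lambda>x. f x - cp_map A F (id_op A) f x)"
  by (simp add: defect_def)

lemma inner_defect:
  assumes "f \<in> ell2 A" "g \<in> ell2 A"
  shows "ell2_inner A (defect A F f) g = ell2_inner A f g - (\<Sum>\<^sub>\<infinity>V\<in>F. ell2_inner A (V f) (V g))"
  by (simp add: defect_apply assms inner_diff_left op_ell2[OF cp_map_bounded] inner_cp_map_id)

lemma inner_defect_commute:
  assumes "f \<in> ell2 A" "g \<in> ell2 A"
  shows "ell2_inner A (defect A F f) g = ell2_inner A f (defect A F g)"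
proof -
  have "ell2_inner A f (defect A F g) = cnj (ell2_inner A (defect A F g) f)" by (rule inner_commute)
  also have "\<dots> = ell2_inner A f g - (\<Sum>\<^sub>\<infinity>V\<in>F. cnj (ell2_inner A (V g) (V f)))"
    by (simp only: inner_defect[OF assms(2,1)] complex_cnj_diff infsum_cnj inner_commute[of A f g])
  also have "\<dots> = ell2_inner A (defect A F f) g"
    unfolding inner_defect[OF assms] by (simp only: inner_commute[symmetric])
  finally show ?thesis by simp
qed

lemma inner_defect_self:
  assumes "f \<in> ell2 A"
  shows "Re (ell2_inner A (defect A F f) f)
    = (ell2_norm A f)\<^sup>2 - (\<Sum>\<^sub>\<infinity>V\<in>F. (ell2_norm A (V f))\<^sup>2)"
  unfolding inner_defect[OF assms assms] inner_self infsum_complex_of_real by (simp del: of_real_power)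

text \<open>A positive operator R that is at most 1 satisfies R^2 at most R. No square root is
  taken: with g = R f, Cauchy-Schwarz for the semi-inner product of R bounds the square of <R g, f>,
  which is the fourth power of the norm of \<open>g\<close>, by \<open>q f * q g\<close>, and
  \<open>q g\<close> is at most the squared norm of \<open>g\<close>.\<close>

lemma norm_defect_sq:
  assumes f: "f \<in> ell2 A"
  shows "(ell2_norm A (defect A F f))\<^sup>2 \<le> (ell2_norm A f)\<^sup>2 - (\<Sum>\<^sub>\<infinity>V\<in>F. (ell2_norm A (V f))\<^sup>2)"
proof -
  let ?R = "defect A F"
  define q where "q = (\<lambda>h. (ell2_norm A h)\<^sup>2 - (\<Sum>\<^sub>\<infinity>V\<in>F. (ell2_norm A (V h))\<^sup>2))"
  have q: "Re (ell2_inner A (?R h) h) = q h" if "h \<in> ell2 A" for h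
    using inner_defect_self[OF that] by (simp add: q_def)
  have q0: "0 \<le> q h" "q h \<le> (ell2_norm A h)\<^sup>2" if "h \<in> ell2 A" for h
    using family_summable(2)[OF that] by (auto simp: q_def infsum_nonneg)
  define g where "g = ?R f"
  have g: "g \<in> ell2 A" unfolding g_def by (rule op_ell2[OF defect_bounded])
  have Rfg: "?R f \<in> ell2 A" "?R g \<in> ell2 A" by (intro op_ell2 defect_bounded)+
  have im: "Im (ell2_inner A (?R h) h) = 0" if "h \<in> ell2 A" for h
    unfolding inner_defect[OF that that] inner_self infsum_complex_of_real by (simp del: of_real_power)
  have "0 \<le> q f + 2 * Re (c * ell2_inner A (?R g) f) + (cmod c)\<^sup>2 * q g" for c
  proof -
    let ?h = "\<lambda>x. f x + c * g x"
    have h: "?h \<in> ell2 A" using f g by simp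
    have 1: "ell2_inner A (?R f) g = cnj (ell2_inner A (?R g) f)"
      using inner_defect_commute[OF f g] inner_commute[of A f "?R g"] by simp
    have 3: "ell2_inner A (?R g) g = complex_of_real (q g)"
      using q[OF g] im[OF g] by (simp add: complex_eq_iff)
    have 2: "ell2_inner A (?R ?h) ?h = ell2_inner A (?R f) f + c * ell2_inner A (?R g) f
       + cnj (c * ell2_inner A (?R g) f) + (c * cnj c) * ell2_inner A (?R g) g"
      using f g Rfg
      by (simp add: op_add[OF defect_bounded] op_scale[OF defect_bounded]
          inner_add_left inner_add_right inner_scale_left inner_scale_right 1 algebra_simps)
    have "q ?h = q f + 2 * Re (c * ell2_inner A (?R g) f) + (cmod c)\<^sup>2 * q g"
      unfolding q[OF h, symmetric] q[OF f, symmetric] 2 3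
      by (simp add: complex_mult_cnj cmod_power2)
    then show ?thesis using q0(1)[OF h] by simp
  qed
  then have "(cmod (ell2_inner A (?R g) f))\<^sup>2 \<le> q f * q g"
    by (rule discriminant_bound) (rule q0(1)[OF g])
  moreover have "ell2_inner A (?R g) f = complex_of_real ((ell2_norm A g)\<^sup>2)"
    using inner_defect_commute[OF g f] by (simp only: g_def[symmetric] inner_self)
  ultimately have "((ell2_norm A g)\<^sup>2)\<^sup>2 \<le> q f * q g" by (simp del: of_real_power)
  also have "\<dots> \<le> q f * (ell2_norm A g)\<^sup>2" by (intro mult_left_mono q0 f g)
  finally have le: "(ell2_norm A g)\<^sup>2 * (ell2_norm A g)\<^sup>2 \<le> q f * (ell2_norm A g)\<^sup>2"
    by (simp add: power2_eq_square)
  have "(ell2_norm A g)\<^sup>2 \<le> q f"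
  proof (cases "ell2_norm A g = 0")
    case False
    show ?thesis by (rule mult_right_le_imp_le[OF le]) (use False in simp)
  qed (use q0(1)[OF f] in simp)
  then show ?thesis by (simp only: g_def q_def)
qed

end

text \<open>A finite subset of the union of a chain lies in one member, and \<open>subunital\<close>
  speaks only of finite subsets.\<close>

lemma subunital_Union_chain:
  assumes "C \<in> chains {F. subunital A F}" 
  shows "subunital A (\<Union>C)"
  unfolding subunital_def
proof (intro conjI ballI allI impI)
  have C: "\<And>F. F \<in> C \<Longrightarrow> subunital A F" and ch: "subset.chain {F. subunital A F} C"
    using assms by (auto simp: chains_alt_def subset_chain_def)
  show "\<Union>C \<subseteq> bounded_ops A" using C by (auto simp: subunital_def)
  fix f F' assume f: "f \<in> ell2 A" and F': "finite F'" "F' \<subseteq> \<Union>C"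
  show "(\<Sum>V\<in>F'. (ell2_norm A (V f))\<^sup>2) \<le> (ell2_norm A f)\<^sup>2"
  proof (cases "C = {}")
    case True
    then show ?thesis using F' by simp
  next
    case False
    obtain F where "F \<in> C" "F' \<subseteq> F"
      using finite_subset_Union_chain[OF F' False ch] by blast
    then show ?thesis using C[of F] f F' by (auto simp: subunital_def)
  qed
qed

text \<open>Maximality is exploited by adjoining \<open>c V R\<close> with \<open>R\<close> the defect; this uses \<open>R\<^sup>2 \<le> R\<close>.\<close>

lemma exists_maximal_family:
  assumes VV: "\<V> \<subseteq> bounded_ops A"
    and closed: "\<And>F V c. F \<subseteq> \<V> \<Longrightarrow> subunital A F \<Longrightarrow> V \<in> \<V> \<Longrightarrow>
      (\<lambda>f x. complex_of_real c * V (defect A F f) x) \<in> \<V>"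
  obtains F where "F \<subseteq> \<V>" "subunital A F"
    "\<And>V f. V \<in> \<V> \<Longrightarrow> f \<in> ell2 A \<Longrightarrow> V (defect A F f) = (\<lambda>_. 0)"
proof -
  let ?Z = "{F. F \<subseteq> \<V> \<and> subunital A F}"
  have "\<exists>F\<in>?Z. \<forall>G\<in>?Z. F \<subseteq> G \<longrightarrow> G = F"
  proof (rule Zorn_Lemma, intro ballI)
    fix C assume C: "C \<in> chains ?Z"
    then have "C \<in> chains {F. subunital A F}" by (auto simp: chains_def)
    then have "subunital A (\<Union>C)" by (rule subunital_Union_chain)
    moreover have "\<Union>C \<subseteq> \<V>" using C by (auto simp: chains_def)
    ultimately show "\<Union>C \<in> ?Z" by simp
  qed
  then obtain F where F': "F \<in> ?Z" and max': "\<forall>G\<in>?Z. F \<subseteq> G \<longrightarrow> G = F" ..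
  have F: "F \<subseteq> \<V>" "subunital A F" using F' by auto
  have max: "G = F" if "G \<subseteq> \<V>" "subunital A G" "F \<subseteq> G" for G using max' that by simp
  have "V (defect A F f0) = (\<lambda>_. 0)" if V: "V \<in> \<V>" and f0: "f0 \<in> ell2 A" for V f0
  proof (rule ccontr)
    assume nz: "V (defect A F f0) \<noteq> (\<lambda>_. 0)"
    have Vb: "V \<in> bounded_ops A" using V VV by blast
    let ?R = "defect A F"
    obtain K where K: "0 < K" "\<And>f. f \<in> ell2 A \<Longrightarrow> ell2_norm A (V f) \<le> K * ell2_norm A f"
      using op_bound[OF Vb] by blast
    define W where "W = (\<lambda>c f x. complex_of_real c * V (?R f) x)"
    \<comment> \<open>If \<open>W c\<close> were new, inserting it would keep the family subunital:
      for \<open>c\<close> up to 1 / K its squared norm fits into the slack left by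
      \<open>F\<close>, by \<open>norm_defect_sq\<close>. So maximality puts all these multiples
      into \<open>F\<close>.\<close>
    have W_in: "W c \<in> F" if c: "0 < c" "c \<le> 1 / K" for c
    proof (rule ccontr)
      assume nin: "W c \<notin> F"
      have Wc: "W c \<in> \<V>" unfolding W_def by (rule closed[OF F V])
      have small: "(ell2_norm A (W c f))\<^sup>2 \<le> (ell2_norm A f)\<^sup>2 - (\<Sum>\<^sub>\<infinity>V\<in>F. (ell2_norm A (V f))\<^sup>2)"
        if f: "f \<in> ell2 A" for f
      proof -
        have R: "?R f \<in> ell2 A" by (intro op_ell2 defect_bounded F)
        have "ell2_norm A (W c f) = c * ell2_norm A (V (?R f))"
          using c by (simp add: W_def norm_scale)
        also have "\<dots> \<le> (1 / K) * (K * ell2_norm A (?R f))"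
          using c K(1) by (intro mult_mono K R) auto
        also have "\<dots> = ell2_norm A (?R f)" using K(1) by simp
        finally have "(ell2_norm A (W c f))\<^sup>2 \<le> (ell2_norm A (?R f))\<^sup>2"
          by (intro power_mono) auto
        also note norm_defect_sq[OF F(2) f]
        finally show ?thesis .
      qed
      have "subunital A (insert (W c) F)"
        unfolding subunital_def
      proof (intro conjI ballI allI impI)
        show "insert (W c) F \<subseteq> bounded_ops A" using Wc VV F by auto
        fix f F' assume f: "f \<in> ell2 A" and F': "finite F'" "F' \<subseteq> insert (W c) F"
        have "(\<Sum>V\<in>F'. (ell2_norm A (V f))\<^sup>2) \<le> (\<Sum>V\<in>insert (W c) (F' - {W c}). (ell2_norm A (V f))\<^sup>2)"
          by (rule sum_mono2) (use F' in auto)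
        also have "\<dots> = (ell2_norm A (W c f))\<^sup>2 + (\<Sum>V\<in>F' - {W c}. (ell2_norm A (V f))\<^sup>2)"
          by (subst sum.insert) (use F' in auto)
        also have "(\<Sum>V\<in>F' - {W c}. (ell2_norm A (V f))\<^sup>2) \<le> (\<Sum>\<^sub>\<infinity>V\<in>F. (ell2_norm A (V f))\<^sup>2)"
          by (rule finite_sum_le_infsum) (use F' family_summable(1)[OF F(2) f] in auto)
        finally show "(\<Sum>V\<in>F'. (ell2_norm A (V f))\<^sup>2) \<le> (ell2_norm A f)\<^sup>2"
          using small[OF f] by simp
      qed
      moreover have "insert (W c) F \<subseteq> \<V>" using Wc F by simp
      ultimately have "insert (W c) F = F" by (intro max) auto
      with nin show False by blast
    qed
    let ?v = "ell2_norm A (V (?R f0))"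
    have "V (?R f0) \<in> ell2 A" by (rule op_ell2[OF Vb])
    then have v: "?v > 0" using nz norm_eq_zero[of "V (?R f0)" A] norm_nonneg[of A "V (?R f0)"]
      by (auto simp: order_less_le simp del: norm_nonneg)
    \<comment> \<open>The multiples are distinct members of \<open>F\<close>, and for
      \<open>c\<close> in this interval each has norm at least \<open>?v / (2 * K)\<close> at
      \<open>f0\<close>. So \<open>N\<close> of them exceed what \<open>subunital\<close> allows at
      \<open>f0\<close>.\<close>
    let ?I = "{1 / (2 * K)..1 / K}"
    obtain N :: nat where N: "(ell2_norm A f0)\<^sup>2 < real N * (?v / (2 * K))\<^sup>2"
      using reals_Archimedean3[of "(?v / (2 * K))\<^sup>2"] v K(1) by (auto simp: mult.commute)
    have "infinite ?I" using K(1) by (intro infinite_Icc) (simp add: field_simps)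
    then obtain D where D: "D \<subseteq> ?I" "finite D" "card D = N"
      using infinite_arbitrarily_large by metis
    have normW: "ell2_norm A (W c f0) = c * ?v" if "c \<in> D" for c
    proof -
      have "0 < 1 / (2 * K)" using K(1) by simp
      moreover have "1 / (2 * K) \<le> c" using D that by auto
      ultimately have "0 < c" by linarith
      then show ?thesis by (simp add: W_def norm_scale)
    qed
    have inj: "inj_on W D"
    proof (rule inj_onI)
      fix c d assume "c \<in> D" "d \<in> D" "W c = W d"
      then have "c * ?v = d * ?v" using normW by metis
      then show "c = d" using v by simp
    qed
    have "real N * (?v / (2 * K))\<^sup>2 = (\<Sum>c\<in>D. (?v / (2 * K))\<^sup>2)" using D by simp
    also have "\<dots> \<le> (\<Sum>c\<in>D. (ell2_norm A (W c f0))\<^sup>2)"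
    proof (rule sum_mono)
      fix c assume c: "c \<in> D"
      have "1 / (2 * K) \<le> c" using D c by auto
      then have "?v / (2 * K) \<le> c * ?v" using v mult_right_mono[of "1 / (2 * K)" c ?v] by simp
      then show "(?v / (2 * K))\<^sup>2 \<le> (ell2_norm A (W c f0))\<^sup>2"
        unfolding normW[OF c] using v K(1) by (intro power_mono) auto
    qed
    also have "\<dots> = (\<Sum>V\<in>W ` D. (ell2_norm A (V f0))\<^sup>2)"
      by (simp add: sum.reindex[OF inj])
    also have "\<dots> \<le> (ell2_norm A f0)\<^sup>2"
    proof -
      have "W c \<in> F" if "c \<in> D" for c
      proof (rule W_in)
        show "c \<le> 1 / K" using D that by auto
        have "0 < 1 / (2 * K)" using K(1) by simp
        moreover have "1 / (2 * K) \<le> c" using D that by auto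
        ultimately show "0 < c" by linarith
      qed
      then have "W ` D \<subseteq> F" by blast
      then show ?thesis using F(2) f0 D(2) by (auto simp: subunital_def)
    qed
    finally show False using N by simp
  qed
  with F that show thesis by blast
qed

section \<open>Orthogonal projections\<close>

definition perp :: "'a set \<Rightarrow> ('a \<Rightarrow> complex) set \<Rightarrow> ('a \<Rightarrow> complex) set" where
  "perp A S = {f \<in> ell2 A. \<forall>s\<in>S. ell2_inner A f s = 0}"

lemma perp_diff:
  "f \<in> perp A S \<Longrightarrow> g \<in> perp A S \<Longrightarrow> S \<subseteq> ell2 A \<Longrightarrow> (\<lambda>x. f x - g x) \<in> perp A S"
  by (auto simp: perp_def inner_diff_left subset_iff)

lemma perp_scale: "f \<in> perp A S \<Longrightarrow> (\<lambda>x. c * f x) \<in> perp A S"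
  by (auto simp: perp_def inner_scale_left)

lemma perp_ell2: "f \<in> perp A S \<Longrightarrow> f \<in> ell2 A"
  by (simp add: perp_def)

lemma perp_perpI: "S \<subseteq> ell2 A \<Longrightarrow> f \<in> S \<Longrightarrow> f \<in> perp A (perp A S)"
  unfolding perp_def by (auto, subst inner_commute, simp)

text \<open>The projection is \<open>\<Sum> V\<^sup>* V\<close> for a maximal family of rank-one operators \<open>\<langle>\<cdot>, k\<rangle> \<delta>\<close>
  with \<open>k\<close> in the subspace, which avoids completeness arguments.\<close>

lemma exists_projection:
  assumes S: "S \<subseteq> ell2 A" and x0: "x0 \<in> A"
  obtains e where "e \<in> bounded_ops A" "\<And>f. e f \<in> perp A (perp A S)"
    "\<And>f. f \<in> perp A (perp A S) \<Longrightarrow> e f = f"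
    "\<And>f g. f \<in> ell2 A \<Longrightarrow> g \<in> ell2 A \<Longrightarrow> ell2_inner A (e f) g = ell2_inner A f (e g)"
proof -
  define K where "K = perp A (perp A S)"
  have perp_S: "perp A S \<subseteq> ell2 A" by (auto simp: perp_def)
  \<comment> \<open>For V = \<open>r k\<close> the operator V^* V maps f to <f, k> k, because
    \<open>kron x0\<close> is a unit vector; hence sums over such families take values in
    \<open>K\<close>.\<close>
  define r where "r = (\<lambda>k f x. ell2_inner A (id_op A f) k * kron x0 x)"
  have K_ell2: "k \<in> ell2 A" if "k \<in> K" for k using that by (simp add: K_def perp_ell2)
  have r_b: "r k \<in> bounded_ops A" if k: "k \<in> ell2 A" for k
  proof (rule bounded_opsI[where K = "ell2_norm A k"])
    fix f assume f: "f \<in> ell2 A"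
    show "ell2_norm A (r k f) \<le> ell2_norm A k * ell2_norm A f"
      using inner_Cauchy_Schwarz[OF f k] f x0
      by (simp add: r_def norm_scale mult.commute[of "ell2_norm A k"])
  qed (use k x0 in \<open>auto simp: r_def inner_add_left inner_scale_left distrib_right id_op_def\<close>)
  let ?V = "r ` K"
  have cpK: "cp_map A F (id_op A) f \<in> K" if F: "F \<subseteq> ?V" "subunital A F" and f: "f \<in> ell2 A" for F f
    unfolding K_def perp_def[of A "perp A S"]
  proof (intro CollectI conjI ballI op_ell2[OF cp_map_bounded[OF F(2) id_op_bounded]])
    fix s assume s: "s \<in> perp A S"
    have *: "ell2_inner A (V f) (V s) = 0" if VF: "V \<in> F" for V
    proof -
      obtain k where k: "k \<in> K" "V = r k" using VF F(1) by blast
      have "ell2_inner A k s = 0" using k(1) s by (auto simp: K_def perp_def)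
      then have "ell2_inner A s k = 0" by (subst inner_commute) simp
      then have "V s = (\<lambda>_. 0)" using k(2) s by (simp add: r_def perp_ell2)
      then show ?thesis by simp
    qed
    then show "ell2_inner A (cp_map A F (id_op A) f) s = 0"
      unfolding inner_cp_map_id[OF F(2) f perp_ell2[OF s]] by (simp add: * infsum_0)
  qed
  have RK: "defect A F k \<in> K" if F: "F \<subseteq> ?V" "subunital A F" and k: "k \<in> K" for F k
    unfolding defect_apply[OF F(2) K_ell2[OF k]] K_def
    by (rule perp_diff) (use k cpK[OF F K_ell2[OF k]] perp_S in \<open>auto simp: K_def\<close>)
  obtain F where F: "F \<subseteq> ?V" "subunital A F"
    and zero: "\<And>V f. V \<in> ?V \<Longrightarrow> f \<in> ell2 A \<Longrightarrow> V (defect A F f) = (\<lambda>_. 0)"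
  proof (rule exists_maximal_family[of ?V A])
    show "?V \<subseteq> bounded_ops A" using r_b K_ell2 by blast
    fix F V c assume F: "F \<subseteq> ?V" "subunital A F" and V: "V \<in> ?V"
    then obtain k where k: "k \<in> K" "V = r k" by blast
    \<comment> \<open>The defect is self-adjoint, so composing the rank-one operator of
      \<open>k\<close> with it gives the rank-one operator of the image of \<open>k\<close>. Closure
      of the family thus rests on \<open>RK\<close>.\<close>
    have "(\<lambda>f x. complex_of_real c * V (defect A F f) x)
        = r (\<lambda>x. complex_of_real c * defect A F k x)"
    proof (intro ext)
      fix f x
      show "complex_of_real c * V (defect A F f) x = r (\<lambda>x. complex_of_real c * defect A F k x) f x"
      proof (cases "f \<in> ell2 A")
        case True
        then show ?thesis
          using inner_defect_commute[OF F(2) True K_ell2[OF k(1)]]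
          by (simp add: k(2) r_def inner_scale_right op_ell2[OF defect_bounded[OF F(2)]])
      next
        case False
        then show ?thesis
          by (simp add: k(2) r_def op_outside[OF defect_bounded[OF F(2)]] id_op_def)
      qed
    qed
    moreover have "(\<lambda>x. complex_of_real c * defect A F k x) \<in> K"
      using RK[OF F k(1)] unfolding K_def by (rule perp_scale)
    ultimately show "(\<lambda>f x. complex_of_real c * V (defect A F f) x) \<in> ?V" by blast
  qed blast
  let ?e = "cp_map A F (id_op A)"
  have "?e k = k" if k: "k \<in> K" for k
  proof -
    have "defect A F k = (\<lambda>_. 0)"
    proof (rule ell2_eqI[OF op_ell2[OF defect_bounded[OF F(2)]]])
      fix h assume h: "h \<in> ell2 A"
      \<comment> \<open>Maximality makes every defect vector orthogonal to \<open>k\<close>;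
        self-adjointness turns this into the vanishing of the defect at \<open>k\<close>.\<close>
      have "r k (defect A F h) x0 = 0" using zero[OF imageI[OF k] h] by simp
      then have "ell2_inner A (defect A F h) k = 0"
        by (simp add: r_def kron_def op_ell2[OF defect_bounded[OF F(2)]])
      then have "ell2_inner A h (defect A F k) = 0"
        using inner_defect_commute[OF F(2) h K_ell2[OF k]] by simp
      then show "ell2_inner A (defect A F k) h = ell2_inner A (\<lambda>_. 0) h"
        by (subst inner_commute) simp
    qed simp
    then show ?thesis unfolding defect_apply[OF F(2) K_ell2[OF k]] by (simp add: fun_eq_iff)
  qed
  moreover have "ell2_inner A (?e f) g = ell2_inner A f (?e g)" if "f \<in> ell2 A" "g \<in> ell2 A" for f g
  proof -
    have "ell2_inner A f (?e g) = cnj (ell2_inner A (?e g) f)" by (rule inner_commute)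
    also have "\<dots> = (\<Sum>\<^sub>\<infinity>V\<in>F. cnj (ell2_inner A (V g) (V f)))"
      by (simp only: inner_cp_map_id[OF F(2) that(2,1)] infsum_cnj)
    also have "\<dots> = ell2_inner A (?e f) g"
      unfolding inner_cp_map_id[OF F(2) that] by (simp only: inner_commute[symmetric])
    finally show ?thesis by simp
  qed
  moreover have "?e f \<in> K" for f
  proof (cases "f \<in> ell2 A")
    case True
    then show ?thesis by (rule cpK[OF F])
  next
    case False
    then show ?thesis
      using op_outside[OF cp_map_bounded[OF F(2) id_op_bounded] False] cpK[OF F zero_in_ell2]
        op_zero[OF cp_map_bounded[OF F(2) id_op_bounded]] by simp
  qed
  moreover have "?e \<in> bounded_ops A" by (rule cp_map_bounded[OF F(2) id_op_bounded])
  ultimately show thesis using that[of ?e] unfolding K_def by blast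
qed

section \<open>Commutants\<close>

lemma commutant_bounded: "T \<in> commutant A M \<Longrightarrow> T \<in> bounded_ops A"
  by (simp add: commutant_def)

lemma commutantD: "T \<in> commutant A M \<Longrightarrow> S \<in> M \<Longrightarrow> T \<circ> S = S \<circ> T"
  by (simp add: commutant_def)

lemma commutantI: "T \<in> bounded_ops A \<Longrightarrow> (\<And>S. S \<in> M \<Longrightarrow> T \<circ> S = S \<circ> T) \<Longrightarrow> T \<in> commutant A M"
  by (simp add: commutant_def)

lemma commutant_apply: "T \<in> commutant A M \<Longrightarrow> S \<in> M \<Longrightarrow> T (S f) = S (T f)"
  by (drule (1) commutantD) (drule fun_cong[of _ _ f], simp)

lemma commutant_antimono: "M \<subseteq> N \<Longrightarrow> commutant A N \<subseteq> commutant A M"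
  by (auto simp: commutant_def)

lemma subset_bicommutant: "M \<subseteq> bounded_ops A \<Longrightarrow> M \<subseteq> commutant A (commutant A M)"
  by (auto simp: commutant_def)

lemma tricommutant: "M \<subseteq> bounded_ops A \<Longrightarrow> commutant A (commutant A (commutant A M)) = commutant A M"
proof (rule antisym)
  assume "M \<subseteq> bounded_ops A"
  then show "commutant A (commutant A (commutant A M)) \<subseteq> commutant A M"
    by (intro commutant_antimono subset_bicommutant)
qed (rule subset_bicommutant, auto simp: commutant_def)

lemma id_op_commutant: "M \<subseteq> bounded_ops A \<Longrightarrow> id_op A \<in> commutant A M"
  by (intro commutantI id_op_bounded) (simp add: id_op_comp comp_id_op subset_iff)

lemma comp_commutant: "T \<in> commutant A M \<Longrightarrow> S \<in> commutant A M \<Longrightarrow> T \<circ> S \<in> commutant A M"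
  by (intro commutantI comp_bounded) (auto simp: commutant_bounded fun_eq_iff commutant_apply)

lemma scale_commutant:
  assumes "T \<in> commutant A M" "M \<subseteq> bounded_ops A"
  shows "(\<lambda>f x. c * T f x) \<in> commutant A M"
proof (intro commutantI scale_op_bounded)
  show T: "T \<in> bounded_ops A" by (rule commutant_bounded[OF assms(1)])
  fix S assume S: "S \<in> M"
  have "S (\<lambda>x. c * T f x) = (\<lambda>x. c * S (T f) x)" for f
    using S assms(2) op_ell2[OF T] by (intro op_scale) auto
  then show "(\<lambda>f x. c * T f x) \<circ> S = S \<circ> (\<lambda>f x. c * T f x)"
    by (auto simp: fun_eq_iff commutant_apply[OF assms(1) S])
qed

lemma adj_commutant:
  assumes T: "T \<in> commutant A M" and M: "M \<subseteq> bounded_ops A" "\<And>S. S \<in> M \<Longrightarrow> adj A S \<in> M"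
  shows "adj A T \<in> commutant A M"
proof (intro commutantI adj_bounded commutant_bounded[OF T])
  fix S assume S: "S \<in> M"
  have S': "S \<in> bounded_ops A" using S M by auto
  have "adj A (adj A S \<circ> T) = adj A (T \<circ> adj A S)"
    using commutantD[OF T M(2)[OF S]] by simp
  then show "adj A T \<circ> S = S \<circ> adj A T"
    using S' by (simp add: adj_comp adj_bounded commutant_bounded[OF T])
qed

lemma diff_commutant:
  assumes T: "T \<in> commutant A M" "S \<in> commutant A M" and M: "M \<subseteq> bounded_ops A"
  shows "(\<lambda>f x. T f x - S f x) \<in> commutant A M"
proof (intro commutantI diff_op_bounded commutant_bounded[OF T(1)] commutant_bounded[OF T(2)])
  fix R assume R: "R \<in> M"
  then have Rb: "R \<in> bounded_ops A" using M by auto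
  have "R (\<lambda>x. T f x - S f x) = (\<lambda>x. R (T f) x - R (S f) x)" for f
  proof -
    have mem: "T f \<in> ell2 A" "S f \<in> ell2 A" using T by (auto intro: op_ell2 commutant_bounded)
    have "R (\<lambda>x. T f x + - 1 * S f x) = (\<lambda>x. R (T f) x + - 1 * R (S f) x)"
      using mem by (simp only: op_add[OF Rb] op_scale[OF Rb] ell2_scale)
    then show ?thesis by simp
  qed
  then show "(\<lambda>f x. T f x - S f x) \<circ> R = R \<circ> (\<lambda>f x. T f x - S f x)"
    by (auto simp: fun_eq_iff commutant_apply[OF T(1) R] commutant_apply[OF T(2) R])
qed

text \<open>Inside \<open>cp_map\<close>, \<open>S\<close> can stand on the left or on the right of
  the identity operator; \<open>cp_map_bimodule\<close> extracts it on either side. Closure of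
  \<open>M\<close> under adjoints supplies the commutation with \<open>adj A S\<close>.\<close>

lemma cp_map_id_commutant:
  assumes F: "subunital A F" "F \<subseteq> commutant A M"
    and M: "M \<subseteq> bounded_ops A" "\<And>S. S \<in> M \<Longrightarrow> adj A S \<in> M"
  shows "cp_map A F (id_op A) \<in> commutant A M"
proof (intro commutantI cp_map_bounded[OF F(1) id_op_bounded])
  fix S assume S: "S \<in> M"
  note cb = cp_map_bounded[OF F(1) id_op_bounded]
  have Sb: "S \<in> bounded_ops A" using S M by auto
  have comm: "S \<circ> V = V \<circ> S" "adj A S \<circ> V = V \<circ> adj A S" "adj A (id_op A) \<circ> V = V \<circ> adj A (id_op A)"
    "id_op A \<circ> V = V \<circ> id_op A" if "V \<in> F" for V
  proof -
    have V: "V \<in> commutant A M" using that F by auto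
    have [simp]: "adj A (id_op A) = id_op A" by (rule adj_unique) auto
    show "S \<circ> V = V \<circ> S" "adj A S \<circ> V = V \<circ> adj A S" 
      using commutantD[OF V S] commutantD[OF V M(2)[OF S]] by simp_all
    show "adj A (id_op A) \<circ> V = V \<circ> adj A (id_op A)" "id_op A \<circ> V = V \<circ> id_op A"
      using commutant_bounded[OF V] by (simp_all add: id_op_comp comp_id_op)
  qed
  have "S \<circ> cp_map A F (id_op A) = S \<circ> cp_map A F (id_op A) \<circ> id_op A"
    by (simp add: comp_id_op comp_assoc cb)
  also have "\<dots> = cp_map A F (S \<circ> id_op A \<circ> id_op A)"
    by (rule cp_map_bimodule[OF F(1), symmetric]) (auto simp: Sb comm)
  also have "\<dots> = cp_map A F (id_op A \<circ> id_op A \<circ> S)"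
    by (simp add: comp_id_op id_op_comp Sb)
  also have "\<dots> = id_op A \<circ> cp_map A F (id_op A) \<circ> S"
    by (rule cp_map_bimodule[OF F(1)]) (auto simp: Sb comm)
  also have "\<dots> = cp_map A F (id_op A) \<circ> S" by (simp add: id_op_comp cb)
  finally show "cp_map A F (id_op A) \<circ> S = S \<circ> cp_map A F (id_op A)" by simp
qed

lemma von_neumann_algebra_adj:
  assumes "von_neumann_algebra A M" "T \<in> M"
  shows "adj A T \<in> M"
proof -
  obtain S where "S \<in> M" "is_adjoint A T S" using assms by (auto simp: von_neumann_algebra_def)
  moreover have "S = adj A T"
    by (rule is_adjoint_unique) (use assms calculation in \<open>auto simp: von_neumann_algebra_def\<close>)
  ultimately show ?thesis by simp
qed

lemma von_neumann_algebra_bicommutant: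
  assumes S: "S \<subseteq> bounded_ops A" "\<And>T. T \<in> S \<Longrightarrow> adj A T \<in> S"
  shows "von_neumann_algebra A (commutant A (commutant A S))"
  unfolding von_neumann_algebra_def
proof (intro conjI ballI)
  show "commutant A (commutant A S) \<subseteq> bounded_ops A" by (auto simp: commutant_def)
  have c: "commutant A S \<subseteq> bounded_ops A" by (auto simp: commutant_def)
  show "commutant A (commutant A (commutant A (commutant A S))) = commutant A (commutant A S)"
    by (rule tricommutant[OF c])
  fix T assume T: "T \<in> commutant A (commutant A S)"
  have "adj A T \<in> commutant A (commutant A S)"
    by (rule adj_commutant[OF T c]) (rule adj_commutant[OF _ S])
  then show "\<exists>R\<in>commutant A (commutant A S). is_adjoint A T R"
    using is_adjoint_adj[OF commutant_bounded[OF T]] by blast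
qed

section \<open>The regular representations\<close>

text \<open>The modular conjugation of the canonical trace: on the group algebra it sends
  \<open>x \<delta>\<close> to the adjoint of \<open>x\<close> applied to \<open>\<delta>\<close>,
  see \<open>flip_group_vN_delta\<close>. It is conjugate-linear, so bounded operators in the
  present sense arise only from sandwiches \<open>J \<circ> T \<circ> J\<close>.\<close>

definition flip :: "('a, 'm) monoid_scheme \<Rightarrow> 'a oper" where
  "flip G f = (if f \<in> ell2 (carrier G)
     then (\<lambda>x. if x \<in> carrier G then cnj (f (inv\<^bsub>G\<^esub> x)) else 0) else (\<lambda>_. 0))"

text \<open>Conjugation lets boundedness, adjoints and the composition law be inherited from
  \<open>left_regular\<close>. Pointwise the value is \<open>f (x \<otimes> g)\<close>, and
  \<open>\<delta>\<close> goes to the basis vector at the inverse of \<open>g\<close>.\<close>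

definition right_regular :: "('a, 'm) monoid_scheme \<Rightarrow> 'a \<Rightarrow> 'a oper" where
  "right_regular G g = flip G \<circ> left_regular G g \<circ> flip G"

context group
begin

abbreviation "L2 \<equiv> ell2 (carrier G)"
abbreviation "B2 \<equiv> bounded_ops (carrier G)"
abbreviation ip ("\<langle>_, _\<rangle>") where "\<langle>f, g\<rangle> \<equiv> ell2_inner (carrier G) f g"
abbreviation "\<delta> \<equiv> kron \<one>"
abbreviation "u \<equiv> left_regular G"
abbreviation "r \<equiv> right_regular G"
abbreviation "J \<equiv> flip G"
abbreviation "comm \<equiv> commutant (carrier G)"
abbreviation adjoint ("_\<^sup>\<star>" [1000] 1000) where "T\<^sup>\<star> \<equiv> adj (carrier G) T"

lemma bij_left_mult: "g \<in> carrier G \<Longrightarrow> bij_betw (\<lambda>x. inv g \<otimes> x) (carrier G) (carrier G)"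
  by (rule bij_betwI[where g = "\<lambda>x. g \<otimes> x"]) (auto simp: m_assoc[symmetric])

lemma bij_inv: "bij_betw (\<lambda>x. inv x) (carrier G) (carrier G)"
  by (rule bij_betwI[where g = "\<lambda>x. inv x"]) auto

lemma left_regular_ell2: "g \<in> carrier G \<Longrightarrow> u g f \<in> L2"
  using summable_on_reindex_bij_betw[OF bij_left_mult, of g "\<lambda>x. (cmod (f x))\<^sup>2"]
  by (auto simp: left_regular_def ell2_def cong: summable_on_cong)

lemma norm_left_regular:
  "g \<in> carrier G \<Longrightarrow> f \<in> L2 \<Longrightarrow> ell2_norm (carrier G) (u g f) = ell2_norm (carrier G) f"
  using infsum_reindex_bij_betw[OF bij_left_mult, of g "\<lambda>x. (cmod (f x))\<^sup>2"]
  by (simp add: left_regular_def ell2_norm_def cong: infsum_cong)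

lemma left_regular_bounded: "g \<in> carrier G \<Longrightarrow> u g \<in> B2"
  by (rule bounded_opsI[where K = 1])
     (simp_all add: left_regular_ell2 norm_left_regular, auto simp: left_regular_def)

lemma left_regular_apply:
  "f \<in> L2 \<Longrightarrow> x \<in> carrier G \<Longrightarrow> u g f x = f (inv g \<otimes> x)"
  by (simp add: left_regular_def)

lemma inner_left_regular:
  assumes "g \<in> carrier G" "f \<in> L2" "h \<in> L2"
  shows "\<langle>u g f, h\<rangle> = \<langle>f, u (inv g) h\<rangle>"
proof -
  have "\<langle>u g f, h\<rangle> = (\<Sum>\<^sub>\<infinity>x\<in>carrier G. f (inv g \<otimes> x) * cnj (u (inv g) h (inv g \<otimes> x)))"
    unfolding ell2_inner_def
    by (rule infsum_cong) (use assms in \<open>simp add: left_regular_apply m_assoc[symmetric]\<close>)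
  also have "\<dots> = \<langle>f, u (inv g) h\<rangle>"
    unfolding ell2_inner_def using infsum_reindex_bij_betw[OF bij_left_mult[OF assms(1)]] .
  finally show ?thesis .
qed

lemma left_regular_adj: "g \<in> carrier G \<Longrightarrow> (u g)\<^sup>\<star> = u (inv g)"
  by (rule adj_unique) (auto simp: left_regular_bounded inner_left_regular)

lemma left_regular_comp:
  assumes "g \<in> carrier G" "h \<in> carrier G" shows "u g (u h f) = u (g \<otimes> h) f"
proof (cases "f \<in> L2")
  case True
  show ?thesis
    by (rule ell2_ext[OF left_regular_ell2 left_regular_ell2])
       (use True assms in \<open>auto simp: left_regular_apply left_regular_ell2 inv_mult_group m_assoc\<close>)
next
  case False
  then show ?thesis using assms
    by (simp add: op_outside[OF left_regular_bounded] op_zero[OF left_regular_bounded])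
qed

lemma left_regular_one: "f \<in> L2 \<Longrightarrow> u \<one> f = f"
  by (rule ell2_ext) (auto simp: left_regular_ell2 left_regular_apply)

lemma left_regular_kron:
  assumes "g \<in> carrier G" "x \<in> carrier G" shows "u g (kron x) = kron (g \<otimes> x)"
proof (rule ell2_ext)
  fix y assume y: "y \<in> carrier G"
  have "inv g \<otimes> y = x \<longleftrightarrow> y = g \<otimes> x"
    using assms y by (metis inv_closed inv_solve_left m_closed)
  then show "u g (kron x) y = kron (g \<otimes> x) y"
    using assms y by (simp add: left_regular_apply) (simp add: kron_def)
qed (use assms in \<open>auto simp: left_regular_ell2\<close>)

lemma flip_ell2: "J f \<in> L2"
  using summable_on_reindex_bij_betw[OF bij_inv, of "\<lambda>x. (cmod (f x))\<^sup>2"]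
  by (auto simp: flip_def ell2_def cong: summable_on_cong)

lemma flip_apply: "f \<in> L2 \<Longrightarrow> x \<in> carrier G \<Longrightarrow> J f x = cnj (f (inv x))"
  by (simp add: flip_def)

lemma flip_flip: "f \<in> L2 \<Longrightarrow> J (J f) = f"
  by (rule ell2_ext) (auto simp: flip_ell2 flip_apply)

lemma norm_flip: "f \<in> L2 \<Longrightarrow> ell2_norm (carrier G) (J f) = ell2_norm (carrier G) f"
  using infsum_reindex_bij_betw[OF bij_inv, of "\<lambda>x. (cmod (f x))\<^sup>2"]
  by (simp add: flip_def ell2_norm_def cong: infsum_cong)

lemma flip_add: "f \<in> L2 \<Longrightarrow> g \<in> L2 \<Longrightarrow> J (\<lambda>x. f x + g x) = (\<lambda>x. J f x + J g x)"
  by (auto simp: flip_def)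

lemma flip_scale: "f \<in> L2 \<Longrightarrow> J (\<lambda>x. c * f x) = (\<lambda>x. cnj c * J f x)"
  by (auto simp: flip_def)

lemma flip_outside: "f \<notin> L2 \<Longrightarrow> J f = (\<lambda>_. 0)"
  by (simp add: flip_def)

lemma flip_zero [simp]: "J (\<lambda>_. 0) = (\<lambda>_. 0)"
  by (simp add: flip_def fun_eq_iff)

lemma inner_flip_left:
  assumes "f \<in> L2" "h \<in> L2"
  shows "\<langle>J f, h\<rangle> = \<langle>J h, f\<rangle>"
proof -
  have "\<langle>J f, h\<rangle> = (\<Sum>\<^sub>\<infinity>x\<in>carrier G. J h (inv x) * cnj (f (inv x)))"
    unfolding ell2_inner_def
    by (rule infsum_cong) (use assms in \<open>simp add: flip_apply mult.commute\<close>)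
  also have "\<dots> = \<langle>J h, f\<rangle>"
    unfolding ell2_inner_def using infsum_reindex_bij_betw[OF bij_inv] .
  finally show ?thesis .
qed

lemma inner_flip_right: "f \<in> L2 \<Longrightarrow> h \<in> L2 \<Longrightarrow> \<langle>f, J h\<rangle> = \<langle>h, J f\<rangle>"
  by (subst (1 2) inner_commute) (simp add: inner_flip_left)

lemma flip_kron: "x \<in> carrier G \<Longrightarrow> J (kron x) = kron (inv x)"
  by (rule ell2_ext[where A = "carrier G"]) (auto simp: flip_ell2 flip_apply, auto simp: kron_def)

lemma flip_delta [simp]: "J \<delta> = \<delta>"
  by (simp add: flip_kron)

lemma flip_conj_bounded:
  assumes T: "T \<in> B2" shows "J \<circ> T \<circ> J \<in> B2"
proof -
  obtain K where K: "0 < K" "\<And>f. f \<in> L2 \<Longrightarrow> ell2_norm (carrier G) (T f) \<le> K * ell2_norm (carrier G) f"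
    using op_bound[OF T] by blast
  have "ell2_norm (carrier G) (J (T (J f))) \<le> K * ell2_norm (carrier G) f" if "f \<in> L2" for f
    using K(2)[OF flip_ell2, of f] that by (simp add: norm_flip op_ell2[OF T])
  then show ?thesis
    by (intro bounded_opsI[where K = K])
       (auto simp: flip_ell2 flip_add flip_scale op_add[OF T] op_scale[OF T]
          op_ell2[OF T] flip_outside op_zero[OF T])
qed

lemma flip_conj_adj:
  assumes T: "T \<in> B2" shows "(J \<circ> T \<circ> J)\<^sup>\<star> = J \<circ> T\<^sup>\<star> \<circ> J"
proof (rule adj_unique)
  fix f g assume fg: "f \<in> L2" "g \<in> L2"
  have "\<langle>J (T\<^sup>\<star> (J f)), g\<rangle> = \<langle>J g, T\<^sup>\<star> (J f)\<rangle>"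
    by (intro inner_flip_left op_ell2 adj_bounded T fg)
  also have "\<dots> = \<langle>T (J g), J f\<rangle>" by (intro inner_adj_right T flip_ell2)
  also have "\<dots> = \<langle>f, J (T (J g))\<rangle>" by (intro inner_flip_right op_ell2 T fg)
  finally show "\<langle>(J \<circ> T\<^sup>\<star> \<circ> J) f, g\<rangle> = \<langle>f, (J \<circ> T \<circ> J) g\<rangle>" by simp
qed (intro flip_conj_bounded adj_bounded T)+

lemma right_regular_bounded: "g \<in> carrier G \<Longrightarrow> r g \<in> B2"
  unfolding right_regular_def by (intro flip_conj_bounded left_regular_bounded)

lemma right_regular_adj: "g \<in> carrier G \<Longrightarrow> (r g)\<^sup>\<star> = r (inv g)"
  unfolding right_regular_def by (simp add: flip_conj_adj left_regular_bounded left_regular_adj)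

lemma right_regular_apply:
  "g \<in> carrier G \<Longrightarrow> f \<in> L2 \<Longrightarrow> x \<in> carrier G \<Longrightarrow> r g f x = f (x \<otimes> g)"
  by (simp add: right_regular_def flip_apply left_regular_apply left_regular_ell2 flip_ell2
      inv_mult_group)

lemma right_regular_delta: "g \<in> carrier G \<Longrightarrow> r g \<delta> = kron (inv g)"
  by (simp add: right_regular_def left_regular_kron flip_kron)

lemma right_regular_comp:
  "g \<in> carrier G \<Longrightarrow> h \<in> carrier G \<Longrightarrow> r g (r h f) = r (g \<otimes> h) f"
  by (simp add: right_regular_def left_regular_comp flip_flip left_regular_ell2)

lemma inner_right_regular:
  "g \<in> carrier G \<Longrightarrow> f \<in> L2 \<Longrightarrow> h \<in> L2 \<Longrightarrow> \<langle>r g f, h\<rangle> = \<langle>f, r (inv g) h\<rangle>"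
  using inner_adj_right[OF right_regular_bounded, of g f h] by (simp add: right_regular_adj)

lemma left_right_commute:
  assumes "g \<in> carrier G" "h \<in> carrier G" shows "r g \<circ> u h = u h \<circ> r g"
proof
  fix f show "(r g \<circ> u h) f = (u h \<circ> r g) f"
  proof (cases "f \<in> L2")
    case True
    show ?thesis
      by (rule ell2_ext[where A = "carrier G"])
        (use True assms in \<open>auto simp: op_ell2[OF right_regular_bounded] left_regular_ell2
          right_regular_apply left_regular_apply m_assoc\<close>)
  next
    case False
    with assms show ?thesis
      by (simp add: op_outside[OF left_regular_bounded] op_zero[OF left_regular_bounded]
        op_outside[OF right_regular_bounded] op_zero[OF right_regular_bounded])
  qed
qed

lemma left_regular_image_bounded: "H \<subseteq> carrier G \<Longrightarrow> u ` H \<subseteq> B2"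
  using left_regular_bounded by auto

lemma right_regular_commutant: "g \<in> carrier G \<Longrightarrow> r g \<in> comm (u ` carrier G)"
  by (intro commutantI right_regular_bounded) (auto simp: left_right_commute)

lemma group_vN_bounded: "x \<in> group_vN G \<Longrightarrow> x \<in> B2"
  unfolding subgroup_vN_def by (rule commutant_bounded)

lemma subgroup_von_neumann_algebra:
  assumes "subgroup H G" shows "von_neumann_algebra (carrier G) (subgroup_vN G H)"
  unfolding subgroup_vN_def
proof (rule von_neumann_algebra_bicommutant)
  have H: "H \<subseteq> carrier G" using assms by (rule subgroup.subset)
  show "u ` H \<subseteq> B2" by (rule left_regular_image_bounded[OF H])
  fix T assume "T \<in> u ` H"
  then show "T\<^sup>\<star> \<in> u ` H"
    using H assms by (auto simp: left_regular_adj subgroup.m_inv_closed)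
qed

lemma group_vN_adj: "x \<in> group_vN G \<Longrightarrow> x\<^sup>\<star> \<in> group_vN G"
  by (rule von_neumann_algebra_adj[OF subgroup_von_neumann_algebra[OF subgroup_self]])

lemma right_regular_group_vN:
  assumes "x \<in> group_vN G" "g \<in> carrier G" shows "x (r g f) = r g (x f)"
  using assms(1) unfolding subgroup_vN_def
  by (rule commutant_apply) (rule right_regular_commutant[OF assms(2)])

text \<open>\<open>J\<close> interchanges \<open>u h\<close> and \<open>r h\<close>, so commuting
  with right translations becomes commuting with left ones. It serves the group algebra, with
  \<open>H\<close> the whole group, and operators averaged over a subgroup.\<close>

lemma flip_conj_commutant:
  assumes xb: "x \<in> B2" and H: "H \<subseteq> carrier G"
    and comm: "\<And>h f. h \<in> H \<Longrightarrow> f \<in> L2 \<Longrightarrow> x (r h f) = r h (x f)"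
  shows "J \<circ> x \<circ> J \<in> comm (u ` H)"
proof (intro commutantI flip_conj_bounded xb)
  fix S assume "S \<in> u ` H"
  then obtain h where h: "h \<in> H" "h \<in> carrier G" "S = u h" using H by auto
  have "(J \<circ> x \<circ> J \<circ> u h) f = (u h \<circ> (J \<circ> x \<circ> J)) f" for f
  proof (cases "f \<in> L2")
    case True
    have "J (x (J (u h f))) = J (x (r h (J f)))"
      using True by (simp add: right_regular_def flip_flip)
    also have "\<dots> = J (r h (x (J f)))" by (simp only: comm[OF h(1) flip_ell2])
    also have "\<dots> = u h (J (x (J f)))" by (simp add: right_regular_def flip_flip left_regular_ell2 h)
    finally show ?thesis by simp
  next
    case False
    with h xb show ?thesis
      by (simp add: flip_outside op_outside[OF left_regular_bounded] op_zero[OF left_regular_bounded] op_zero)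
  qed
  then show "J \<circ> x \<circ> J \<circ> S = S \<circ> (J \<circ> x \<circ> J)" unfolding h(3) by blast
qed

lemma flip_conj_group_vN:
  assumes x: "x \<in> group_vN G" shows "J \<circ> x \<circ> J \<in> comm (u ` carrier G)"
  by (rule flip_conj_commutant[OF group_vN_bounded[OF x] subset_refl]) (rule right_regular_group_vN[OF x])

text \<open>Right translations carry \<open>\<delta>\<close> to every basis vector and commute with
  \<open>x\<close>, so each coordinate of the right-hand side is read off from a coordinate of
  \<open>x \<delta>\<close>.\<close>

lemma flip_group_vN_delta:
  assumes x: "x \<in> group_vN G" shows "J (x \<delta>) = x\<^sup>\<star> \<delta>"
proof (rule ell2_ext)
  have xb: "x \<in> B2" by (rule group_vN_bounded[OF x])
  show "J (x \<delta>) \<in> L2" "x\<^sup>\<star> \<delta> \<in> L2" using xb by (auto simp: flip_ell2 op_ell2)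
  have xd: "x \<delta> \<in> L2" by (rule op_ell2[OF xb])
  fix s assume s: "s \<in> carrier G"
  have "x\<^sup>\<star> \<delta> s = \<langle>x\<^sup>\<star> \<delta>, kron s\<rangle>" using s by (simp add: inner_kron)
  also have "\<dots> = \<langle>\<delta>, x (kron s)\<rangle>" using s by (intro inner_adj_left xb) auto
  also have "\<dots> = \<langle>\<delta>, x (r (inv s) \<delta>)\<rangle>" using s by (simp add: right_regular_delta)
  also have "\<dots> = \<langle>\<delta>, r (inv s) (x \<delta>)\<rangle>" using s by (simp add: right_regular_group_vN[OF x])
  also have "\<dots> = \<langle>kron (inv s), x \<delta>\<rangle>"
    using inner_right_regular[of s \<delta> "x \<delta>"] s xd by (simp add: right_regular_delta)
  also have "\<dots> = cnj (x \<delta> (inv s))" using s by (subst inner_commute) (simp add: inner_kron)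
  also have "\<dots> = J (x \<delta>) s" using s xd by (simp add: flip_apply)
  finally show "J (x \<delta>) s = x\<^sup>\<star> \<delta> s" by simp
qed

text \<open>\<open>J\<close> transfers the equality at \<open>\<delta>\<close> to the adjoints, and
  right translations spread it over all basis vectors. The adjoints on the basis determine every
  coordinate of \<open>x f\<close>, so general \<open>f\<close> is reached without a density
  argument.\<close>

lemma group_vN_separating:
  assumes x: "x \<in> group_vN G" and y: "y \<in> group_vN G" and eq: "x \<delta> = y \<delta>"
  shows "x = y"
proof (rule op_eqI)
  show xb: "x \<in> B2" and yb: "y \<in> B2" using x y by (auto intro: group_vN_bounded)
  have adj: "x\<^sup>\<star> (kron s) = y\<^sup>\<star> (kron s)" if "s \<in> carrier G" for s
  proof -
    have "x\<^sup>\<star> (r (inv s) \<delta>) = y\<^sup>\<star> (r (inv s) \<delta>)"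
      using that eq
      by (simp add: right_regular_group_vN group_vN_adj x y flip_group_vN_delta[symmetric])
    then show ?thesis using that by (simp add: right_regular_delta)
  qed
  fix f g assume f: "f \<in> L2"
  have "x f = y f"
  proof (rule ell2_ext)
    fix s assume s: "s \<in> carrier G"
    have "x f s = \<langle>f, x\<^sup>\<star> (kron s)\<rangle>" using s f xb by (simp add: inner_kron inner_adj_right)
    also have "\<dots> = y f s" using s f yb by (simp add: adj inner_kron inner_adj_right)
    finally show "x f s = y f s" .
  qed (use xb yb in \<open>auto intro: op_ell2\<close>)
  then show "\<langle>x f, g\<rangle> = \<langle>y f, g\<rangle>" by simp
qed

end

section \<open>Subalgebras of the group algebra\<close>

locale vN_subalgebra = group G for G (structure) +
  fixes Q :: "'a oper set"
  assumes vN: "von_neumann_algebra (carrier G) Q"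
    and sub: "Q \<subseteq> group_vN G"
begin

abbreviation "S \<equiv> (\<lambda>x. x \<delta>) ` Q"
abbreviation "K \<equiv> perp (carrier G) (perp (carrier G) S)"

lemma Q_bounded: "x \<in> Q \<Longrightarrow> x \<in> B2"
  using vN by (auto simp: von_neumann_algebra_def)

lemma Q_subset: "Q \<subseteq> B2"
  using Q_bounded by blast

lemma Q_adj: "x \<in> Q \<Longrightarrow> x\<^sup>\<star> \<in> Q"
  by (rule von_neumann_algebra_adj[OF vN])

lemma bicommutant: "comm (comm Q) = Q"
  using vN by (auto simp: von_neumann_algebra_def)

lemma comm_Q_bounded: "T \<in> comm Q \<Longrightarrow> T \<in> B2"
  by (rule commutant_bounded)

lemma comm_Q_adj: "T \<in> comm Q \<Longrightarrow> T\<^sup>\<star> \<in> comm Q"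
  by (rule adj_commutant[OF _ Q_subset Q_adj])

lemma Q_id: "id_op (carrier G) \<in> Q"
  using id_op_commutant[of "comm Q" "carrier G"] by (simp add: bicommutant subset_iff comm_Q_bounded)

lemma S_ell2: "S \<subseteq> L2"
  using Q_bounded by (auto intro: op_ell2)

lemma K_ell2: "f \<in> K \<Longrightarrow> f \<in> L2"
  by (rule perp_ell2)

lemma Q_delta_K: "x \<in> Q \<Longrightarrow> x \<delta> \<in> K"
  by (rule perp_perpI[OF S_ell2]) simp

lemma delta_K: "\<delta> \<in> K"
  using Q_delta_K[OF Q_id] by simp

lemma Q_perp: "x \<in> Q \<Longrightarrow> p \<in> perp (carrier G) S \<Longrightarrow> x p \<in> perp (carrier G) S"
  unfolding perp_def
proof (safe)
  fix y assume x: "x \<in> Q" and y: "y \<in> Q" and p: "p \<in> L2" "\<forall>s\<in>S. \<langle>p, s\<rangle> = 0"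
  note b = Q_bounded[OF x] Q_bounded[OF y]
  show "x p \<in> L2" by (rule op_ell2[OF b(1)])
  have "x\<^sup>\<star> \<circ> y \<in> Q"
    using comp_commutant[of "x\<^sup>\<star>" "carrier G" "comm Q" y] x y by (simp add: bicommutant Q_adj)
  then have "\<langle>p, x\<^sup>\<star> (y \<delta>)\<rangle> = 0" using p(2) by force
  then show "\<langle>x p, y \<delta>\<rangle> = 0" using inner_adj_right[OF b(1) p(1) op_ell2[OF b(2)]] by simp
qed

lemma K_iff: "k \<in> K \<longleftrightarrow> k \<in> L2 \<and> (\<forall>p\<in>perp (carrier G) S. \<langle>k, p\<rangle> = 0)"
  by (simp add: perp_def[of _ "perp (carrier G) S"])

lemma Q_K:
  assumes x: "x \<in> Q" and k: "k \<in> K" shows "x k \<in> K"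
  unfolding K_iff
proof (intro conjI ballI)
  note b = Q_bounded[OF x]
  show "x k \<in> L2" by (rule op_ell2[OF b])
  fix p assume p: "p \<in> perp (carrier G) S"
  have "\<langle>k, x\<^sup>\<star> p\<rangle> = 0" using k Q_perp[OF Q_adj[OF x] p] unfolding K_iff by blast
  then show "\<langle>x k, p\<rangle> = 0" using inner_adj_right[OF b K_ell2[OF k] perp_ell2[OF p]] by simp
qed

lemma flip_Q_delta: "x \<in> Q \<Longrightarrow> J (x \<delta>) = x\<^sup>\<star> \<delta>"
  using sub flip_group_vN_delta by blast

text \<open>\<open>J\<close> permutes \<open>S\<close>, by \<open>flip_Q_delta\<close>. Moving it
  across the inner product shows that it preserves \<open>perp\<close> of \<open>S\<close>, and in
  the same way \<open>K\<close>.\<close>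

lemma flip_K:
  assumes k: "k \<in> K" shows "J k \<in> K"
proof -
  have Jp: "J p \<in> perp (carrier G) S" if p: "p \<in> perp (carrier G) S" for p
    unfolding perp_def
  proof (safe intro!: flip_ell2)
    fix x assume x: "x \<in> Q"
    have "\<langle>J p, x \<delta>\<rangle> = \<langle>x\<^sup>\<star> \<delta>, p\<rangle>"
      using inner_flip_left[OF perp_ell2[OF p] op_ell2[OF Q_bounded[OF x]]]
      by (simp add: flip_Q_delta[OF x])
    also have "\<dots> = cnj \<langle>p, x\<^sup>\<star> \<delta>\<rangle>" by (rule inner_commute)
    also have "\<dots> = 0" using p Q_adj[OF x] by (auto simp: perp_def)
    finally show "\<langle>J p, x \<delta>\<rangle> = 0" .
  qed
  show ?thesis
    unfolding perp_def[of _ "perp (carrier G) S"]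
  proof (safe intro!: flip_ell2)
    fix p assume p: "p \<in> perp (carrier G) S"
    have "\<langle>k, J p\<rangle> = 0" using k Jp[OF p] by (auto simp: perp_def[of _ "perp (carrier G) S"])
    then have "\<langle>J p, k\<rangle> = 0" by (subst inner_commute) simp
    then show "\<langle>J k, p\<rangle> = 0"
      using inner_flip_left[OF K_ell2[OF k] perp_ell2[OF p]] by simp
  qed
qed

lemma K_determined:
  assumes v: "v \<in> K" and orth: "\<And>x. x \<in> Q \<Longrightarrow> \<langle>v, x \<delta>\<rangle> = 0"
  shows "v = (\<lambda>_. 0)"
proof (rule norm_eq_zero[OF K_ell2[OF v]])
  have "v \<in> perp (carrier G) S" using orth K_ell2[OF v] by (auto simp: perp_def)
  then have "\<langle>v, v\<rangle> = 0" using v by (auto simp: perp_def[of _ "perp (carrier G) S"])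
  then show "ell2_norm (carrier G) v = 0" by (simp add: inner_self)
qed

lemma comm_u_subset: "comm (u ` carrier G) \<subseteq> comm Q"
proof -
  have "comm (u ` carrier G) = comm (group_vN G)"
    unfolding subgroup_vN_def by (rule tricommutant[symmetric, OF left_regular_image_bounded]) simp
  then show ?thesis using commutant_antimono[OF sub] by simp
qed

lemma right_regular_comm_Q: "g \<in> carrier G \<Longrightarrow> r g \<in> comm Q"
  using right_regular_commutant comm_u_subset by blast

lemma flip_conj_Q: "x \<in> group_vN G \<Longrightarrow> J \<circ> x \<circ> J \<in> comm Q"
  using flip_conj_group_vN comm_u_subset by blast

end

section \<open>The projection onto K and the compressed commutant\<close>

locale vN_projection = vN_subalgebra G Q for G (structure) and Q +
  fixes e :: "'a oper"
  assumes e_bounded: "e \<in> B2"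
    and e_K: "e f \<in> K"
    and e_fix: "f \<in> K \<Longrightarrow> e f = f"
    and e_herm: "f \<in> L2 \<Longrightarrow> g \<in> L2 \<Longrightarrow> \<langle>e f, g\<rangle> = \<langle>f, e g\<rangle>"
begin

lemma e_adj: "e\<^sup>\<star> = e"
  by (rule adj_unique[OF e_bounded e_bounded]) (rule e_herm)

lemma e_idem: "e (e f) = e f"
  by (rule e_fix[OF e_K])

lemma e_ell2: "e f \<in> L2"
  by (rule op_ell2[OF e_bounded])

lemma e_delta: "e \<delta> = \<delta>"
  by (rule e_fix[OF delta_K])

text \<open>The range of \<open>e\<close> is invariant under each element of \<open>Q\<close> and
  under its adjoint, which makes the projection commute with the element.\<close>

lemma e_comm: "e \<in> comm Q"
proof (intro commutantI e_bounded op_eqI comp_bounded Q_bounded)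
  fix x f g assume x: "x \<in> Q" and f: "f \<in> L2" and g: "g \<in> L2"
  note xb = Q_bounded[OF x]
  have efix: "e (y (e h)) = y (e h)" if "y \<in> Q" for y h by (rule e_fix[OF Q_K[OF that e_K]])
  have "\<langle>e (x f), g\<rangle> = \<langle>f, x\<^sup>\<star> (e g)\<rangle>"
    using e_herm[OF op_ell2[OF xb] g, of f] inner_adj_right[OF xb f e_ell2] by simp
  also have "\<dots> = \<langle>f, e (x\<^sup>\<star> (e g))\<rangle>" by (simp only: efix[OF Q_adj[OF x]])
  also have "\<dots> = \<langle>e f, x\<^sup>\<star> (e g)\<rangle>" by (rule e_herm[symmetric]) (auto intro: f op_ell2 xb)
  also have "\<dots> = \<langle>e (x (e f)), g\<rangle>"
    using e_herm[OF op_ell2[OF xb] g] inner_adj_right[OF xb e_ell2 e_ell2] by simp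
  finally show "\<langle>(e \<circ> x) f, g\<rangle> = \<langle>(x \<circ> e) f, g\<rangle>" by (simp add: efix[OF x])
qed (auto intro: e_bounded Q_bounded)

text \<open>As in \<open>e_comm\<close>: \<open>J\<close> preserves \<open>K\<close>, and
  \<open>inner_flip_left\<close> plays the part of the adjoint.\<close>

lemma e_flip: "e (J f) = J (e f)"
proof (cases "f \<in> L2")
  case f: True
  show ?thesis
  proof (rule ell2_eqI[OF e_ell2 flip_ell2])
    fix g assume g: "g \<in> L2"
    have efix: "e (J (e h)) = J (e h)" for h by (rule e_fix[OF flip_K[OF e_K]])
    have "\<langle>e (J f), g\<rangle> = \<langle>J (e g), f\<rangle>"
      using e_herm[OF flip_ell2 g] inner_flip_left[OF f e_ell2] by simp
    also have "\<dots> = \<langle>J (e g), e f\<rangle>"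
      using e_herm[OF flip_ell2 f] efix[of g] by metis
    also have "\<dots> = \<langle>e (J (e f)), g\<rangle>"
      using e_herm[OF flip_ell2 g] inner_flip_left[OF e_ell2 e_ell2] by simp
    finally show "\<langle>e (J f), g\<rangle> = \<langle>J (e f), g\<rangle>" by (simp only: efix)
  qed
next
  case False
  then show ?thesis by (simp add: flip_outside op_outside[OF e_bounded] op_zero[OF e_bounded])
qed

text \<open>The corner \<open>e Q' e\<close>; by the next lemmas \<open>J\<close> maps it into its own commutant.\<close>

definition corner :: "'a oper set" where
  "corner = {T \<in> comm Q. e \<circ> T = T \<and> T \<circ> e = T}"

lemma cornerD:
  assumes "T \<in> corner"
  shows "T \<in> comm Q" "T \<in> B2" "e (T f) = T f" "T (e f) = T f"
proof -
  show "T \<in> comm Q" "T \<in> B2" using assms by (auto simp: corner_def intro: commutant_bounded)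
  have "(e \<circ> T) f = T f" "(T \<circ> e) f = T f" using assms by (simp_all add: corner_def del: o_apply)
  then show "e (T f) = T f" "T (e f) = T f" by simp_all
qed

lemma cornerI: "T \<in> comm Q \<Longrightarrow> e \<circ> T = T \<Longrightarrow> T \<circ> e = T \<Longrightarrow> T \<in> corner"
  by (simp add: corner_def)

lemma corner_adj:
  assumes T: "T \<in> corner" shows "T\<^sup>\<star> \<in> corner"
proof (rule cornerI)
  have *: "e \<circ> T = T" "T \<circ> e = T" using T by (simp_all add: corner_def)
  show "T\<^sup>\<star> \<in> comm Q" by (rule comm_Q_adj[OF cornerD(1)[OF T]])
  show "e \<circ> T\<^sup>\<star> = T\<^sup>\<star>"
    using adj_comp[OF cornerD(2)[OF T] e_bounded] by (simp only: * e_adj)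
  show "T\<^sup>\<star> \<circ> e = T\<^sup>\<star>"
    using adj_comp[OF e_bounded cornerD(2)[OF T]] by (simp only: * e_adj)
qed

lemma corner_compress: "T \<in> comm Q \<Longrightarrow> e \<circ> T \<circ> e \<in> corner"
  by (rule cornerI) (auto intro: comp_commutant e_comm simp: fun_eq_iff e_idem)

text \<open>The counterpart of \<open>flip_Q_delta\<close> for the commutant. Compression places
  both vectors in \<open>K\<close>, where \<open>K_determined\<close> reduces the claim to pairings
  with \<open>x \<delta>\<close>; there the adjoint of \<open>T\<close> moves past that of
  \<open>x\<close> and acts on \<open>\<delta>\<close>.\<close>

lemma flip_corner_delta:
  assumes T: "T \<in> corner" shows "J (T \<delta>) = T\<^sup>\<star> \<delta>"
proof -
  note Tb = cornerD(2)[OF T] note T' = cornerD[OF corner_adj[OF T]]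
  define v where "v = (\<lambda>x. J (T \<delta>) x - T\<^sup>\<star> \<delta> x)"
  have K1: "J (T \<delta>) \<in> K" using flip_K[OF e_K[of "T \<delta>"]] by (simp add: cornerD[OF T])
  have K2: "T\<^sup>\<star> \<delta> \<in> K" using e_K[of "T\<^sup>\<star> \<delta>"] by (simp add: T')
  have "v \<in> K" unfolding v_def by (rule perp_diff[OF K1 K2]) (auto simp: perp_def)
  moreover have "\<langle>v, x \<delta>\<rangle> = 0" if x: "x \<in> Q" for x
  proof -
    note xb = Q_bounded[OF x]
    have "\<langle>J (T \<delta>), x \<delta>\<rangle> = \<langle>x\<^sup>\<star> \<delta>, T \<delta>\<rangle>"
      using inner_flip_left[OF op_ell2[OF Tb] op_ell2[OF xb]] by (simp add: flip_Q_delta x)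
    also have "\<dots> = \<langle>T\<^sup>\<star> (x\<^sup>\<star> \<delta>), \<delta>\<rangle>"
      by (rule inner_adj_left[OF Tb op_ell2[OF adj_bounded[OF xb]], symmetric]) simp
    also have "\<dots> = \<langle>x\<^sup>\<star> (T\<^sup>\<star> \<delta>), \<delta>\<rangle>"
      by (simp only: commutant_apply[OF T'(1) Q_adj[OF x]])
    also have "\<dots> = \<langle>T\<^sup>\<star> \<delta>, x \<delta>\<rangle>"
      by (rule inner_adj_left[OF xb op_ell2[OF T'(2)]]) simp
    finally show ?thesis
      unfolding v_def by (simp add: inner_diff_left flip_ell2 op_ell2[OF T'(2)] op_ell2[OF xb])
  qed
  ultimately have "v = (\<lambda>_. 0)" by (rule K_determined)
  then show ?thesis by (simp add: v_def fun_eq_iff)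
qed

text \<open>\<open>K_determined\<close> is used twice: on the images of the vectors
  \<open>x \<delta>\<close>, and then on the values of the adjoints, which lie in \<open>K\<close>
  because the operators absorb \<open>e\<close> on the right.\<close>

lemma corner_ext:
  assumes R: "R \<in> B2" "\<And>f. e (R f) = R f" "\<And>f. R (e f) = R f"
    and R': "R' \<in> B2" "\<And>f. e (R' f) = R' f" "\<And>f. R' (e f) = R' f"
    and eq: "\<And>x z. x \<in> Q \<Longrightarrow> z \<in> Q \<Longrightarrow> \<langle>R (x \<delta>), z \<delta>\<rangle> = \<langle>R' (x \<delta>), z \<delta>\<rangle>"
  shows "R = R'"
proof (rule op_eqI[OF R(1) R'(1)])
  have on_S: "R (x \<delta>) = R' (x \<delta>)" if x: "x \<in> Q" for x
  proof -
    let ?v = "\<lambda>y. R (x \<delta>) y - R' (x \<delta>) y"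
    have "R (x \<delta>) \<in> K" "R' (x \<delta>) \<in> K"
      using e_K[of "R (x \<delta>)"] e_K[of "R' (x \<delta>)"] by (simp_all only: R(2) R'(2))
    then have "?v \<in> K" by (rule perp_diff) (auto simp: perp_def)
    moreover have "\<langle>?v, z \<delta>\<rangle> = 0" if z: "z \<in> Q" for z
      using eq[OF x z] by (simp add: inner_diff_left op_ell2 R R' Q_bounded z)
    ultimately have "?v = (\<lambda>_. 0)" by (rule K_determined)
    then show ?thesis by (simp add: fun_eq_iff)
  qed
  have e_adj_R: "e (T\<^sup>\<star> g) = T\<^sup>\<star> g" if "T \<in> B2" "\<And>f. T (e f) = T f" for T g
  proof -
    have "T \<circ> e = T" by (rule ext) (simp add: that(2))
    then have "e\<^sup>\<star> \<circ> T\<^sup>\<star> = T\<^sup>\<star>" using adj_comp[OF that(1) e_bounded] by simp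
    then show ?thesis by (metis comp_apply e_adj)
  qed
  fix f g assume fg: "f \<in> L2" "g \<in> L2"
  let ?w = "\<lambda>y. R\<^sup>\<star> g y - R'\<^sup>\<star> g y"
  have "R\<^sup>\<star> g \<in> K" "R'\<^sup>\<star> g \<in> K"
    using e_K[of "R\<^sup>\<star> g"] e_K[of "R'\<^sup>\<star> g"]
    by (simp_all only: e_adj_R[OF R(1,3)] e_adj_R[OF R'(1,3)])
  then have "?w \<in> K" by (rule perp_diff) (auto simp: perp_def)
  moreover have "\<langle>?w, x \<delta>\<rangle> = 0" if x: "x \<in> Q" for x
    by (simp add: inner_diff_left op_ell2 R R' Q_bounded x fg inner_adj_left on_S)
  ultimately have "?w = (\<lambda>_. 0)" by (rule K_determined)
  then have "R\<^sup>\<star> g = R'\<^sup>\<star> g" by (simp add: fun_eq_iff)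
  then show "\<langle>R f, g\<rangle> = \<langle>R' f, g\<rangle>"
    using inner_adj_right[OF R(1) fg] inner_adj_right[OF R'(1) fg] by simp
qed

text \<open>The commutation theorem for a tracial vector. Matrix coefficients on \<open>S\<close>
  are rewritten until \<open>T\<close> and \<open>U\<close> act on \<open>\<delta>\<close> itself,
  where \<open>flip_corner_delta\<close> lets \<open>J\<close> replace each by its adjoint; in
  between, only the commuting left and right actions of \<open>Q\<close> have to be
  exchanged.\<close>

lemma flip_corner_commute:
  assumes T: "T \<in> corner" and U: "U \<in> corner"
  shows "T \<circ> (J \<circ> U \<circ> J) = (J \<circ> U \<circ> J) \<circ> T"
proof (rule corner_ext)
  note Tb = cornerD(2)[OF T] and Ub = cornerD(2)[OF U]
  show "T \<circ> (J \<circ> U \<circ> J) \<in> B2" "J \<circ> U \<circ> J \<circ> T \<in> B2"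
    by (rule comp_bounded[OF Tb flip_conj_bounded[OF Ub]], rule comp_bounded[OF flip_conj_bounded[OF Ub] Tb])
  fix f
  show "(T \<circ> (J \<circ> U \<circ> J)) (e f) = (T \<circ> (J \<circ> U \<circ> J)) f"
    "e ((T \<circ> (J \<circ> U \<circ> J)) f) = (T \<circ> (J \<circ> U \<circ> J)) f"
    "e ((J \<circ> U \<circ> J \<circ> T) f) = (J \<circ> U \<circ> J \<circ> T) f"
    "(J \<circ> U \<circ> J \<circ> T) (e f) = (J \<circ> U \<circ> J \<circ> T) f"
    by (simp_all add: cornerD(3,4)[OF T] cornerD(3)[OF U] e_flip)
       (simp add: cornerD(4)[OF U] flip: e_flip)
next
  note Tb = cornerD(2)[OF T] and Ub = cornerD(2)[OF U]
  note T' = cornerD[OF corner_adj[OF T]] and U' = cornerD[OF corner_adj[OF U]]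
  fix x z assume x: "x \<in> Q" and z: "z \<in> Q"
  note xb = Q_bounded[OF x] and zb = Q_bounded[OF z]
  note mem = op_ell2[OF Tb] op_ell2[OF Ub] op_ell2[OF T'(2)] op_ell2[OF U'(2)] op_ell2[OF xb]
    op_ell2[OF zb] op_ell2[OF adj_bounded[OF xb]] op_ell2[OF adj_bounded[OF zb]] flip_ell2 kron_ell2[OF one_closed]
  \<comment> \<open>Conjugation by \<open>J\<close> turns left multiplication by \<open>z\<close>
    into a right multiplication, which commutes with \<open>x\<close>.\<close>
  have Jz: "J (z (J (x f))) = x (J (z (J f)))" for f
    using commutant_apply[OF flip_conj_Q x, of z f] sub z by auto
  have "\<langle>(J \<circ> U \<circ> J \<circ> T) (x \<delta>), z \<delta>\<rangle> = \<langle>J (z \<delta>), U (J (T (x \<delta>)))\<rangle>"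
    using inner_flip_left[OF mem(2) mem(6), of "J (T (x \<delta>))" \<delta>] by simp
  also have "\<dots> = \<langle>U\<^sup>\<star> (z\<^sup>\<star> \<delta>), J (x (T \<delta>))\<rangle>"
    by (simp only: flip_Q_delta[OF z] commutant_apply[OF cornerD(1)[OF T] x]
       inner_adj_left[OF Ub mem(8) mem(9)])
  also have "\<dots> = \<langle>z\<^sup>\<star> (J (U \<delta>)), J (x (T \<delta>))\<rangle>"
    by (simp only: commutant_apply[OF U'(1) Q_adj[OF z]] flip_corner_delta[OF U])
  also have "\<dots> = \<langle>J (U \<delta>), z (J (x (T \<delta>)))\<rangle>" by (rule inner_adj_left[OF zb mem(9) mem(9)])
  also have "\<dots> = \<langle>J (z (J (x (T \<delta>)))), U \<delta>\<rangle>" by (rule inner_flip_left[OF mem(2) mem(6)])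
  also have "\<dots> = \<langle>x (J (z (J (T \<delta>)))), U \<delta>\<rangle>" by (simp only: Jz)
  also have "\<dots> = \<langle>J (z (J (T \<delta>))), x\<^sup>\<star> (U \<delta>)\<rangle>" by (rule inner_adj_right[OF xb mem(9) mem(2), symmetric])
  also have "\<dots> = \<langle>J (x\<^sup>\<star> (U \<delta>)), z (J (T \<delta>))\<rangle>" by (rule inner_flip_left[OF mem(6) mem(7)])
  also have "\<dots> = \<langle>J (U (J (x \<delta>))), T\<^sup>\<star> (z \<delta>)\<rangle>"
    by (simp only: flip_corner_delta[OF T] commutant_apply[OF T'(1) z] flip_Q_delta[OF x]
      commutant_apply[OF cornerD(1)[OF U] Q_adj[OF x]])
  also have "\<dots> = \<langle>(T \<circ> (J \<circ> U \<circ> J)) (x \<delta>), z \<delta>\<rangle>"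
    using inner_adj_right[OF Tb mem(9) mem(6)] by simp
  finally show "\<langle>(T \<circ> (J \<circ> U \<circ> J)) (x \<delta>), z \<delta>\<rangle> = \<langle>(J \<circ> U \<circ> J \<circ> T) (x \<delta>), z \<delta>\<rangle>" by simp
qed

text \<open>The candidates are closed under composition with the defect because the defect lies in
  the commutant of \<open>Q\<close>. They include every \<open>e \<circ> r g\<close>, and pairing
  its value at a defect vector with \<open>\<delta>\<close> reads off the coordinate at
  \<open>g\<close>; so for a maximal family all defect vectors vanish.\<close>

lemma exists_family:
  obtains F where "subunital (carrier G) F" "F \<subseteq> comm Q" "\<And>V. V \<in> F \<Longrightarrow> e \<circ> V = V"
    "cp_map (carrier G) F (id_op (carrier G)) = id_op (carrier G)"
proof -
  let ?V = "{V \<in> comm Q. e \<circ> V = V}"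
  have def_comm: "defect (carrier G) F \<in> comm Q" if "subunital (carrier G) F" "F \<subseteq> ?V" for F
    unfolding defect_def
    by (intro diff_commutant id_op_commutant cp_map_id_commutant Q_subset Q_adj) (use that in auto)
  obtain F where F: "F \<subseteq> ?V" "subunital (carrier G) F"
    and zero: "\<And>V f. V \<in> ?V \<Longrightarrow> f \<in> L2 \<Longrightarrow> V (defect (carrier G) F f) = (\<lambda>_. 0)"
  proof (rule exists_maximal_family[of ?V "carrier G"])
    show "?V \<subseteq> B2" by (auto simp: comm_Q_bounded)
    fix F V c assume *: "F \<subseteq> ?V" "subunital (carrier G) F" "V \<in> ?V"
    let ?W = "\<lambda>f x. complex_of_real c * V (defect (carrier G) F f) x"
    have VR: "V \<circ> defect (carrier G) F \<in> comm Q"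
      using * def_comm[OF *(2,1)] by (intro comp_commutant) auto
    have "?W \<in> comm Q" using scale_commutant[OF VR Q_subset] by simp
    moreover have "e \<circ> ?W = ?W"
    proof
      fix f
      have "V (defect (carrier G) F f) \<in> L2" using * by (auto intro: op_ell2 comm_Q_bounded)
      moreover have "e (V g) = V g" for g using * by (auto dest: fun_cong)
      ultimately show "(e \<circ> ?W) f = ?W f" by (simp add: op_scale[OF e_bounded])
    qed
    ultimately show "?W \<in> ?V" by simp
  qed blast
  let ?R = "defect (carrier G) F"
  have "?R f = (\<lambda>_. 0)" if f: "f \<in> L2" for f
  proof (rule ell2_ext[OF op_ell2[OF defect_bounded[OF F(2)]] zero_in_ell2])
    fix g assume g: "g \<in> carrier G"
    have Rf: "?R f \<in> L2" by (rule op_ell2[OF defect_bounded[OF F(2)]])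
    have "e \<circ> r g \<in> ?V"
      using g by (auto intro: comp_commutant e_comm right_regular_comm_Q simp: fun_eq_iff e_idem)
    then have "e (r g (?R f)) = (\<lambda>_. 0)" using zero[OF _ f, of "e \<circ> r g"] by simp
    then have "0 = \<langle>e (r g (?R f)), \<delta>\<rangle>" by simp
    also have "\<dots> = \<langle>r g (?R f), \<delta>\<rangle>"
      using e_herm[OF op_ell2[OF right_regular_bounded[OF g]], of \<delta>] by (simp add: e_delta)
    also have "\<dots> = \<langle>?R f, kron g\<rangle>"
      using inner_right_regular[OF g Rf, of \<delta>] g by (simp add: right_regular_delta)
    finally show "?R f g = 0" using g by (simp add: inner_kron)
  qed
  then have "cp_map (carrier G) F (id_op (carrier G)) f = f" if "f \<in> L2" for f
    using that defect_apply[OF F(2) that] by (simp add: fun_eq_iff)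
  then have "cp_map (carrier G) F (id_op (carrier G)) = id_op (carrier G)"
    by (intro op_eqI[where A = "carrier G"] cp_map_bounded[OF F(2)] id_op_bounded) simp
  with F that show thesis by blast
qed

end

section \<open>The completely positive map of the family and its values in Q\<close>

locale vN_frame = vN_projection G Q e for G (structure) and Q and e +
  fixes F :: "'a oper set"
  assumes F_sub: "subunital (carrier G) F"
    and F_comm: "F \<subseteq> comm Q"
    and F_e: "V \<in> F \<Longrightarrow> e \<circ> V = V"
    and F_unit: "cp_map (carrier G) F (id_op (carrier G)) = id_op (carrier G)"
begin

abbreviation "\<Theta> \<equiv> cp_map (carrier G) F"

lemma Theta_bounded: "T \<in> B2 \<Longrightarrow> \<Theta> T \<in> B2"
  by (rule cp_map_bounded[OF F_sub])

lemma F_bounded: "V \<in> F \<Longrightarrow> V \<in> B2"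
  using F_comm by (auto intro: comm_Q_bounded)

lemma Theta_bimodule:
  assumes "T \<in> B2" "a \<in> Q" "b \<in> Q"
  shows "\<Theta> (a \<circ> T \<circ> b) = a \<circ> \<Theta> T \<circ> b"
proof (rule cp_map_bimodule[OF F_sub assms(1)])
  fix V assume "V \<in> F"
  then have V: "V \<in> comm Q" using F_comm by auto
  show "a\<^sup>\<star> \<circ> V = V \<circ> a\<^sup>\<star>" "b \<circ> V = V \<circ> b"
    using commutantD[OF V Q_adj[OF assms(2)]] commutantD[OF V assms(3)] by simp_all
qed (use assms in \<open>auto simp: Q_bounded\<close>)

lemma Theta_Q: 
  assumes x: "x \<in> Q" shows "\<Theta> x = x"
proof -
  note xb = Q_bounded[OF x]
  show ?thesis
    using Theta_bimodule[OF id_op_bounded x Q_id] by (simp only: F_unit comp_id_op[OF xb])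
qed

lemma inner_family:
  assumes "f \<in> L2" "g \<in> L2"
  shows "\<langle>f, g\<rangle> = (\<Sum>\<^sub>\<infinity>V\<in>F. \<langle>V f, V g\<rangle>)"
  using inner_cp_map_id[OF F_sub assms] assms by (simp add: F_unit)

text \<open>The family resolves the identity and each \<open>W V\<^sup>*\<close> with \<open>W\<close> in it lies in the corner, hence
  commutes with \<open>e y e\<close>.\<close>

lemma Theta_intertwine:
  assumes y: "y \<in> B2" and Jy: "J \<circ> y \<circ> J \<in> comm Q"
    and V: "V \<in> comm Q" "e \<circ> V = V"
  shows "e \<circ> y \<circ> e \<circ> V = V \<circ> \<Theta> y"
proof (rule op_eqI)
  note Vb = comm_Q_bounded[OF V(1)]
  show "e \<circ> y \<circ> e \<circ> V \<in> B2" "V \<circ> \<Theta> y \<in> B2"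
    by (intro comp_bounded e_bounded y Vb Theta_bounded)+
  let ?U = "e \<circ> (J \<circ> y \<circ> J) \<circ> e"
  have U: "?U \<in> corner" by (rule corner_compress[OF Jy])
  have JUJ: "J \<circ> ?U \<circ> J = e \<circ> y \<circ> e"
  proof
    fix f show "(J \<circ> ?U \<circ> J) f = (e \<circ> y \<circ> e) f"
    proof (cases "f \<in> L2")
      case True
      then show ?thesis
        by (simp add: e_flip e_flip[symmetric, of "J _"] flip_flip e_ell2 op_ell2[OF y])
    next
      case False
      then show ?thesis
        by (simp add: flip_outside op_outside[OF e_bounded] op_zero[OF e_bounded] op_zero[OF y])
    qed
  qed
  \<comment> \<open>The adjoint is again \<open>J\<close>-conjugate to a corner element, so
    \<open>flip_corner_commute\<close> still applies, and in this form the operator can travel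
    through the second argument of the inner product.\<close>
  let ?y1 = "(e \<circ> y \<circ> e)\<^sup>\<star>"
  have eyeb: "e \<circ> y \<circ> e \<in> B2" by (intro comp_bounded e_bounded y)
  have y1: "?y1 = J \<circ> ?U\<^sup>\<star> \<circ> J"
    unfolding JUJ[symmetric] by (rule flip_conj_adj[OF cornerD(2)[OF U]])
  have comm: "T (?y1 f) = ?y1 (T f)" if "T \<in> corner" for T f
    using flip_corner_commute[OF that corner_adj[OF U]] unfolding y1[symmetric]
    by (auto dest: fun_cong)
  have V'e: "V\<^sup>\<star> \<circ> e = V\<^sup>\<star>" using adj_comp[OF e_bounded Vb] by (simp add: V e_adj)
  fix f h assume f: "f \<in> L2" and h: "h \<in> L2"
  have eV: "e (V g) = V g" for g using V(2) by (auto dest: fun_cong)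
  have V'h: "V\<^sup>\<star> h \<in> L2" by (rule op_ell2[OF adj_bounded[OF Vb]])
  have "\<langle>(e \<circ> y \<circ> e \<circ> V) f, h\<rangle> = \<langle>V f, ?y1 h\<rangle>"
    using inner_adj_right[OF eyeb op_ell2[OF Vb] h] by simp
  also have "\<dots> = \<langle>f, V\<^sup>\<star> (?y1 h)\<rangle>"
    by (rule inner_adj_right[OF Vb f, symmetric]) (rule op_ell2[OF adj_bounded[OF eyeb]])
  also have "\<dots> = (\<Sum>\<^sub>\<infinity>W\<in>F. \<langle>W f, W (V\<^sup>\<star> (?y1 h))\<rangle>)"
    by (rule inner_family[OF f op_ell2[OF adj_bounded[OF Vb]]])
  also have "\<dots> = (\<Sum>\<^sub>\<infinity>W\<in>F. \<langle>y (W f), W (V\<^sup>\<star> h)\<rangle>)"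
  proof (rule infsum_cong)
    fix W assume W: "W \<in> F"
    have Wb: "W \<in> B2" and eW: "e (W g) = W g" for g
      using F_bounded[OF W] F_e[OF W] by (auto dest: fun_cong)
    have "W \<circ> V\<^sup>\<star> \<in> corner"
    proof (rule cornerI)
      show "W \<circ> V\<^sup>\<star> \<in> comm Q" using W F_comm by (auto intro: comp_commutant comm_Q_adj V)
      show "e \<circ> (W \<circ> V\<^sup>\<star>) = W \<circ> V\<^sup>\<star>" by (simp add: comp_assoc[symmetric] F_e[OF W])
      show "W \<circ> V\<^sup>\<star> \<circ> e = W \<circ> V\<^sup>\<star>" by (simp add: comp_assoc V'e)
    qed
    from comm[OF this, of h] have "\<langle>W f, W (V\<^sup>\<star> (?y1 h))\<rangle> = \<langle>W f, ?y1 (W (V\<^sup>\<star> h))\<rangle>" by simp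
    also have "\<dots> = \<langle>e (y (W f)), W (V\<^sup>\<star> h)\<rangle>"
      using inner_adj_right[OF eyeb op_ell2[OF Wb] op_ell2[OF Wb]] by (simp add: eW)
    also have "\<dots> = \<langle>y (W f), W (V\<^sup>\<star> h)\<rangle>"
      using e_herm[OF op_ell2[OF y] op_ell2[OF Wb]] by (simp add: eW)
    finally show "\<langle>W f, W (V\<^sup>\<star> (?y1 h))\<rangle> = \<langle>y (W f), W (V\<^sup>\<star> h)\<rangle>" .
  qed
  also have "\<dots> = \<langle>\<Theta> y f, V\<^sup>\<star> h\<rangle>" by (rule inner_cp_map[OF F_sub y f V'h, symmetric])
  also have "\<dots> = \<langle>(V \<circ> \<Theta> y) f, h\<rangle>"
    using inner_adj_right[OF Vb op_ell2[OF Theta_bounded[OF y]] h] by simp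
  finally show "\<langle>(e \<circ> y \<circ> e \<circ> V) f, h\<rangle> = \<langle>(V \<circ> \<Theta> y) f, h\<rangle>" .
qed

text \<open>Along with \<open>V\<close>, every \<open>V \<circ> X\<close> with \<open>X\<close> in
  the commutant of \<open>Q\<close> is admissible in \<open>Theta_intertwine\<close>. Summing the
  resulting relations over \<open>F\<close> shows that \<open>\<Theta> y\<close> commutes with
  \<open>X\<close>, and \<open>Q\<close> is its own bicommutant.\<close>

lemma Theta_in_Q:
  assumes y: "y \<in> B2" and Jy: "J \<circ> y \<circ> J \<in> comm Q"
  shows "\<Theta> y \<in> Q"
proof -
  have "\<Theta> y \<in> comm (comm Q)"
  proof (intro commutantI Theta_bounded y op_eqI)
    fix X assume X: "X \<in> comm Q"
    note Xb = comm_Q_bounded[OF X]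
    show "\<Theta> y \<circ> X \<in> B2" "X \<circ> \<Theta> y \<in> B2" by (intro comp_bounded Theta_bounded y Xb)+
    fix f g assume f: "f \<in> L2" and g: "g \<in> L2"
    have "\<langle>\<Theta> y (X f), g\<rangle> = (\<Sum>\<^sub>\<infinity>V\<in>F. \<langle>y (V (X f)), V g\<rangle>)"
      by (rule inner_cp_map[OF F_sub y op_ell2[OF Xb] g])
    also have "\<dots> = (\<Sum>\<^sub>\<infinity>V\<in>F. \<langle>V (X (\<Theta> y f)), V g\<rangle>)"
    proof (rule infsum_cong)
      fix V assume V: "V \<in> F"
      then have VX: "V \<circ> X \<in> comm Q" using F_comm X by (auto intro: comp_commutant)
      have eV: "e (V g) = V g" for g using F_e[OF V] by (auto dest: fun_cong)
      have "e \<circ> y \<circ> e \<circ> (V \<circ> X) = V \<circ> X \<circ> \<Theta> y"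
        by (rule Theta_intertwine[OF y Jy VX]) (simp add: comp_assoc[symmetric] F_e[OF V])
      then have "e (y (V (X f))) = V (X (\<Theta> y f))" by (auto dest!: fun_cong[of _ _ f] simp: eV)
      moreover have "\<langle>e (y (V (X f))), V g\<rangle> = \<langle>y (V (X f)), V g\<rangle>"
        using e_herm[OF op_ell2[OF y] op_ell2[OF F_bounded[OF V]]] by (simp add: eV)
      ultimately show "\<langle>y (V (X f)), V g\<rangle> = \<langle>V (X (\<Theta> y f)), V g\<rangle>" by simp
    qed
    also have "\<dots> = \<langle>X (\<Theta> y f), g\<rangle>" by (rule inner_family[OF op_ell2[OF Xb] g, symmetric])
    finally show "\<langle>(\<Theta> y \<circ> X) f, g\<rangle> = \<langle>(X \<circ> \<Theta> y) f, g\<rangle>" by simp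
  qed
  then show ?thesis by (simp add: bicommutant)
qed

text \<open>This is the intertwining relation for \<open>V = e\<close>. It identifies
  \<open>\<Theta>\<close> on the group algebra with the trace-preserving conditional expectation,
  which acts on vectors as \<open>e\<close>.\<close>

lemma Theta_delta:
  assumes y: "y \<in> B2" and Jy: "J \<circ> y \<circ> J \<in> comm Q"
  shows "\<Theta> y \<delta> = e (y \<delta>)"
proof -
  have "e \<circ> y \<circ> e \<circ> e = e \<circ> \<Theta> y"
    by (rule Theta_intertwine[OF y Jy e_comm]) (simp add: fun_eq_iff e_idem)
  from fun_cong[OF this, of \<delta>] have "e (y \<delta>) = e (\<Theta> y \<delta>)" by (simp add: e_delta)
  also have "\<dots> = \<Theta> y \<delta>" by (rule e_fix[OF Q_delta_K[OF Theta_in_Q[OF assms]]])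
  finally show ?thesis by simp
qed

text \<open>\<open>\<Theta> x\<close> and \<open>x\<close> agree at the separating vector
  \<open>\<delta>\<close>. Applied to L(H) at the end, where the hypothesis follows from the
  coefficients of \<open>x\<close> being supported in \<open>H\<close>.\<close>

lemma in_Q_if_delta_in_K:
  assumes x: "x \<in> group_vN G" and K: "x \<delta> \<in> K"
  shows "x \<in> Q"
proof -
  note xb = group_vN_bounded[OF x] and Jx = flip_conj_Q[OF x]
  have "\<Theta> x = x"
  proof (rule group_vN_separating[OF _ x])
    show "\<Theta> x \<in> group_vN G" using Theta_in_Q[OF xb Jx] sub by blast
    show "\<Theta> x \<delta> = x \<delta>" using Theta_delta[OF xb Jx] e_fix[OF K] by simp
  qed
  then show ?thesis using Theta_in_Q[OF xb Jx] by simp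
qed

end

lemma (in vN_subalgebra) exists_frame: "\<exists>e F. vN_frame G Q e F"
proof -
  obtain e where e: "e \<in> B2" "\<And>f. e f \<in> K" "\<And>f. f \<in> K \<Longrightarrow> e f = f"
    "\<And>f g. f \<in> L2 \<Longrightarrow> g \<in> L2 \<Longrightarrow> \<langle>e f, g\<rangle> = \<langle>f, e g\<rangle>"
    using exists_projection[OF S_ell2 one_closed] by blast
  interpret vN_projection G Q e by unfold_locales (fact e)+
  obtain F where "subunital (carrier G) F" "F \<subseteq> comm Q" "\<And>V. V \<in> F \<Longrightarrow> e \<circ> V = V"
    "cp_map (carrier G) F (id_op (carrier G)) = id_op (carrier G)"
    using exists_family by blast
  then have "vN_frame G Q e F" by unfold_locales
  then show ?thesis by blast
qed

section \<open>Averaging over an amenable subgroup\<close>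

text \<open>Real and imaginary parts are averaged separately, whence the factor 2 in the last
  property.\<close>

lemma amenable_group_complex_mean:
  assumes "amenable_group L"
  obtains M :: "('a \<Rightarrow> complex) \<Rightarrow> complex" where
    "\<And>f g. bounded (f ` carrier L) \<Longrightarrow> bounded (g ` carrier L) \<Longrightarrow> M (\<lambda>x. f x + g x) = M f + M g"
    "\<And>c f. bounded (f ` carrier L) \<Longrightarrow> M (\<lambda>x. c * f x) = c * M f"
    "\<And>f. bounded (f ` carrier L) \<Longrightarrow> (\<And>x. x \<in> carrier L \<Longrightarrow> f x \<in> \<real>\<^sub>\<ge>\<^sub>0) \<Longrightarrow> M f \<in> \<real>\<^sub>\<ge>\<^sub>0"
    "M (\<lambda>_. 1) = 1"
    "\<And>g f. g \<in> carrier L \<Longrightarrow> bounded (f ` carrier L) \<Longrightarrow> M (\<lambda>x. f (g \<otimes>\<^bsub>L\<^esub> x)) = M f"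
    "\<And>f C. (\<And>x. x \<in> carrier L \<Longrightarrow> cmod (f x) \<le> C) \<Longrightarrow> cmod (M f) \<le> 2 * C"
proof -
  let ?b = "\<lambda>f :: 'a \<Rightarrow> real. bounded (f ` carrier L)"
  obtain m :: "('a \<Rightarrow> real) \<Rightarrow> real" where
    "(\<forall>f g. ?b f \<and> ?b g \<longrightarrow> m (\<lambda>x. f x + g x) = m f + m g) \<and>
     (\<forall>c f. ?b f \<longrightarrow> m (\<lambda>x. c * f x) = c * m f) \<and>
     (\<forall>f. ?b f \<and> (\<forall>x\<in>carrier L. 0 \<le> f x) \<longrightarrow> 0 \<le> m f) \<and>
     m (\<lambda>_. 1) = 1 \<and>
     (\<forall>g\<in>carrier L. \<forall>f. ?b f \<longrightarrow> m (\<lambda>x. f (g \<otimes>\<^bsub>L\<^esub> x)) = m f)"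
    using assms unfolding amenable_group_def by (elim exE)
  then have add: "?b f \<Longrightarrow> ?b g \<Longrightarrow> m (\<lambda>x. f x + g x) = m f + m g"
    and scale: "?b f \<Longrightarrow> m (\<lambda>x. c * f x) = c * m f"
    and pos: "?b f \<Longrightarrow> (\<And>x. x \<in> carrier L \<Longrightarrow> 0 \<le> f x) \<Longrightarrow> 0 \<le> m f"
    and one: "m (\<lambda>_. 1) = 1"
    and inv: "a \<in> carrier L \<Longrightarrow> ?b f \<Longrightarrow> m (\<lambda>x. f (a \<otimes>\<^bsub>L\<^esub> x)) = m f" for f g c a
    by simp_all
  have bI: "?b f" if "\<And>x. x \<in> carrier L \<Longrightarrow> \<bar>f x\<bar> \<le> C" for f C
    using that by (auto simp: bounded_iff)
  have le: "m f \<le> C" if f: "\<And>x. x \<in> carrier L \<Longrightarrow> \<bar>f x\<bar> \<le> C" for f C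
  proof -
    have bf: "?b f" by (rule bI) (rule f)
    have b0: "?b (\<lambda>_. 1)" by (rule bI[of _ 1]) simp
    have b1: "?b (\<lambda>_. C * 1)" by (auto simp: bounded_iff)
    have b2: "?b (\<lambda>x. -1 * f x)" by (rule bI[of _ C]) (use f in simp)
    have "0 \<le> m (\<lambda>x. C * 1 + -1 * f x)"
    proof (rule pos)
      show "?b (\<lambda>x. C * 1 + -1 * f x)"
        by (rule bI[of _ "\<bar>C\<bar> + C"]) (use f in \<open>force intro: order_trans[OF abs_triangle_ineq4]\<close>)
      show "0 \<le> C * 1 + -1 * f x" if "x \<in> carrier L" for x using f[OF that] by simp
    qed
    also have "\<dots> = C - m f"
      using add[OF b1 b2] scale[OF b0, of C] scale[OF bf, of "-1"] one by simp
    finally show ?thesis by simp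
  qed
  have abs: "\<bar>m f\<bar> \<le> C" if f: "\<And>x. x \<in> carrier L \<Longrightarrow> \<bar>f x\<bar> \<le> C" for f C
  proof -
    have bf: "?b f" by (rule bI) (rule f)
    have "m f \<le> C" by (rule le) (rule f)
    moreover have "m (\<lambda>x. -1 * f x) \<le> C" by (rule le) (use f in simp)
    ultimately show ?thesis using scale[OF bf, of "-1"] by simp
  qed
  have ReIm: "?b (\<lambda>x. Re (f x)) \<and> ?b (\<lambda>x. Im (f x))" if f: "bounded (f ` carrier L)" for f
  proof -
    obtain C where "\<And>x. x \<in> carrier L \<Longrightarrow> cmod (f x) \<le> C" using f by (auto simp: bounded_iff)
    then show ?thesis
      using bI[of "\<lambda>x. Re (f x)" C] bI[of "\<lambda>x. Im (f x)" C] abs_Re_le_cmod abs_Im_le_cmod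
      by (meson order_trans)
  qed
  define M where "M = (\<lambda>f. Complex (m (\<lambda>x. Re (f x))) (m (\<lambda>x. Im (f x))))"
  show thesis
  proof (rule that[of M])
    fix f g :: "'a \<Rightarrow> complex"
    assume f: "bounded (f ` carrier L)" and g: "bounded (g ` carrier L)"
    show "M (\<lambda>x. f x + g x) = M f + M g"
      using ReIm[OF f] ReIm[OF g] by (simp add: M_def complex_eq_iff add)
  next
    fix f :: "'a \<Rightarrow> complex" and c assume f: "bounded (f ` carrier L)"
    have b: "?b (\<lambda>x. d * Re (f x))" "?b (\<lambda>x. d * Im (f x))" for d
      using bounded_scaleR_comp[of "\<lambda>x. Re (f x)" "carrier L" d]
        bounded_scaleR_comp[of "\<lambda>x. Im (f x)" "carrier L" d] ReIm[OF f] by simp_all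
    have "m (\<lambda>x. Re c * Re (f x) + - Im c * Im (f x)) = Re c * m (\<lambda>x. Re (f x)) + - Im c * m (\<lambda>x. Im (f x))"
      by (simp only: add[OF b(1) b(2)] scale ReIm[OF f])
    moreover have "m (\<lambda>x. Re c * Im (f x) + Im c * Re (f x)) = Re c * m (\<lambda>x. Im (f x)) + Im c * m (\<lambda>x. Re (f x))"
      by (simp only: add[OF b(2) b(1)] scale ReIm[OF f])
    ultimately show "M (\<lambda>x. c * f x) = c * M f" by (simp add: M_def complex_eq_iff)
  next
    fix f :: "'a \<Rightarrow> complex"
    assume f: "bounded (f ` carrier L)" and nn: "\<And>x. x \<in> carrier L \<Longrightarrow> f x \<in> \<real>\<^sub>\<ge>\<^sub>0"
    have "0 \<le> m (\<lambda>x. Re (f x))"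
      by (rule pos) (use ReIm[OF f] nn in \<open>auto simp: complex_nonneg_Reals_iff\<close>)
    moreover have "\<bar>m (\<lambda>x. Im (f x))\<bar> \<le> 0"
      by (rule abs) (use nn in \<open>auto simp: complex_nonneg_Reals_iff\<close>)
    ultimately show "M f \<in> \<real>\<^sub>\<ge>\<^sub>0" by (simp add: M_def complex_nonneg_Reals_iff)
  next
    have "\<bar>m (\<lambda>_. 0)\<bar> \<le> 0" by (rule abs) simp
    then show "M (\<lambda>_. 1) = 1" by (simp add: M_def one complex_eq_iff)
  next
    fix a and f :: "'a \<Rightarrow> complex"
    assume "a \<in> carrier L" "bounded (f ` carrier L)"
    then show "M (\<lambda>x. f (a \<otimes>\<^bsub>L\<^esub> x)) = M f"
      using ReIm[of f] inv[of a "\<lambda>x. Re (f x)"] inv[of a "\<lambda>x. Im (f x)"] by (simp add: M_def)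
  next
    fix f :: "'a \<Rightarrow> complex" and C assume f: "\<And>x. x \<in> carrier L \<Longrightarrow> cmod (f x) \<le> C"
    have "\<bar>m (\<lambda>x. Re (f x))\<bar> \<le> C" "\<bar>m (\<lambda>x. Im (f x))\<bar> \<le> C"
      by (rule abs, meson f order_trans abs_Re_le_cmod, rule abs, meson f order_trans abs_Im_le_cmod)
    then show "cmod (M f) \<le> 2 * C" using cmod_le[of "M f"] by (simp add: M_def)
  qed
qed

context group
begin

lemma subgroup_vN_subset:
  assumes "H \<subseteq> carrier G" shows "subgroup_vN G H \<subseteq> group_vN G"
  unfolding subgroup_vN_def by (intro commutant_antimono image_mono assms)

lemma left_regular_subgroup_vN:
  "H \<subseteq> carrier G \<Longrightarrow> h \<in> H \<Longrightarrow> u h \<in> subgroup_vN G H"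
  unfolding subgroup_vN_def using subset_bicommutant[OF left_regular_image_bounded] by blast

lemma subgroup_vN_subalgebra:
  assumes "subgroup H G" shows "vN_subalgebra G (subgroup_vN G H)"
  by unfold_locales
    (use subgroup_von_neumann_algebra[OF assms] subgroup_vN_subset[OF subgroup.subset[OF assms]] in auto)

lemma norm_right_regular:
  "g \<in> carrier G \<Longrightarrow> f \<in> L2 \<Longrightarrow> ell2_norm (carrier G) (r g f) = ell2_norm (carrier G) f"
  by (simp add: right_regular_def norm_flip norm_left_regular left_regular_ell2 flip_ell2)

lemma amenable_subgroup_vN:
  assumes H: "subgroup H G" and am: "amenable_group (G\<lparr>carrier := H\<rparr>)"
  shows "amenable_vN (carrier G) (subgroup_vN G H)"
proof -
  have HG: "H \<subseteq> carrier G" by (rule subgroup.subset[OF H])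
  let ?Q = "subgroup_vN G H"
  interpret vN_subalgebra G ?Q by (rule subgroup_vN_subalgebra[OF H])
  obtain e F where "vN_frame G ?Q e F" using exists_frame by blast
  then interpret vN_frame G ?Q e F .
  obtain M :: "('a \<Rightarrow> complex) \<Rightarrow> complex" where
    M_add: "\<And>f g. bounded (f ` H) \<Longrightarrow> bounded (g ` H) \<Longrightarrow> M (\<lambda>x. f x + g x) = M f + M g"
    and M_scale: "\<And>c f. bounded (f ` H) \<Longrightarrow> M (\<lambda>x. c * f x) = c * M f"
    and M_pos: "\<And>f. bounded (f ` H) \<Longrightarrow> (\<And>x. x \<in> H \<Longrightarrow> f x \<in> \<real>\<^sub>\<ge>\<^sub>0) \<Longrightarrow> M f \<in> \<real>\<^sub>\<ge>\<^sub>0"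
    and M_one: "M (\<lambda>_. 1) = 1"
    and M_inv: "\<And>g f. g \<in> H \<Longrightarrow> bounded (f ` H) \<Longrightarrow> M (\<lambda>x. f (g \<otimes> x)) = M f"
    and M_bound: "\<And>f C. (\<And>x. x \<in> H \<Longrightarrow> cmod (f x) \<le> C) \<Longrightarrow> cmod (M f) \<le> 2 * C"
    using amenable_group_complex_mean[OF am] by (auto simp del: of_real_1)
  \<comment> \<open>The functions are defined on the whole type. The bound with constant 0, applied
    to the difference, shows that only the values on \<open>H\<close> matter.\<close>
  have M_cong: "M f = M g" if "bounded (f ` H)" "bounded (g ` H)" "\<And>x. x \<in> H \<Longrightarrow> f x = g x" for f g
  proof -
    have b: "bounded ((\<lambda>x. -1 * g x) ` H)" using that(2) by (auto simp: bounded_iff)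
    have "cmod (M (\<lambda>x. f x + -1 * g x)) \<le> 2 * 0" by (rule M_bound) (simp add: that)
    moreover have "M (\<lambda>x. f x + -1 * g x) = M f + -1 * M g"
      by (simp only: M_add[OF that(1) b] M_scale[OF that(2)])
    ultimately show ?thesis by simp
  qed
  have rb: "k \<in> H \<Longrightarrow> r (inv k) \<in> B2" for k using HG by (auto intro: right_regular_bounded)
  have rm: "k \<in> H \<Longrightarrow> r (inv k) f \<in> L2" for k f by (rule op_ell2[OF rb])
  \<comment> \<open>The matrix coefficient of \<open>T\<close> conjugated by right translation.
    Because of the inverse, replacing \<open>k\<close> by \<open>h \<otimes> k\<close> amounts to
    translating both vectors by the inverse of \<open>h\<close> first, which suits a left-invariant
    mean.\<close>
  define B where "B = (\<lambda>T f g k. \<langle>T (r (inv k) f), r (inv k) g\<rangle>)"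
  have B_bound: "\<exists>K>0. \<forall>f\<in>L2. \<forall>g\<in>L2. \<forall>k\<in>H. cmod (B T f g k)
      \<le> K * (ell2_norm (carrier G) f * ell2_norm (carrier G) g)" if T: "T \<in> B2" for T
  proof -
    obtain K where K: "0 < K" "\<And>f g. f \<in> L2 \<Longrightarrow> g \<in> L2 \<Longrightarrow>
        cmod \<langle>T f, id_op (carrier G) g\<rangle> \<le> K * (ell2_norm (carrier G) f * ell2_norm (carrier G) g)"
      using form_bound[OF inner_op_bounded_form[OF T id_op_bounded]] by blast
    have "cmod (B T f g k) \<le> K * (ell2_norm (carrier G) f * ell2_norm (carrier G) g)"
      if "f \<in> L2" "g \<in> L2" "k \<in> H" for f g k
      using K(2)[OF rm rm, of k k f g] that HG by (simp add: B_def norm_right_regular rm subset_iff)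
    with K(1) show ?thesis by blast
  qed
  have Bb: "bounded (B T f g ` H)" if "T \<in> B2" "f \<in> L2" "g \<in> L2" for T f g
    using B_bound[OF that(1)] that(2,3) by (auto simp: bounded_iff)
  have add: "B T (\<lambda>x. f x + f' x) g k = B T f g k + B T f' g k"
    "B T f (\<lambda>x. g x + g' x) k = B T f g k + B T f g' k"
    "B T (\<lambda>x. c * f x) g k = c * B T f g k"
    "B T f (\<lambda>x. c * g x) k = cnj c * B T f g k"
    if "T \<in> B2" "f \<in> L2" "f' \<in> L2" "g \<in> L2" "g' \<in> L2" "k \<in> H" for T f f' g g' c k
    using that by (simp_all add: B_def op_add[OF rb] op_add op_scale[OF rb] op_scale rm op_ell2
        inner_add_left inner_add_right inner_scale_left inner_scale_right)
  have Bsum: "bounded ((\<lambda>k. f k + g k) ` H)" if "bounded (f ` H)" "bounded (g ` H)" for f g :: "'a \<Rightarrow> complex"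
    using bounded_plus_comp[OF that] .
  have Bsc: "bounded ((\<lambda>k. c * f k) ` H)" if bf: "bounded (f ` H)" for f :: "'a \<Rightarrow> complex" and c
  proof -
    obtain C where "\<forall>x\<in>H. cmod (f x) \<le> C" using bf unfolding bounded_iff by blast
    then have "\<And>x. x \<in> H \<Longrightarrow> cmod (c * f x) \<le> cmod c * C" by (simp add: norm_mult mult_left_mono)
    then show ?thesis by (auto simp: bounded_iff)
  qed
  have form: "bounded_form (carrier G) (\<lambda>f g. M (B T f g))" if T: "T \<in> B2" for T
    unfolding bounded_form_def
  proof (intro conjI ballI allI)
    fix f f' g assume *: "f \<in> L2" "f' \<in> L2" "g \<in> L2"
    have "M (B T (\<lambda>x. f x + f' x) g) = M (\<lambda>k. B T f g k + B T f' g k)"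
      by (rule M_cong) (use * T in \<open>auto intro!: Bb Bsum simp: add\<close>)
    then show "M (B T (\<lambda>x. f x + f' x) g) = M (B T f g) + M (B T f' g)"
      using * T by (simp add: M_add Bb)
  next
    fix c f g assume *: "f \<in> L2" "g \<in> L2"
    have "M (B T (\<lambda>x. c * f x) g) = M (\<lambda>k. c * B T f g k)"
      by (rule M_cong) (use * T in \<open>auto intro!: Bb Bsc simp: add\<close>)
    then show "M (B T (\<lambda>x. c * f x) g) = c * M (B T f g)"
      using * T by (simp add: M_scale Bb)
  next
    fix f g g' assume *: "f \<in> L2" "g \<in> L2" "g' \<in> L2"
    have "M (B T f (\<lambda>x. g x + g' x)) = M (\<lambda>k. B T f g k + B T f g' k)"
      by (rule M_cong) (use * T in \<open>auto intro!: Bb Bsum simp: add\<close>)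
    then show "M (B T f (\<lambda>x. g x + g' x)) = M (B T f g) + M (B T f g')"
      using * T by (simp add: M_add Bb)
  next
    fix c f g assume *: "f \<in> L2" "g \<in> L2"
    have "M (B T f (\<lambda>x. c * g x)) = M (\<lambda>k. cnj c * B T f g k)"
      by (rule M_cong) (use * T in \<open>auto intro!: Bb Bsc simp: add\<close>)
    then show "M (B T f (\<lambda>x. c * g x)) = cnj c * M (B T f g)"
      using * T by (simp add: M_scale Bb)
  next
    obtain K where K: "0 < K" "\<And>f g k. f \<in> L2 \<Longrightarrow> g \<in> L2 \<Longrightarrow> k \<in> H \<Longrightarrow> cmod (B T f g k)
      \<le> K * (ell2_norm (carrier G) f * ell2_norm (carrier G) g)" using B_bound[OF T] by blast
    have "cmod (M (B T f g)) \<le> (2 * K) * (ell2_norm (carrier G) f * ell2_norm (carrier G) g)"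
      if "f \<in> L2" "g \<in> L2" for f g
      using M_bound[of "B T f g"] K(2)[OF that] by (simp add: mult.assoc)
    then show "\<exists>C. \<forall>f\<in>L2. \<forall>g\<in>L2. cmod (M (B T f g))
        \<le> C * (ell2_norm (carrier G) f * ell2_norm (carrier G) g)" by blast
  qed
  define avg where "avg = (\<lambda>T. form_op (carrier G) (\<lambda>f g. M (B T f g)))"
  have avg_b: "T \<in> B2 \<Longrightarrow> avg T \<in> B2" for T unfolding avg_def by (intro form_op_bounded form)
  have inner_avg: "\<langle>avg T f, g\<rangle> = M (B T f g)" if "T \<in> B2" "f \<in> L2" "g \<in> L2" for T f g
    unfolding avg_def by (rule inner_form_op[OF form]) (use that in auto)
  have avg_comm: "avg T (r h f) = r h (avg T f)" if T: "T \<in> B2" and h: "h \<in> H" and f: "f \<in> L2" for T h f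
  proof (rule ell2_eqI)
    have hG: "h \<in> carrier G" using h HG by auto
    show "avg T (r h f) \<in> L2" "r h (avg T f) \<in> L2"
      by (auto intro: op_ell2 avg_b T right_regular_bounded hG)
    have rf: "r h f \<in> L2" "r (inv h) g \<in> L2" for g by (auto intro: op_ell2 right_regular_bounded hG)
    fix g assume g: "g \<in> L2"
    have "\<langle>avg T (r h f), g\<rangle> = M (B T (r h f) g)" by (rule inner_avg[OF T rf(1) g])
    also have "\<dots> = M (\<lambda>k. B T (r h f) g (h \<otimes> k))" by (rule M_inv[symmetric, OF h Bb[OF T rf(1) g]])
    also have "\<dots> = M (B T f (r (inv h) g))"
    proof (rule M_cong)
      show "bounded (B T f (r (inv h) g) ` H)" by (rule Bb[OF T f rf(2)])
      have "(\<lambda>k. B T (r h f) g (h \<otimes> k)) ` H \<subseteq> B T (r h f) g ` H"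
        using h H by (auto simp: subgroup.m_closed)
      then show "bounded ((\<lambda>k. B T (r h f) g (h \<otimes> k)) ` H)"
        by (rule bounded_subset[rotated]) (rule Bb[OF T rf(1) g])
      fix k assume "k \<in> H"
      then have k: "k \<in> carrier G" using HG by auto
      have "r (inv (h \<otimes> k)) (r h f) = r (inv k) f" 
        using k hG by (simp add: right_regular_comp inv_mult_group m_assoc)
      moreover have "r (inv (h \<otimes> k)) g = r (inv k) (r (inv h) g)"
        using k hG by (simp add: right_regular_comp inv_mult_group)
      ultimately show "B T (r h f) g (h \<otimes> k) = B T f (r (inv h) g) k" by (simp add: B_def)
    qed
    also have "\<dots> = \<langle>avg T f, r (inv h) g\<rangle>" by (rule inner_avg[OF T f rf(2), symmetric])
    also have "\<dots> = \<langle>r h (avg T f), g\<rangle>"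
      by (rule inner_right_regular[OF hG op_ell2[OF avg_b[OF T]] g, symmetric])
    finally show "\<langle>avg T (r h f), g\<rangle> = \<langle>r h (avg T f), g\<rangle>" .
  qed
  \<comment> \<open>Commuting with right translations by \<open>H\<close> is what
    \<open>Theta_in_Q\<close> asks for when the algebra is L(H), so \<open>\<Theta>\<close> carries
    every averaged operator into L(H).\<close>
  have J_avg: "J \<circ> avg T \<circ> J \<in> comm ?Q" if T: "T \<in> B2" for T
  proof -
    have "J \<circ> avg T \<circ> J \<in> comm (u ` H)"
      by (rule flip_conj_commutant[OF avg_b[OF T] HG]) (rule avg_comm[OF T])
    then show ?thesis
      unfolding subgroup_vN_def using tricommutant[OF left_regular_image_bounded[OF HG]] by simp
  qed
  \<comment> \<open>Elements of L(H) commute with right translations and therefore slide out of the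
    average.\<close>
  have avg_bimodule: "avg (a \<circ> T \<circ> b) = a \<circ> avg T \<circ> b" if T: "T \<in> B2" and a: "a \<in> ?Q" and b: "b \<in> ?Q" for a b T
  proof (rule op_eqI)
    have ab: "a \<in> B2" "b \<in> B2" and abG: "a\<^sup>\<star> \<in> group_vN G" "b \<in> group_vN G"
      using a b Q_adj[OF a] sub by (auto simp: Q_bounded)
    have aTb: "a \<circ> T \<circ> b \<in> B2" by (intro comp_bounded ab T)
    show "avg (a \<circ> T \<circ> b) \<in> B2" "a \<circ> avg T \<circ> b \<in> B2"
      by (rule avg_b[OF aTb], intro comp_bounded avg_b ab T)
    fix f g assume fg: "f \<in> L2" "g \<in> L2"
    have bf: "b f \<in> L2" "a\<^sup>\<star> g \<in> L2" by (auto intro: op_ell2 ab)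
    have "M (B (a \<circ> T \<circ> b) f g) = M (B T (b f) (a\<^sup>\<star> g))"
    proof (rule M_cong[OF Bb[OF aTb fg] Bb[OF T bf]])
      fix k assume k: "k \<in> H"
      then have kG: "inv k \<in> carrier G" using HG by auto
      have "\<langle>a (T (r (inv k) (b f))), r (inv k) g\<rangle> = \<langle>T (r (inv k) (b f)), a\<^sup>\<star> (r (inv k) g)\<rangle>"
        by (rule inner_adj_right[symmetric]) (auto intro: ab op_ell2 T rm k)
      then show "B (a \<circ> T \<circ> b) f g k = B T (b f) (a\<^sup>\<star> g) k"
        by (simp add: B_def right_regular_group_vN[OF abG(1) kG] right_regular_group_vN[OF abG(2) kG])
    qed
    then show "\<langle>avg (a \<circ> T \<circ> b) f, g\<rangle> = \<langle>(a \<circ> avg T \<circ> b) f, g\<rangle>"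
      using inner_adj_right[OF ab(1) op_ell2[OF avg_b[OF T]] fg(2), of "b f"]
      by (simp add: inner_avg[OF aTb fg] inner_avg[OF T bf])
  qed
  have avg_id: "avg (id_op (carrier G)) = id_op (carrier G)"
  proof (rule op_eqI[where A = "carrier G"])
    fix f g assume fg: "f \<in> L2" "g \<in> L2"
    have "M (B (id_op (carrier G)) f g) = M (\<lambda>_. \<langle>f, g\<rangle> * 1)"
    proof (rule M_cong[OF Bb[OF id_op_bounded fg]])
      show "bounded ((\<lambda>_. \<langle>f, g\<rangle> * 1) ` H)" by (auto simp: bounded_iff)
      fix k assume k: "k \<in> H"
      then have kG: "k \<in> carrier G" using HG by auto
      have "r k (r (inv k) g) = g"
      proof (rule ell2_ext[where A = "carrier G"])
        show "r k (r (inv k) g) \<in> L2" by (rule op_ell2[OF right_regular_bounded[OF kG]])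
      qed (use kG fg rm[OF k] in \<open>auto simp: right_regular_apply m_assoc\<close>)
      then show "B (id_op (carrier G)) f g k = \<langle>f, g\<rangle> * 1"
        using inner_right_regular[of "inv k" f "r (inv k) g"] kG fg rm[OF k] by (simp add: B_def)
    qed
    also have "\<dots> = \<langle>f, g\<rangle>" using M_scale[of "\<lambda>_. 1" "\<langle>f, g\<rangle>"] M_one by (auto simp: bounded_iff image_subset_iff)
    finally show "\<langle>avg (id_op (carrier G)) f, g\<rangle> = \<langle>id_op (carrier G) f, g\<rangle>"
      using fg by (simp add: inner_avg)
  qed (auto intro: avg_b)
  have avg_Q: "avg x = x" if x: "x \<in> ?Q" for x
    using avg_bimodule[OF id_op_bounded x Q_id] by (simp only: avg_id comp_id_op[OF Q_bounded[OF x]])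
  have avg_add: "avg (\<lambda>f x. T f x + T' f x) = (\<lambda>f x. avg T f x + avg T' f x)" if T: "T \<in> B2" "T' \<in> B2" for T T'
  proof (rule op_eqI)
    show "avg (\<lambda>f x. T f x + T' f x) \<in> B2" "(\<lambda>f x. avg T f x + avg T' f x) \<in> B2"
      by (intro avg_b add_op_bounded T)+
    fix f g assume fg: "f \<in> L2" "g \<in> L2"
    have "M (B (\<lambda>f x. T f x + T' f x) f g) = M (\<lambda>k. B T f g k + B T' f g k)"
    proof (rule M_cong)
      fix k assume "k \<in> H"
      then show "B (\<lambda>f x. T f x + T' f x) f g k = B T f g k + B T' f g k"
        unfolding B_def by (intro inner_add_left op_ell2 T rm)
    qed (auto intro!: Bb Bsum T fg add_op_bounded)
    then show "\<langle>avg (\<lambda>f x. T f x + T' f x) f, g\<rangle> = \<langle>\<lambda>x. avg T f x + avg T' f x, g\<rangle>"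
      using fg T by (simp add: inner_avg add_op_bounded M_add Bb inner_add_left op_ell2[OF avg_b])
  qed
  have avg_scale: "avg (\<lambda>f x. c * T f x) = (\<lambda>f x. c * avg T f x)" if T: "T \<in> B2" for T c
  proof (rule op_eqI)
    show "avg (\<lambda>f x. c * T f x) \<in> B2" "(\<lambda>f x. c * avg T f x) \<in> B2"
      by (intro avg_b scale_op_bounded T)+
    fix f g assume fg: "f \<in> L2" "g \<in> L2"
    have "B (\<lambda>f x. c * T f x) f g = (\<lambda>k. c * B T f g k)"
      by (simp add: B_def inner_scale_left)
    then show "\<langle>avg (\<lambda>f x. c * T f x) f, g\<rangle> = \<langle>\<lambda>x. c * avg T f x, g\<rangle>"
      using fg T by (simp add: inner_avg scale_op_bounded M_scale Bb inner_scale_left)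
  qed
  have avg_pos: "positive_op (carrier G) (avg T)" if T: "T \<in> B2" "positive_op (carrier G) T" for T
    unfolding positive_op_def
  proof
    fix f assume f: "f \<in> L2"
    have "M (B T f f) \<in> \<real>\<^sub>\<ge>\<^sub>0"
      using T(2) rm by (intro M_pos Bb T f) (auto simp: B_def positive_op_def)
    then show "\<langle>avg T f, f\<rangle> \<in> \<real>\<^sub>\<ge>\<^sub>0" by (simp only: inner_avg[OF T(1) f f])
  qed
  have "conditional_expectation (carrier G) B2 ?Q (\<lambda>T. \<Theta> (avg T))"
    unfolding conditional_expectation_def
  proof (intro conjI ballI allI impI)
    fix T assume "T \<in> B2"
    then show "\<Theta> (avg T) \<in> ?Q" by (intro Theta_in_Q avg_b J_avg)
  next
    fix S T assume "S \<in> B2" "T \<in> B2"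
    then show "\<Theta> (avg (\<lambda>f x. S f x + T f x)) = (\<lambda>f x. \<Theta> (avg S) f x + \<Theta> (avg T) f x)"
      by (simp add: avg_add cp_map_add[OF F_sub] avg_b)
  next
    fix c T assume "T \<in> B2"
    then show "\<Theta> (avg (\<lambda>f x. c * T f x)) = (\<lambda>f x. c * \<Theta> (avg T) f x)"
      by (simp add: avg_scale cp_map_scale[OF F_sub] avg_b)
  next
    fix T assume "T \<in> B2" "positive_op (carrier G) T"
    then show "positive_op (carrier G) (\<Theta> (avg T))"
      by (intro cp_map_positive[OF F_sub] avg_b avg_pos)
  next
    fix T assume "T \<in> ?Q"
    then show "\<Theta> (avg T) = T" by (simp add: avg_Q Theta_Q)
  next
    fix S R T assume "S \<in> ?Q" "R \<in> ?Q" "T \<in> B2"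
    then show "\<Theta> (avg (S \<circ> T \<circ> R)) = S \<circ> \<Theta> (avg T) \<circ> R"
      by (simp add: avg_bimodule Theta_bimodule avg_b)
  qed
  then show ?thesis unfolding amenable_vN_def using vN by blast
qed

end

section \<open>Maximality from small sets\<close>

text \<open>Degenerate Cauchy-Schwarz: \<open>X\<close> and \<open>Y\<close> stand for the two cross
  terms of a positive functional whose quadratic term vanishes. That \<open>Y\<close> is the
  conjugate of \<open>X\<close> is extracted from the values at 1 and \<i>, so no hermitian symmetry
  of the functional is presupposed.\<close>

lemma vanishing_linear_bound:
  fixes X Y :: complex
  assumes nonneg: "\<And>c. complex_of_real a + c * X + cnj c * Y \<in> \<real>\<^sub>\<ge>\<^sub>0"
  shows "X = 0" "Y = 0"
proof -
  have a: "0 \<le> a" using nonneg[of 0] by (simp add: complex_nonneg_Reals_iff)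
  have Y: "Y = cnj X"
    using nonneg[of 1] nonneg[of \<i>] by (simp add: complex_nonneg_Reals_iff complex_eq_iff)
  have "(cmod X)\<^sup>2 \<le> a * 0"
  proof (rule discriminant_bound)
    fix c show "0 \<le> a + 2 * Re (c * X) + (cmod c)\<^sup>2 * 0"
      using nonneg[of c] by (simp add: complex_nonneg_Reals_iff Y algebra_simps)
  qed simp
  then show "X = 0" by simp
  with Y show "Y = 0" by simp
qed

context group
begin

definition cutoff :: "'a set \<Rightarrow> 'a oper" where
  "cutoff B = (\<lambda>f. if f \<in> L2 then (\<lambda>x. if x \<in> B then f x else 0) else (\<lambda>_. 0))"

lemma cutoff_ell2: "cutoff B f \<in> L2"
proof (cases "f \<in> L2")
  case True
  have "(\<lambda>x. (cmod (cutoff B f x))\<^sup>2) summable_on carrier G"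
    by (rule summable_on_comparison_test[OF ell2_summable[OF True]]) (auto simp: cutoff_def)
  with True show ?thesis by (auto simp: cutoff_def ell2_def)
qed (simp add: cutoff_def)

lemma cutoff_bounded: "cutoff B \<in> B2"
proof (rule bounded_opsI[where K = 1])
  fix f assume f: "f \<in> L2"
  have "(ell2_norm (carrier G) (cutoff B f))\<^sup>2 \<le> (ell2_norm (carrier G) f)\<^sup>2"
    unfolding norm_sq
    by (rule infsum_mono[OF ell2_summable[OF cutoff_ell2] ell2_summable[OF f]]) (auto simp: cutoff_def)
  then show "ell2_norm (carrier G) (cutoff B f) \<le> 1 * ell2_norm (carrier G) f"
    using power2_le_imp_le[OF _ norm_nonneg] by simp
qed (auto simp: cutoff_ell2, auto simp: cutoff_def)

lemma inner_cutoff: "f \<in> L2 \<Longrightarrow> g \<in> L2 \<Longrightarrow> \<langle>cutoff B f, g\<rangle> = \<langle>f, cutoff B g\<rangle>"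
  unfolding ell2_inner_def by (rule infsum_cong) (simp add: cutoff_def)

lemma cutoff_idem: "cutoff B \<circ> cutoff B = cutoff B"
proof
  fix f show "(cutoff B \<circ> cutoff B) f = cutoff B f"
    using cutoff_ell2[of B f] by (cases "f \<in> L2") (auto simp: cutoff_def)
qed

lemma cutoff_positive: "positive_op (carrier G) (cutoff B)"
  unfolding positive_op_def
proof
  fix f assume "f \<in> L2"
  then have "\<langle>cutoff B f, f\<rangle> = \<langle>cutoff B f, cutoff B f\<rangle>"
    using inner_cutoff[OF cutoff_ell2, of f B B f] fun_cong[OF cutoff_idem, of B f] by simp
  then show "\<langle>cutoff B f, f\<rangle> \<in> \<real>\<^sub>\<ge>\<^sub>0" by simp
qed

lemma left_regular_cutoff:
  assumes g: "g \<in> carrier G" and B: "B \<subseteq> carrier G"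
  shows "u g \<circ> cutoff B = cutoff ((\<lambda>b. g \<otimes> b) ` B) \<circ> u g"
proof
  fix f show "(u g \<circ> cutoff B) f = (cutoff ((\<lambda>b. g \<otimes> b) ` B) \<circ> u g) f"
  proof (cases "f \<in> L2")
    case True
    show ?thesis
    proof (rule ell2_ext[where A = "carrier G"])
      fix x assume x: "x \<in> carrier G"
      have "inv g \<otimes> x \<in> B \<longleftrightarrow> x \<in> (\<lambda>b. g \<otimes> b) ` B"
      proof
        assume *: "inv g \<otimes> x \<in> B"
        have "x = g \<otimes> (inv g \<otimes> x)" using g x by (simp add: m_assoc[symmetric])
        with * show "x \<in> (\<lambda>b. g \<otimes> b) ` B" by blast
      next
        assume "x \<in> (\<lambda>b. g \<otimes> b) ` B"
        then obtain b where "b \<in> B" "x = g \<otimes> b" by blast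
        then show "inv g \<otimes> x \<in> B" using g B by (auto simp: m_assoc[symmetric] subset_iff)
      qed
      then show "(u g \<circ> cutoff B) f x = (cutoff ((\<lambda>b. g \<otimes> b) ` B) \<circ> u g) f x"
        using x True g by (simp add: left_regular_apply cutoff_ell2) (simp add: cutoff_def left_regular_ell2 left_regular_apply)
    qed (use g in \<open>auto simp: left_regular_ell2 cutoff_ell2\<close>)
  next
    case False
    then show ?thesis
      by (simp add: op_outside[OF cutoff_bounded] op_zero[OF left_regular_bounded[OF g]]
        op_outside[OF left_regular_bounded[OF g]] op_zero[OF cutoff_bounded])
  qed
qed

text \<open>A combinatorial condition that forces measure zero: for an \<open>H\<close>-invariant
  finitely additive probability measure, \<open>n\<close> disjoint translates bound the measure by 1
  / n.\<close>

definition small :: "'a set \<Rightarrow> 'a set \<Rightarrow> bool" where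
  "small H B \<longleftrightarrow> B \<subseteq> carrier G \<and> (\<forall>n. \<exists>D\<subseteq>H. finite D \<and> card D = n \<and>
    (\<forall>h\<in>D. \<forall>k\<in>D. h \<noteq> k \<longrightarrow> (\<lambda>b. h \<otimes> b) ` B \<inter> (\<lambda>b. k \<otimes> b) ` B = {}))"

text \<open>For a hypertrace \<open>\<phi>\<close> of \<open>Q\<close> whose restriction to the group algebra is the trace, small sets
  are \<open>\<phi>\<close>-null because \<open>\<phi>\<close> is invariant under \<open>H\<close>.  Splitting \<open>u\<^sub>g = u\<^sub>g 1\<^sub>B + 1\<^bsub>g(G - B)\<^esub> u\<^sub>g\<close>
  then gives \<open>\<tau>(x u\<^sub>g) = \<phi>(x u\<^sub>g) = 0\<close>.\<close>

lemma maximal_amenable_criterion: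
  assumes H: "subgroup H G" and Qvn: "von_neumann_algebra (carrier G) Q" and QG: "Q \<subseteq> group_vN G"
    and am: "amenable_vN (carrier G) Q" and HQ: "subgroup_vN G H \<subseteq> Q"
    and singular: "\<And>g. g \<in> carrier G \<Longrightarrow> g \<notin> H \<Longrightarrow>
      \<exists>B. small H B \<and> (\<forall>a\<in>carrier G - B. g \<otimes> a \<in> B)"
  shows "Q = subgroup_vN G H"
proof (rule antisym[OF _ HQ], rule subsetI)
  have HG: "H \<subseteq> carrier G" by (rule subgroup.subset[OF H])
  fix x assume x: "x \<in> Q"
  interpret vN_subalgebra G Q by unfold_locales (use Qvn QG in auto)
  obtain e F where "vN_frame G Q e F" using exists_frame by blast
  then interpret vN_frame G Q e F .
  let ?A = "carrier G" and ?I = "id_op (carrier G)"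
  obtain E where E: "conditional_expectation ?A B2 Q E" using am by (auto simp: amenable_vN_def)
  have E_in: "T \<in> B2 \<Longrightarrow> E T \<in> Q"
    and E_add: "T \<in> B2 \<Longrightarrow> T' \<in> B2 \<Longrightarrow> E (\<lambda>f x. T f x + T' f x) = (\<lambda>f x. E T f x + E T' f x)"
    and E_scale: "T \<in> B2 \<Longrightarrow> E (\<lambda>f x. c * T f x) = (\<lambda>f x. c * E T f x)"
    and E_pos: "T \<in> B2 \<Longrightarrow> positive_op ?A T \<Longrightarrow> positive_op ?A (E T)"
    and E_Q: "y \<in> Q \<Longrightarrow> E y = y"
    and E_bim: "T \<in> B2 \<Longrightarrow> y \<in> Q \<Longrightarrow> z \<in> Q \<Longrightarrow> E (y \<circ> T \<circ> z) = y \<circ> E T \<circ> z" for T T' c y z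
    using E unfolding conditional_expectation_def by simp_all
  define \<phi> where "\<phi> = (\<lambda>T. \<langle>E (\<Theta> T) \<delta>, \<delta>\<rangle>)"
  have dl: "E T \<delta> \<in> L2" if "T \<in> B2" for T by (rule op_ell2[OF Q_bounded[OF E_in[OF that]]])
  have phi_add: "\<phi> (\<lambda>f x. T f x + T' f x) = \<phi> T + \<phi> T'" if "T \<in> B2" "T' \<in> B2" for T T'
    using that by (simp add: \<phi>_def cp_map_add[OF F_sub] E_add Theta_bounded inner_add_left dl)
  have phi_scale: "\<phi> (\<lambda>f x. c * T f x) = c * \<phi> T" if "T \<in> B2" for T c
    using that by (simp add: \<phi>_def cp_map_scale[OF F_sub] E_scale Theta_bounded inner_scale_left)
  have phi_pos: "\<phi> T \<in> \<real>\<^sub>\<ge>\<^sub>0" if T: "T \<in> B2" "positive_op ?A T" for T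
  proof -
    have "positive_op ?A (E (\<Theta> T))"
      by (intro E_pos Theta_bounded cp_map_positive[OF F_sub] T)
    then show ?thesis by (simp add: \<phi>_def positive_op_def)
  qed
  have phi_id: "\<phi> ?I = 1"
    by (simp add: \<phi>_def F_unit E_Q[OF Q_id] inner_self)
  have phi_left: "\<phi> (y \<circ> T) = \<langle>(y \<circ> E (\<Theta> T)) \<delta>, \<delta>\<rangle>" if T: "T \<in> B2" and y: "y \<in> Q" for y T
  proof -
    have ET: "E (\<Theta> T) \<in> B2" by (intro Q_bounded E_in Theta_bounded T)
    have "\<Theta> (y \<circ> T) = y \<circ> \<Theta> T"
      using Theta_bimodule[OF T y Q_id]
      by (simp only: comp_id_op[OF comp_bounded[OF Q_bounded[OF y] T]]
          comp_id_op[OF comp_bounded[OF Q_bounded[OF y] Theta_bounded[OF T]]])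
    moreover have "E (y \<circ> \<Theta> T) = y \<circ> E (\<Theta> T)"
      using E_bim[OF Theta_bounded[OF T] y Q_id]
      by (simp only: comp_id_op[OF comp_bounded[OF Q_bounded[OF y] Theta_bounded[OF T]]]
          comp_id_op[OF comp_bounded[OF Q_bounded[OF y] ET]])
    ultimately show ?thesis by (simp add: \<phi>_def)
  qed
  have phi_right: "\<phi> (T \<circ> y) = \<langle>(E (\<Theta> T) \<circ> y) \<delta>, \<delta>\<rangle>" if T: "T \<in> B2" and y: "y \<in> Q" for y T
  proof -
    have ET: "E (\<Theta> T) \<in> B2" by (intro Q_bounded E_in Theta_bounded T)
    have "\<Theta> (T \<circ> y) = \<Theta> T \<circ> y"
      using Theta_bimodule[OF T Q_id y] by (simp only: id_op_comp[OF T] id_op_comp[OF Theta_bounded[OF T]])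
    moreover have "E (\<Theta> T \<circ> y) = E (\<Theta> T) \<circ> y"
      using E_bim[OF Theta_bounded[OF T] Q_id y] by (simp only: id_op_comp[OF ET] id_op_comp[OF Theta_bounded[OF T]])
    ultimately show ?thesis by (simp add: \<phi>_def)
  qed
  have trace: "\<langle>y (z \<delta>), \<delta>\<rangle> = \<langle>z (y \<delta>), \<delta>\<rangle>" if y: "y \<in> Q" and z: "z \<in> Q" for y z
  proof -
    note yb = Q_bounded[OF y] and zb = Q_bounded[OF z]
    have "\<langle>y (z \<delta>), \<delta>\<rangle> = \<langle>z \<delta>, y\<^sup>\<star> \<delta>\<rangle>" by (rule inner_adj_right[OF yb op_ell2[OF zb], symmetric]) simp
    also have "\<dots> = \<langle>y \<delta>, J (z \<delta>)\<rangle>"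
      by (simp only: flip_Q_delta[OF y, symmetric] inner_flip_right[OF op_ell2[OF zb] op_ell2[OF yb]])
    also have "\<dots> = \<langle>z (y \<delta>), \<delta>\<rangle>"
      unfolding flip_Q_delta[OF z] by (rule inner_adj_right[OF zb op_ell2[OF yb]]) simp
    finally show ?thesis .
  qed
  \<comment> \<open>\<open>E\<close> and \<open>\<Theta>\<close> are \<open>Q\<close>-bimodular,
    which reduces centrality to the trace property of \<open>\<delta>\<close> on
    \<open>Q\<close>.\<close>
  have central: "\<phi> (y \<circ> T) = \<phi> (T \<circ> y)" if "T \<in> B2" "y \<in> Q" for y T
    using that trace[OF _ E_in[OF Theta_bounded]] by (simp add: phi_left phi_right)
  have null_adj: "\<phi> (T \<circ> cutoff B) = 0 \<and> \<phi> (cutoff B \<circ> T\<^sup>\<star>) = 0" if B: "\<phi> (cutoff B) = 0" and T: "T \<in> B2" for B T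
  proof -
    let ?P = "cutoff B" and ?S = "T\<^sup>\<star>"
    note Pb = cutoff_bounded[of B] and Sb = adj_bounded[OF T]
    obtain a where a: "\<phi> (T \<circ> ?S) = complex_of_real a"
    proof -
      have "positive_op ?A (T \<circ> ?S)"
        unfolding positive_op_def using inner_adj_right[OF T op_ell2[OF Sb], symmetric] by simp
      then have "\<phi> (T \<circ> ?S) \<in> \<real>\<^sub>\<ge>\<^sub>0" by (intro phi_pos comp_bounded T Sb)
      then show thesis using that by (auto simp: nonneg_Reals_def)
    qed
    have "complex_of_real a + c * \<phi> (T \<circ> ?P) + cnj c * \<phi> (?P \<circ> ?S) \<in> \<real>\<^sub>\<ge>\<^sub>0" for c
    proof -
      \<comment> \<open>\<open>?W'\<close> is the adjoint of \<open>?W\<close>, so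
        \<open>\<phi>\<close> is nonnegative on their product. The term quadratic in
        \<open>c\<close> carries the factor \<open>\<phi> (cutoff B) = 0\<close>; what remains is
        the situation of \<open>vanishing_linear_bound\<close>.\<close>
      let ?W = "\<lambda>f x. ?S f x + c * ?P f x" and ?W' = "\<lambda>f x. T f x + cnj c * ?P f x"
      have Wb: "?W \<in> B2" "?W' \<in> B2" by (intro add_op_bounded scale_op_bounded T Sb Pb)+
      have adjW: "?W\<^sup>\<star> = ?W'"
      proof (rule adj_unique[OF Wb])
        fix f g assume fg: "f \<in> L2" "g \<in> L2"
        show "\<langle>?W' f, g\<rangle> = \<langle>f, ?W g\<rangle>"
          using fg by (simp add: inner_add_left inner_add_right inner_scale_left inner_scale_right
              op_ell2[OF T] op_ell2[OF Sb] cutoff_ell2 inner_adj_right[OF T] inner_cutoff)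
      qed
      have "positive_op ?A (?W' \<circ> ?W)"
        unfolding positive_op_def
      proof
        fix f assume f: "f \<in> L2"
        have "\<langle>?W' (?W f), f\<rangle> = \<langle>?W f, ?W f\<rangle>"
          using inner_adj_left[OF Wb(1) op_ell2[OF Wb(1)] f, of f] by (simp only: adjW)
        then show "\<langle>(?W' \<circ> ?W) f, f\<rangle> \<in> \<real>\<^sub>\<ge>\<^sub>0" by simp
      qed
      then have pos: "\<phi> (?W' \<circ> ?W) \<in> \<real>\<^sub>\<ge>\<^sub>0" by (rule phi_pos[OF comp_bounded[OF Wb(2,1)]])
      have expand: "?W' \<circ> ?W = (\<lambda>f x. ((T \<circ> ?S) f x + c * (T \<circ> ?P) f x)
          + (cnj c * (?P \<circ> ?S) f x + (cnj c * c) * ?P f x))"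
      proof (intro ext)
        fix f y
        have PP: "?P (?P f) = ?P f" using fun_cong[OF cutoff_idem[of B], of f] by simp
        have "T (?W f) = (\<lambda>x. T (?S f) x + c * T (?P f) x)"
          by (simp only: op_add[OF T op_ell2[OF Sb] ell2_scale[OF cutoff_ell2]] op_scale[OF T cutoff_ell2])
        moreover have "?P (?W f) = (\<lambda>x. ?P (?S f) x + c * ?P f x)"
          by (simp only: op_add[OF Pb op_ell2[OF Sb] ell2_scale[OF cutoff_ell2]] op_scale[OF Pb cutoff_ell2] PP)
        ultimately show "(?W' \<circ> ?W) f y = ((T \<circ> ?S) f y + c * (T \<circ> ?P) f y)
          + (cnj c * (?P \<circ> ?S) f y + (cnj c * c) * ?P f y)"
          by (simp only: o_apply) (simp add: algebra_simps)
      qed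
      note TS = comp_bounded[OF T Sb] and TP = comp_bounded[OF T Pb] and PS = comp_bounded[OF Pb Sb]
      have "\<phi> (?W' \<circ> ?W) = (\<phi> (T \<circ> ?S) + c * \<phi> (T \<circ> ?P)) + (cnj c * \<phi> (?P \<circ> ?S) + (cnj c * c) * \<phi> ?P)"
        unfolding expand
        by (simp only: phi_add[OF add_op_bounded[OF TS scale_op_bounded[OF TP]]
              add_op_bounded[OF scale_op_bounded[OF PS] scale_op_bounded[OF Pb]]]
            phi_add[OF TS scale_op_bounded[OF TP]] phi_add[OF scale_op_bounded[OF PS] scale_op_bounded[OF Pb]]
            phi_scale[OF TP] phi_scale[OF PS] phi_scale[OF Pb])
      with pos show ?thesis by (simp add: a B add.assoc)
    qed
    from vanishing_linear_bound[OF this] show ?thesis by simp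
  qed
  have null: "\<phi> (T \<circ> cutoff B) = 0" "\<phi> (cutoff B \<circ> T) = 0" if "\<phi> (cutoff B) = 0" "T \<in> B2" for B T
    using null_adj[OF that] null_adj[OF that(1) adj_bounded[OF that(2)]] that(2) by simp_all
  define p where "p = (\<lambda>B. Re (\<phi> (cutoff B)))"
  have phi_p: "\<phi> (cutoff B) = complex_of_real (p B)" and p_nonneg: "0 \<le> p B" for B
    using phi_pos[OF cutoff_bounded cutoff_positive, of B]
    by (simp_all add: p_def complex_nonneg_Reals_iff complex_eq_iff)
  have p_Un: "p (B \<union> C) = p B + p C" if "B \<inter> C = {}" for B C
  proof -
    have "cutoff (B \<union> C) = (\<lambda>f x. cutoff B f x + cutoff C f x)"
      using that by (auto simp: cutoff_def fun_eq_iff)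
    then show ?thesis by (simp add: p_def phi_add cutoff_bounded)
  qed
  have p_mono: "p B \<le> p C" if "B \<subseteq> C" for B C
  proof -
    have "C = B \<union> (C - B)" using that by auto
    then have "p C = p B + p (C - B)" using p_Un[of B "C - B"] by simp
    then show ?thesis using p_nonneg[of "C - B"] by simp
  qed
  have p_total: "p ?A = 1"
  proof -
    have "cutoff ?A = ?I" by (auto simp: cutoff_def id_op_def fun_eq_iff ell2_outside)
    then show ?thesis by (simp add: p_def phi_id)
  qed
  have p_empty: "p {} = 0" using p_Un[of "{}" "{}"] by simp
  \<comment> \<open>The cutoff at the translate is the cutoff at \<open>B\<close> conjugated by
    \<open>u h\<close>, and \<open>\<phi>\<close> is central for \<open>u h\<close> because L(H) is
    contained in \<open>Q\<close>.\<close>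
  have p_translate: "p ((\<lambda>b. h \<otimes> b) ` B) = p B" if h: "h \<in> H" and B: "B \<subseteq> ?A" for h B
  proof -
    have hG: "h \<in> ?A" "inv h \<in> ?A" using h HG by auto
    have uh: "u h \<in> Q" using left_regular_subgroup_vN[OF HG h] HQ by blast
    note ub = left_regular_bounded[OF hG(1)] left_regular_bounded[OF hG(2)]
    have inv1: "u h \<circ> u (inv h) = ?I" and inv2: "u (inv h) \<circ> u h = ?I"
      by (rule op_eqI[where A = ?A]; use hG ub in \<open>force simp: left_regular_comp left_regular_one\<close>)+
    have "cutoff ((\<lambda>b. h \<otimes> b) ` B) = cutoff ((\<lambda>b. h \<otimes> b) ` B) \<circ> (u h \<circ> u (inv h))"
      by (simp only: inv1 comp_id_op[OF cutoff_bounded])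
    also have "\<dots> = u h \<circ> (cutoff B \<circ> u (inv h))"
      by (simp only: comp_assoc[symmetric] left_regular_cutoff[OF hG(1) B])
    finally have "\<phi> (cutoff ((\<lambda>b. h \<otimes> b) ` B)) = \<phi> (cutoff B \<circ> u (inv h) \<circ> u h)"
      using central[OF comp_bounded[OF cutoff_bounded ub(2)] uh] by simp
    then show ?thesis
      by (simp only: p_def comp_assoc inv2 comp_id_op[OF cutoff_bounded])
  qed
  have p_small: "p B = 0" if B: "small H B" for B
  proof (rule ccontr)
    assume "p B \<noteq> 0"
    then have "0 < p B" using p_nonneg[of B] by simp
    then obtain n :: nat where n: "1 < real n * p B" using reals_Archimedean3 by blast
    have "\<exists>D\<subseteq>H. finite D \<and> card D = n \<and>
        (\<forall>h\<in>D. \<forall>k\<in>D. h \<noteq> k \<longrightarrow> (\<lambda>b. h \<otimes> b) ` B \<inter> (\<lambda>b. k \<otimes> b) ` B = {})"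
      using B unfolding small_def by (elim conjE) (erule spec)
    then obtain D where D: "D \<subseteq> H" "finite D" "card D = n"
      and disj: "\<forall>h\<in>D. \<forall>k\<in>D. h \<noteq> k \<longrightarrow> (\<lambda>b. h \<otimes> b) ` B \<inter> (\<lambda>b. k \<otimes> b) ` B = {}"
      by (elim exE conjE)
    have BA: "B \<subseteq> ?A" using B by (simp add: small_def)
    have "p (\<Union>h\<in>D'. (\<lambda>b. h \<otimes> b) ` B) = real (card D') * p B" if "D' \<subseteq> D" for D'
      using finite_subset[OF that D(2)] that
    proof (induction D' rule: finite_induct)
      case empty
      then show ?case by (simp add: p_empty)
    next
      case (insert h D')
      have hD: "h \<in> D" and D'D: "D' \<subseteq> D" using insert.prems by simp_all
      have "(\<lambda>b. h \<otimes> b) ` B \<inter> (\<lambda>b. k \<otimes> b) ` B = {}" if "k \<in> D'" for k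
      proof -
        have "k \<in> D" "h \<noteq> k" using that D'D insert.hyps(2) by auto
        with disj hD show ?thesis by simp
      qed
      then have "(\<lambda>b. h \<otimes> b) ` B \<inter> (\<Union>k\<in>D'. (\<lambda>b. k \<otimes> b) ` B) = {}"
        by (simp only: Int_UN_distrib) simp
      then have "p (\<Union>k\<in>insert h D'. (\<lambda>b. k \<otimes> b) ` B)
          = p ((\<lambda>b. h \<otimes> b) ` B) + p (\<Union>k\<in>D'. (\<lambda>b. k \<otimes> b) ` B)"
        by (simp only: UN_insert p_Un)
      also have "p ((\<lambda>b. h \<otimes> b) ` B) = p B" by (rule p_translate[OF subsetD[OF D(1) hD] BA])
      also have "p (\<Union>k\<in>D'. (\<lambda>b. k \<otimes> b) ` B) = real (card D') * p B" by (rule insert.IH[OF D'D])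
      finally show ?case using insert.hyps by (simp add: distrib_right)
    qed
    from this[OF subset_refl] have "real n * p B = p (\<Union>h\<in>D. (\<lambda>b. h \<otimes> b) ` B)" by (simp add: D)
    also have "\<dots> \<le> p ?A" by (rule p_mono) (use D HG BA in auto)
    finally show False using n p_total by simp
  qed
  \<comment> \<open>\<open>\<Theta> (u g)\<close> already lies in \<open>Q\<close>, so
    \<open>E\<close> fixes it and its possible lack of normality does no harm. The value is the
    Fourier coefficient of \<open>x\<close> at the inverse of \<open>g\<close>.\<close>
  have phi_u: "\<phi> (x \<circ> u g) = x \<delta> (inv g)" if g: "g \<in> ?A" for g
  proof -
    note ub = left_regular_bounded[OF g] and xb = Q_bounded[OF x]
    have JuJ: "J \<circ> u g \<circ> J \<in> comm Q"
      using right_regular_comm_Q[OF g] by (simp add: right_regular_def)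
    have Tu: "\<Theta> (u g) \<in> Q" by (rule Theta_in_Q[OF ub JuJ])
    have "\<phi> (x \<circ> u g) = \<langle>x (\<Theta> (u g) \<delta>), \<delta>\<rangle>"
      using phi_left[OF ub x] by (simp add: E_Q[OF Tu])
    also have "\<dots> = \<langle>e (kron g), x\<^sup>\<star> \<delta>\<rangle>"
      using inner_adj_right[OF xb op_ell2[OF Theta_bounded[OF ub]], of \<delta> \<delta>] g
      by (simp add: Theta_delta[OF ub JuJ] left_regular_kron)
    also have "\<dots> = \<langle>kron g, J (x \<delta>)\<rangle>"
      using e_herm[OF kron_ell2[OF g] op_ell2[OF adj_bounded[OF xb]], of \<delta>]
      by (simp add: e_fix[OF Q_delta_K[OF Q_adj[OF x]]] flip_Q_delta[OF x])
    also have "\<dots> = \<langle>x \<delta>, J (kron g)\<rangle>" by (rule inner_flip_right[OF kron_ell2[OF g] op_ell2[OF xb]])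
    also have "\<dots> = x \<delta> (inv g)" using g by (simp add: flip_kron inner_kron)
    finally show ?thesis .
  qed
  have vanish: "x \<delta> (inv g) = 0" if g: "g \<in> ?A" "g \<notin> H" for g
  proof -
    note ub = left_regular_bounded[OF g(1)] and xb = Q_bounded[OF x]
    obtain B where B: "small H B" and gB: "\<And>a. a \<in> ?A - B \<Longrightarrow> g \<otimes> a \<in> B"
      using singular[OF g] by blast
    let ?C = "?A - B"
    have pB: "\<phi> (cutoff B) = 0" using p_small[OF B] by (simp add: phi_p)
    have "p ((\<lambda>b. g \<otimes> b) ` ?C) \<le> p B" by (rule p_mono) (use gB in blast)
    then have pC: "\<phi> (cutoff ((\<lambda>b. g \<otimes> b) ` ?C)) = 0"
      using p_small[OF B] p_nonneg[of "(\<lambda>b. g \<otimes> b) ` ?C"] by (simp add: phi_p)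
    have xu: "x \<circ> u g \<in> B2" by (rule comp_bounded[OF xb ub])
    have split: "x \<circ> u g = (\<lambda>f y. (x \<circ> u g \<circ> cutoff B) f y + (x \<circ> u g \<circ> cutoff ?C) f y)"
    proof
      fix f
      show "(x \<circ> u g) f = (\<lambda>y. (x \<circ> u g \<circ> cutoff B) f y + (x \<circ> u g \<circ> cutoff ?C) f y)"
      proof (cases "f \<in> L2")
        case True
        have "f = (\<lambda>y. cutoff B f y + cutoff ?C f y)"
          using True by (auto simp: cutoff_def fun_eq_iff ell2_outside)
        then have "(x \<circ> u g) f = (x \<circ> u g) (\<lambda>y. cutoff B f y + cutoff ?C f y)" by simp
        also have "\<dots> = (\<lambda>y. (x \<circ> u g) (cutoff B f) y + (x \<circ> u g) (cutoff ?C f) y)"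
          by (rule op_add[OF xu cutoff_ell2 cutoff_ell2])
        finally show ?thesis by simp
      next
        case False
        then show ?thesis
          by (simp add: op_outside[OF cutoff_bounded] op_outside[OF ub] op_zero[OF xb] op_zero[OF ub])
      qed
    qed
    have "\<phi> (x \<circ> u g) = \<phi> (x \<circ> u g \<circ> cutoff B) + \<phi> (x \<circ> u g \<circ> cutoff ?C)"
      by (subst split) (rule phi_add[OF comp_bounded[OF xu cutoff_bounded] comp_bounded[OF xu cutoff_bounded]])
    also have "\<phi> (x \<circ> u g \<circ> cutoff B) = 0" by (rule null(1)[OF pB xu])
    also have "x \<circ> u g \<circ> cutoff ?C = x \<circ> (cutoff ((\<lambda>b. g \<otimes> b) ` ?C) \<circ> u g)"
      by (simp only: comp_assoc left_regular_cutoff[OF g(1) Diff_subset])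
    \<comment> \<open>The cutoff sits between \<open>x\<close> and \<open>u g\<close>. Centrality
      moves \<open>x\<close> to the far right and leaves the cutoff at the left end, where
      \<open>null\<close> applies.\<close>
    also have "\<phi> \<dots> = \<phi> (cutoff ((\<lambda>b. g \<otimes> b) ` ?C) \<circ> (u g \<circ> x))"
      using central[OF comp_bounded[OF cutoff_bounded ub] x] by (simp only: comp_assoc)
    also have "\<dots> = 0" by (rule null(2)[OF pC comp_bounded[OF ub xb]])
    finally show ?thesis by (simp only: phi_u[OF g(1)] add_0)
  qed
  have support: "x \<delta> s = 0" if "s \<notin> H" for s
  proof (cases "s \<in> ?A")
    case True
    then have "inv s \<notin> H" using that H subgroup.m_inv_closed[OF H, of "inv s"] by auto
    then show ?thesis using vanish[of "inv s"] True by simp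
  qed (rule ell2_outside[OF op_ell2[OF Q_bounded[OF x]]])
  \<comment> \<open>A second family, now for L(H), turns support in \<open>H\<close> back into
    membership in L(H).\<close>
  interpret H: vN_subalgebra G "subgroup_vN G H" by (rule subgroup_vN_subalgebra[OF H])
  obtain e' F' where "vN_frame G (subgroup_vN G H) e' F'" using H.exists_frame by blast
  then interpret H: vN_frame G "subgroup_vN G H" e' F' .
  show "x \<in> subgroup_vN G H"
  proof (rule H.in_Q_if_delta_in_K)
    show "x \<in> group_vN G" using x QG by blast
    show "x \<delta> \<in> H.K"
      unfolding H.K_iff
    proof (intro conjI ballI)
      show "x \<delta> \<in> L2" by (rule op_ell2[OF Q_bounded[OF x]])
      fix q assume q: "q \<in> perp ?A H.S"
      \<comment> \<open>\<open>q\<close> vanishes on \<open>H\<close> and \<open>x \<delta>\<close>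
        vanishes off \<open>H\<close>, so their inner product is zero term by term.\<close>
      have "q h = 0" if h: "h \<in> H" for h
      proof -
        have "kron h = u h \<delta>" using h HG by (auto simp: left_regular_kron)
        then have "kron h \<in> H.S" using left_regular_subgroup_vN[OF HG h] by blast
        then have "\<langle>q, kron h\<rangle> = 0" using q by (auto simp: perp_def)
        then show ?thesis using h HG by (auto simp: inner_kron)
      qed
      then show "\<langle>x \<delta>, q\<rangle> = 0"
        unfolding ell2_inner_def by (intro infsum_0) (metis complex_cnj_zero mult_eq_0_iff support)
    qed
  qed
qed

end

section \<open>Hyperbolically embedded subgroups\<close>

context group
begin

lemma edge_path_trans:
  "edge_path G E v n w \<Longrightarrow> edge_path G E a m v \<Longrightarrow> edge_path G E a (m + n) w"
  by (induction rule: edge_path.induct) (auto intro: edge_path.intros)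

lemma edge_path_start: "edge_path G E a n v \<Longrightarrow> a \<in> carrier G"
  by (induction rule: edge_path.induct)

text \<open>The hypothesis \<open>closed\<close> supplies the carrier membership that the empty path
  demands.\<close>

lemma edge_path_split:
  "edge_path G E a (m + n) w \<Longrightarrow> \<exists>v. edge_path G E a m v \<and> edge_path G E v n w"
  if closed: "\<And>n v. edge_path G E a n v \<Longrightarrow> v \<in> carrier G"
proof (induction n arbitrary: w)
  case 0
  then show ?case using closed by (auto intro: edge_path_Nil)
next
  case (Suc n)
  then have "edge_path G E a (Suc (m + n)) w" by simp
  then show ?case
  proof cases
    case (edge_path_forward e)
    then show ?thesis using Suc.IH by (blast intro: edge_path.edge_path_forward)
  next
    case (edge_path_backward e)
    then show ?thesis using Suc.IH by (blast intro: edge_path.edge_path_backward)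
  qed
qed

end

locale hyperbolic_embedding = group G for G (structure) +
  fixes H X :: "'a set" and hyp :: real
  assumes H: "subgroup H G"
    and XG: "X \<subseteq> carrier G"
    and gen: "generate G (X \<union> H) = carrier G"
    and hyp: "\<And>w x y z. w \<in> carrier G \<Longrightarrow> x \<in> carrier G \<Longrightarrow> y \<in> carrier G \<Longrightarrow> z \<in> carrier G \<Longrightarrow>
      min (gromov_product (cayley_dist G X H) w x y) (gromov_product (cayley_dist G X H) w y z) - hyp
        \<le> gromov_product (cayley_dist G X H) w x z"
    and hyp_nonneg: "0 \<le> hyp"
    and locally_finite: "\<And>n. finite {h \<in> H. \<exists>k\<le>n.
           edge_path G (cayley_edges G X H - subgroup_edges H) \<one> k h}"
begin

abbreviation "E \<equiv> cayley_edges G X H"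
abbreviation "E' \<equiv> cayley_edges G X H - subgroup_edges H"

lemma HG: "h \<in> H \<Longrightarrow> h \<in> carrier G"
  using subgroup.subset[OF H] by blast

lemmas H_mult = subgroup.m_closed[OF H] and H_inv = subgroup.m_inv_closed[OF H]

lemma label_carrier: "a \<in> X \<Longrightarrow> a \<in> carrier G" "a \<in> H \<Longrightarrow> a \<in> carrier G"
  using XG HG by auto

lemma edge_ends: "e \<in> E \<Longrightarrow> edge_source e \<in> carrier G \<and> edge_target G e \<in> carrier G"
  using XG HG by (auto simp: cayley_edges_def edge_source_def edge_target_def)

lemma edge_path_end: "edge_path G D a n v \<Longrightarrow> D \<subseteq> E \<Longrightarrow> v \<in> carrier G"
  by (induction rule: edge_path.induct) (use edge_ends in auto)

lemma edge_path_sym: "edge_path G D a n v \<Longrightarrow> D \<subseteq> E \<Longrightarrow> edge_path G D v n a"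
proof (induction rule: edge_path.induct)
  case edge_path_Nil
  then show ?case by (intro edge_path.edge_path_Nil)
next
  case (edge_path_forward n e)
  then have "e \<in> E" by blast
  from edge_ends[OF this] edge_path_forward(2)
  have "edge_path G D (edge_target G e) (Suc 0) (edge_source e)"
    by (intro edge_path.edge_path_backward edge_path.edge_path_Nil) auto
  then show ?case using edge_path_trans edge_path_forward by fastforce
next
  case (edge_path_backward n e)
  then have "e \<in> E" by blast
  from edge_ends[OF this] edge_path_backward(2)
  have "edge_path G D (edge_source e) (Suc 0) (edge_target G e)"
    by (intro edge_path.edge_path_forward edge_path.edge_path_Nil) auto
  then show ?case using edge_path_trans edge_path_backward by fastforce
qed

lemma edge_path_translate:
  assumes "edge_path G D a n v" "D \<subseteq> E" "k \<in> carrier G"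
    and inv: "\<And>g l. (g, l) \<in> D \<Longrightarrow> (k \<otimes> g, l) \<in> D"
  shows "edge_path G D (k \<otimes> a) n (k \<otimes> v)"
  using assms(1)
proof (induction rule: edge_path.induct)
  case edge_path_Nil
  then show ?case using assms(3) by (intro edge_path.edge_path_Nil) simp
next
  case (edge_path_forward n e)
  obtain g l where e: "e = (g, l)" by force
  have mem: "(k \<otimes> g, l) \<in> D" using inv edge_path_forward(2) e by blast
  have "(g, l) \<in> E" using edge_path_forward(2) assms(2) e by blast
  then have ends: "g \<in> carrier G" "edge_target G (k \<otimes> g, l) = k \<otimes> edge_target G e"
    using label_carrier assms(3)
    by (auto simp: cayley_edges_def edge_target_def e m_assoc split: sum.splits)
  show ?case
    using edge_path.edge_path_forward[OF _ mem, of G "k \<otimes> a" n] edge_path_forward(3) ends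
    by (simp add: e edge_source_def)
next
  case (edge_path_backward n e)
  obtain g l where e: "e = (g, l)" by force
  have mem: "(k \<otimes> g, l) \<in> D" using inv edge_path_backward(2) e by blast
  have "(g, l) \<in> E" using edge_path_backward(2) assms(2) e by blast
  then have ends: "g \<in> carrier G" "edge_target G (k \<otimes> g, l) = k \<otimes> edge_target G e"
    using label_carrier assms(3)
    by (auto simp: cayley_edges_def edge_target_def e m_assoc split: sum.splits)
  show ?case
    using edge_path.edge_path_backward[OF _ mem, of G "k \<otimes> a" n] edge_path_backward(3) ends
    by (simp add: e edge_source_def)
qed

lemma translate_E: "edge_path G E a n v \<Longrightarrow> k \<in> carrier G \<Longrightarrow> edge_path G E (k \<otimes> a) n (k \<otimes> v)"
  by (rule edge_path_translate) (auto simp: cayley_edges_def)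

text \<open>Left translation by an element of \<open>H\<close> preserves the edges of Cay(H,H),
  hence also the complementary edge set; an arbitrary group element could move an edge of another
  coset into Cay(H,H).\<close>

lemma translate_E':
  assumes "edge_path G E' a n v" "k \<in> H" shows "edge_path G E' (k \<otimes> a) n (k \<otimes> v)"
proof (rule edge_path_translate[OF assms(1)])
  fix g l assume gl: "(g, l) \<in> E'"
  then have g: "g \<in> carrier G" by (auto simp: cayley_edges_def)
  have bk: "g \<in> H" if "k \<otimes> g \<in> H"
  proof -
    have "inv k \<otimes> (k \<otimes> g) \<in> H"
      by (rule H_mult[OF H_inv[OF assms(2)] that])
    then show ?thesis using g HG[OF assms(2)] by (simp add: m_assoc[symmetric])
  qed
  then show "(k \<otimes> g, l) \<in> E'" using gl g HG[OF assms(2)]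
    by (auto simp: cayley_edges_def subgroup_edges_def dest: bk)
next
  show "k \<in> carrier G" by (rule HG[OF assms(2)])
qed blast

lemma label_edge:
  assumes "v \<in> carrier G" "s \<in> X \<union> H" shows "edge_path G E v 1 (v \<otimes> s)"
proof -
  define l where "l = (if s \<in> H then Inr s else Inl s)"
  have e: "(v, l) \<in> E" using assms by (auto simp: l_def cayley_edges_def)
  have "edge_path G E v (Suc 0) (edge_target G (v, l))"
    by (rule edge_path_forward[OF _ e]) (use assms in \<open>auto simp: edge_source_def intro: edge_path_Nil\<close>)
  then show ?thesis by (auto simp: edge_target_def l_def split: if_splits)
qed

text \<open>An \<open>H\<close>-labelled edge that starts outside \<open>H\<close> belongs to the
  complete graph of another coset. So a path may jump within a coset gH different from
  \<open>H\<close> in one admissible step.\<close>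

lemma H_edge_avoiding:
  assumes "v \<in> carrier G" "s \<in> H" "v \<notin> H" shows "edge_path G E' v 1 (v \<otimes> s)"
proof -
  have e: "(v, Inr s) \<in> E'" using assms by (auto simp: cayley_edges_def subgroup_edges_def)
  have "edge_path G E' v (Suc 0) (edge_target G (v, Inr s))"
    by (rule edge_path_forward[OF _ e]) (use assms in \<open>auto simp: edge_source_def intro: edge_path_Nil\<close>)
  then show ?thesis by (simp add: edge_target_def)
qed

lemma connected_one: "v \<in> carrier G \<Longrightarrow> \<exists>n. edge_path G E \<one> n v"
proof -
  assume "v \<in> carrier G"
  then have "v \<in> generate G (X \<union> H)" by (simp add: gen)
  then show ?thesis
  proof induction
    case one
    then show ?case by (blast intro: edge_path_Nil)
  next
    case (incl h)
    then have "h \<in> carrier G" using label_carrier by auto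
    then have "edge_path G E \<one> 1 h" using label_edge[OF one_closed incl] by simp
    then show ?case by blast
  next
    case (inv h)
    then have h: "h \<in> carrier G" using XG HG by auto
    have "edge_path G E (inv h) 1 (inv h \<otimes> h)" by (rule label_edge) (use inv h in auto)
    then show ?case using edge_path_sym h by fastforce
  next
    case (eng h1 h2)
    then have c: "h1 \<in> carrier G" "h2 \<in> carrier G" by (simp_all add: gen)
    obtain m n where "edge_path G E \<one> m h1" "edge_path G E \<one> n h2" using eng by blast
    moreover from this(2) have "edge_path G E h1 n (h1 \<otimes> h2)"
      using translate_E[of \<one> n h2 h1] c by simp
    ultimately show ?case using edge_path_trans by blast
  qed
qed

lemma connected:
  assumes "a \<in> carrier G" "v \<in> carrier G" shows "\<exists>n. edge_path G E a n v"
proof -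
  obtain n where "edge_path G E \<one> n (inv a \<otimes> v)" using connected_one[of "inv a \<otimes> v"] assms by auto
  from translate_E[OF this assms(1)] show ?thesis using assms by (auto simp: m_assoc[symmetric])
qed

section \<open>The word metric and nearest-point projections to H\<close>

definition D :: "'a \<Rightarrow> 'a \<Rightarrow> nat" where
  "D a v = (LEAST n. edge_path G E a n v)"

lemma cayley_dist_D: "cayley_dist G X H a v = real (D a v)"
  by (simp add: cayley_dist_def D_def)

lemma geodesic: "a \<in> carrier G \<Longrightarrow> v \<in> carrier G \<Longrightarrow> edge_path G E a (D a v) v"
  unfolding D_def using connected by (rule LeastI_ex)

lemma D_le: "edge_path G E a n v \<Longrightarrow> D a v \<le> n"
  unfolding D_def by (rule Least_le)

lemma D_sym: "a \<in> carrier G \<Longrightarrow> v \<in> carrier G \<Longrightarrow> D a v = D v a"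
  by (rule antisym; rule D_le; rule edge_path_sym[OF geodesic]) auto

lemma D_triangle:
  "a \<in> carrier G \<Longrightarrow> v \<in> carrier G \<Longrightarrow> w \<in> carrier G \<Longrightarrow> D a w \<le> D a v + D v w"
  by (rule D_le) (rule edge_path_trans[OF geodesic geodesic])

lemma D_H: "h \<in> H \<Longrightarrow> k \<in> H \<Longrightarrow> D h k \<le> 1"
proof -
  assume hk: "h \<in> H" "k \<in> H"
  have "edge_path G E h 1 (h \<otimes> (inv h \<otimes> k))"
    using hk H HG by (intro label_edge) (auto simp: H_mult H_inv)
  then show ?thesis using hk HG by (intro D_le) (simp add: m_assoc[symmetric])
qed

definition distH :: "'a \<Rightarrow> nat" where
  "distH x = (LEAST n. \<exists>h\<in>H. edge_path G E x n h)"

definition proj :: "'a \<Rightarrow> 'a set" where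
  "proj x = {h \<in> H. edge_path G E x (distH x) h}"

lemma distH_le: "edge_path G E x n h \<Longrightarrow> h \<in> H \<Longrightarrow> distH x \<le> n"
  unfolding distH_def by (rule Least_le) blast

lemma proj_nonempty: "x \<in> carrier G \<Longrightarrow> proj x \<noteq> {}"
proof -
  assume x: "x \<in> carrier G"
  have "\<exists>n. \<exists>h\<in>H. edge_path G E x n h"
    using connected[OF x one_closed] subgroup.one_closed[OF H] by blast
  then have "\<exists>h\<in>H. edge_path G E x (distH x) h" unfolding distH_def by (rule LeastI_ex)
  then show ?thesis by (auto simp: proj_def)
qed

lemma distH_lipschitz:
  assumes "edge_path G E x n y" shows "distH x \<le> n + distH y"
proof -
  obtain h where "h \<in> H" "edge_path G E y (distH y) h"
    using proj_nonempty[of y] edge_path_end[OF assms] by (auto simp: proj_def)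
  then show ?thesis using edge_path_trans[OF _ assms] distH_le by blast
qed

lemma distH_H: "x \<in> H \<Longrightarrow> distH x = 0"
  using distH_le[OF edge_path_Nil] HG by blast

text \<open>An edge of Cay(H,H) has both ends in \<open>H\<close>, but the end from which the path
  enters an edge is reached in fewer than \<open>distH x\<close> steps and so lies outside
  \<open>H\<close>. The case \<open>n = distH x\<close> is included because then only the final
  vertex can lie in \<open>H\<close>.\<close>

lemma avoiding_path:
  assumes "edge_path G E x n y" "n \<le> distH x" shows "edge_path G E' x n y"
  using assms
proof (induction rule: edge_path.induct)
  case edge_path_Nil
  then show ?case by (intro edge_path.edge_path_Nil) simp
next
  case (edge_path_forward n e)
  have "edge_source e \<notin> H"
    using distH_lipschitz[OF edge_path_forward(1)] edge_path_forward.prems distH_H by force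
  then have "e \<in> E'" using edge_path_forward(2) by (auto simp: subgroup_edges_def edge_source_def)
  then show ?case using edge_path_forward by (intro edge_path.edge_path_forward) auto
next
  case (edge_path_backward n e)
  have "edge_target G e \<notin> H"
    using distH_lipschitz[OF edge_path_backward(1)] edge_path_backward.prems distH_H by force
  then have "e \<in> E'"
    using edge_path_backward(2) H by (auto simp: subgroup_edges_def edge_target_def H_mult)
  then show ?case using edge_path_backward by (intro edge_path.edge_path_backward) auto
qed

text \<open>Thin triangles: a nearly geodesic path from \<open>x\<close> to \<open>H\<close> that avoids the edges of \<open>H\<close> follows the
  geodesic from \<open>x\<close> to a nearest point \<open>q\<close>; the short connection at a fixed height \<open>t\<close> above \<open>H\<close>
  also avoids \<open>H\<close>.\<close>

lemma relative_distance_bound: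
  "\<exists>N. \<forall>x q h L. q \<in> proj x \<longrightarrow> h \<in> H \<longrightarrow> edge_path G E' x L h \<longrightarrow> L \<le> distH x + c \<longrightarrow>
    (\<exists>k\<le>N. edge_path G E' h k q)"
proof -
  \<comment> \<open>\<open>2 * real c + 4 * hyp\<close> is the bound found below for the distance of
    \<open>a\<close> and \<open>b\<close>; the summand 1 pays for \<open>q\<close> and
    \<open>h\<close> being up to distance 1 apart.\<close>
  define t where "t = nat \<lceil>2 * real c + 4 * hyp\<rceil> + 1"
  have t: "2 * real c + 4 * hyp \<le> real t"
  proof -
    have "2 * real c + 4 * hyp \<le> real_of_int \<lceil>2 * real c + 4 * hyp\<rceil>" by simp
    also have "\<dots> \<le> real t" unfolding t_def using hyp_nonneg by simp
    finally show ?thesis .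
  qed
  have t1: "1 \<le> t" by (simp add: t_def)
  have sub: "E' \<subseteq> E" by blast
  \<comment> \<open>Three legs lead from \<open>h\<close> to \<open>q\<close>: at most
    \<open>t + c\<close> back along the given path, at most \<open>t\<close> across, and
    \<open>t\<close> down to \<open>q\<close>.\<close>
  have "\<exists>k\<le>c + 3 * t. edge_path G E' h k q"
    if q: "q \<in> proj x" and h: "h \<in> H" and L: "edge_path G E' x L h" and Lc: "L \<le> distH x + c" for x q h L
  proof -
    define n where "n = distH x"
    have xG: "x \<in> carrier G" by (rule edge_path_start[OF L])
    have xq: "edge_path G E x n q" and qH: "q \<in> H" using q by (auto simp: proj_def n_def)
    have hG: "h \<in> carrier G" and qG: "q \<in> carrier G" using h qH HG by auto
    have mono: "edge_path G E a m v" if "edge_path G E' a m v" for a m v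
      using that by (induction rule: edge_path.induct) (auto intro: edge_path.intros)
    show ?thesis
    \<comment> \<open>Near \<open>H\<close> the geodesic has no point at height \<open>t\<close>,
      but then the path from \<open>h\<close> through \<open>x\<close> to \<open>q\<close> is short
      enough itself.\<close>
    proof (cases "n < t")
      case True
      have "edge_path G E' h (L + n) q"
        by (rule edge_path_trans[OF avoiding_path[OF xq] edge_path_sym[OF L sub]]) (simp add: n_def)
      moreover have "L + n \<le> c + 3 * t" using True Lc by (simp add: n_def)
      ultimately show ?thesis by blast
    next
      case False
      define s where "s = n - t"
      have n: "n = s + t" using False by (simp add: s_def)
      obtain a where a: "edge_path G E x s a" "edge_path G E a t q"
        using edge_path_split[of E x s t q] xq edge_path_end[of E] by (auto simp: n)
      have aG: "a \<in> carrier G" using edge_path_end[OF a(1)] by simp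
      have nL: "n \<le> L" unfolding n_def by (rule distH_le[OF mono[OF L] h])
      obtain b where b: "edge_path G E' x s b" "edge_path G E' b (L - s) h"
        using edge_path_split[of E' x s "L - s" h] L edge_path_end[OF _ sub] nL n by auto
      have bG: "b \<in> carrier G" using edge_path_end[OF b(1) sub] .
      have dist_a: "t \<le> distH a" using distH_lipschitz[OF a(1)] by (simp add: n_def[symmetric] n)
      have Dxq: "D x q = n" using D_le[OF xq] distH_le[OF geodesic[OF xG qG] qH] by (simp add: n_def)
      have Dxa: "D x a = s"
        using D_le[OF a(1)] D_le[OF a(2)] D_triangle[OF xG aG qG] Dxq n by simp
      have Daq: "D a q = t"
        using D_le[OF a(1)] D_le[OF a(2)] D_triangle[OF xG aG qG] Dxq n by simp
      have Dxh: "n \<le> D x h" using distH_le[OF geodesic[OF xG hG] h] by (simp add: n_def)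
      have Dqh: "D q h \<le> 1" by (rule D_H[OF qH h])
      have Dxb: "D x b \<le> s" by (rule D_le[OF mono[OF b(1)]])
      have Dbh: "D b h \<le> L - s" by (rule D_le[OF mono[OF b(2)]])
      have Dxb': "D x h \<le> D x b + D b h" by (rule D_triangle[OF xG bG hG])
      have Lr: "real L \<le> real s + real t + real c" using Lc by (simp add: n_def[symmetric] n)
      have Ls: "real (L - s) = real L - real s" using nL n by simp
      let ?d = "cayley_dist G X H" and ?g = "gromov_product (cayley_dist G X H) x"
      have sym: "D q x = D x q" "D a x = D x a" "D h x = D x h" "D b x = D x b" "D h b = D b h"
        using D_sym xG qG aG hG bG by auto
      \<comment> \<open>Seen from \<open>x\<close>, consecutive points of the chain
        \<open>a\<close>, \<open>q\<close>, \<open>h\<close>, \<open>b\<close> have Gromov product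
        at least \<open>s - c\<close>, and two uses of hyperbolicity compare \<open>a\<close> with
        \<open>b\<close>. The edge of Cay(H,H) joining \<open>q\<close> to \<open>h\<close> enters
        only through distances, never as part of a path.\<close>
      have g1: "?g a q = real s" by (simp add: gromov_product_def cayley_dist_D sym Dxq Dxa Daq n)
      have g2: "real s \<le> ?g q h"
        using Dqh Dxh t1 n by (simp add: gromov_product_def cayley_dist_D sym Dxq)
      have g3: "real s - real c \<le> ?g h b"
      proof -
        have "real (D x h) \<le> real (D x b) + real (D b h)" using Dxb' by linarith
        moreover have "real (D b h) \<le> real t + real c" using Dbh Ls Lr by linarith
        moreover have "real s + real t \<le> real (D x h)" using Dxh n by linarith
        ultimately show ?thesis by (simp add: gromov_product_def cayley_dist_D sym)
      qed
      have "real s - real c - hyp \<le> ?g q b"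
        using hyp[OF xG qG hG bG] g2 g3 by linarith
      then have g4: "real s - real c - 2 * hyp \<le> ?g a b"
        using hyp[OF xG aG qG bG] g1 hyp_nonneg by linarith
      have "real (D a b) \<le> 2 * real c + 4 * hyp"
        using g4 Dxb by (simp add: gromov_product_def cayley_dist_D sym Dxa)
      then have Dab: "D a b \<le> t" using t by linarith
      have p1: "edge_path G E' a (D a b) b"
        by (rule avoiding_path[OF geodesic[OF aG bG]]) (use Dab dist_a in simp)
      have p2: "edge_path G E' a t q" by (rule avoiding_path[OF a(2) dist_a])
      have "edge_path G E' h ((L - s) + D a b + t) q"
        by (rule edge_path_trans[OF p2 edge_path_trans[OF edge_path_sym[OF p1 sub] edge_path_sym[OF b(2) sub]]])
      moreover have "(L - s) + D a b + t \<le> c + 3 * t" using Dab Lc n by (simp add: n_def[symmetric])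
      ultimately show ?thesis by blast
    qed
  qed
  then show ?thesis by blast
qed

text \<open>Translation by the inverse of \<open>h\<close> moves the ball to the identity, where
  \<open>locally_finite\<close> applies.\<close>

lemma relative_ball_finite: "finite {q \<in> H. \<exists>k\<le>N. edge_path G E' h k q}" if h: "h \<in> H"
proof (rule finite_subset)
  let ?D = "{h \<in> H. \<exists>k\<le>N. edge_path G E' \<one> k h}"
  show "{q \<in> H. \<exists>k\<le>N. edge_path G E' h k q} \<subseteq> (\<lambda>d. h \<otimes> d) ` ?D"
  proof
    fix q assume "q \<in> {q \<in> H. \<exists>k\<le>N. edge_path G E' h k q}"
    then obtain k where q: "q \<in> H" "k \<le> N" "edge_path G E' h k q" by blast
    have ih: "inv h \<in> H" using h H by (simp add: H_inv)
    have "edge_path G E' \<one> k (inv h \<otimes> q)" using translate_E'[OF q(3) ih] h HG by simp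
    moreover have "inv h \<otimes> q \<in> H" using ih q H by (simp add: H_mult)
    ultimately have "inv h \<otimes> q \<in> ?D" using q by blast
    moreover have "q = h \<otimes> (inv h \<otimes> q)" using h q HG by (simp add: m_assoc[symmetric])
    ultimately show "q \<in> (\<lambda>d. h \<otimes> d) ` ?D" by blast
  qed
qed (rule finite_imageI[OF locally_finite])

lemma proj_translate:
  assumes "x \<in> carrier G" "h \<in> H" "q \<in> proj x" shows "h \<otimes> q \<in> proj (h \<otimes> x)"
proof -
  have le: "distH (k \<otimes> y) \<le> distH y" if y: "y \<in> carrier G" and k: "k \<in> H" for k y
  proof -
    obtain p where p: "p \<in> H" "edge_path G E y (distH y) p"
      using proj_nonempty[OF y] by (auto simp: proj_def)
    show ?thesis by (rule distH_le[OF translate_E[OF p(2) HG[OF k]] H_mult[OF k p(1)]])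
  qed
  have hG: "h \<in> carrier G" by (rule HG[OF assms(2)])
  have "distH (inv h \<otimes> (h \<otimes> x)) \<le> distH (h \<otimes> x)"
    by (rule le[OF m_closed[OF hG assms(1)] H_inv[OF assms(2)]])
  then have "distH (h \<otimes> x) = distH x"
    using le[OF assms(1,2)] assms(1) hG by (simp add: m_assoc[symmetric])
  moreover have "q \<in> H" "edge_path G E x (distH x) q" using assms(3) by (simp_all add: proj_def)
  ultimately show ?thesis
    using translate_E[of x "distH x" q h] hG H_mult[OF assms(2)] by (simp add: proj_def)
qed

text \<open>\<open>distH (inv g \<otimes> x)\<close> is the distance from \<open>x\<close> to the
  coset gH. If it is at most the distance to \<open>H\<close>, then walking to gH, jumping to
  \<open>g\<close> inside the coset and descending to \<open>H\<close> avoids Cay(H,H), ends at a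
  point \<open>h\<close> independent of \<open>x\<close>, and is at most \<open>1 + distH g\<close>
  longer than \<open>distH x\<close>. Hence \<open>relative_distance_bound\<close> confines all
  projections to a finite ball about \<open>h\<close>.\<close>

lemma proj_far_coset:
  assumes g: "g \<in> carrier G" "g \<notin> H"
  shows "\<exists>F. finite F \<and> (\<forall>x\<in>carrier G. distH (inv g \<otimes> x) \<le> distH x \<longrightarrow> proj x \<subseteq> F)"
proof -
  obtain h where h: "h \<in> H" "edge_path G E g (distH g) h"
    using proj_nonempty[OF g(1)] by (auto simp: proj_def)
  obtain N where N: "\<And>x q h L. q \<in> proj x \<Longrightarrow> h \<in> H \<Longrightarrow> edge_path G E' x L h \<Longrightarrow>
      L \<le> distH x + (1 + distH g) \<Longrightarrow> \<exists>k\<le>N. edge_path G E' h k q"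
    using relative_distance_bound[of "1 + distH g"] by blast
  have "proj x \<subseteq> {q \<in> H. \<exists>k\<le>N. edge_path G E' h k q}"
    if x: "x \<in> carrier G" and le: "distH (inv g \<otimes> x) \<le> distH x" for x
  proof
    fix q assume q: "q \<in> proj x"
    define m where "m = distH (inv g \<otimes> x)"
    obtain p where p: "p \<in> H" "edge_path G E (inv g \<otimes> x) m p"
      using proj_nonempty[of "inv g \<otimes> x"] g x by (auto simp: proj_def m_def)
    have pG: "p \<in> carrier G" by (rule HG[OF p(1)])
    have gp: "g \<otimes> p \<notin> H"
    proof
      assume "g \<otimes> p \<in> H"
      then have "(g \<otimes> p) \<otimes> inv p \<in> H" by (rule H_mult) (rule H_inv[OF p(1)])
      then show False using g pG by (simp add: m_assoc)
    qed
    have "edge_path G E x m (g \<otimes> p)"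
      using translate_E[OF p(2) g(1)] g x by (simp add: m_assoc[symmetric])
    then have 1: "edge_path G E' x m (g \<otimes> p)" by (rule avoiding_path) (use le in \<open>simp add: m_def\<close>)
    have 2: "edge_path G E' (g \<otimes> p) 1 g"
      using H_edge_avoiding[of "g \<otimes> p" "inv p"] g pG gp p H by (simp add: m_assoc H_inv)
    have 3: "edge_path G E' g (distH g) h" by (rule avoiding_path[OF h(2)]) simp
    have "edge_path G E' x ((m + 1) + distH g) h" by (rule edge_path_trans[OF 3 edge_path_trans[OF 2 1]])
    then have "\<exists>k\<le>N. edge_path G E' h k q"
      by (rule N[OF q h(1)]) (use le in \<open>simp add: m_def\<close>)
    then show "q \<in> {q \<in> H. \<exists>k\<le>N. edge_path G E' h k q}" using q by (auto simp: proj_def)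
  qed
  then show ?thesis using relative_ball_finite[OF h(1)] by blast
qed

text \<open>A geodesic to one projection is a path of zero excess, to be compared with the other
  projection.\<close>

lemma proj_bounded:
  "\<exists>Z. finite Z \<and> (\<forall>x\<in>carrier G. \<forall>p\<in>proj x. \<forall>q\<in>proj x. inv p \<otimes> q \<in> Z)"
proof -
  obtain N where N: "\<And>x q h L. q \<in> proj x \<Longrightarrow> h \<in> H \<Longrightarrow> edge_path G E' x L h \<Longrightarrow>
      L \<le> distH x + 0 \<Longrightarrow> \<exists>k\<le>N. edge_path G E' h k q"
    using relative_distance_bound[of 0] by blast
  have "inv p \<otimes> q \<in> {h \<in> H. \<exists>k\<le>N. edge_path G E' \<one> k h}"
    if x: "x \<in> carrier G" and p: "p \<in> proj x" and q: "q \<in> proj x" for x p q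
  proof -
    have pH: "p \<in> H" "inv p \<in> H" and qH: "q \<in> H" and xp: "edge_path G E x (distH x) p"
      using p q H by (auto simp: proj_def H_inv)
    obtain k where k: "k \<le> N" "edge_path G E' p k q"
      using N[OF q pH(1) avoiding_path[OF xp]] by auto
    from translate_E'[OF this(2) pH(2)] have "edge_path G E' \<one> k (inv p \<otimes> q)" using pH HG by simp
    then show ?thesis using k pH qH H by (auto simp: H_mult)
  qed
  then show ?thesis using locally_finite[of N] by blast
qed

text \<open>A point and its translate by \<open>g\<close> are compared by their distances to
  \<open>H\<close>. If the distance does not increase, \<open>proj_far_coset\<close> for the inverse
  of \<open>g\<close> confines the projections of the point; if it increases, the same lemma for
  \<open>g\<close> confines those of the translate. Hence \<open>F\<close> has two parts.\<close>

lemma small_set_exists: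
  assumes g: "g \<in> carrier G" "g \<notin> H" and inf: "infinite H"
  obtains B where "B \<subseteq> carrier G" "\<And>a. a \<in> carrier G - B \<Longrightarrow> g \<otimes> a \<in> B"
    "\<And>n. \<exists>D\<subseteq>H. finite D \<and> card D = n \<and>
      (\<forall>h\<in>D. \<forall>k\<in>D. h \<noteq> k \<longrightarrow> (\<lambda>b. h \<otimes> b) ` B \<inter> (\<lambda>b. k \<otimes> b) ` B = {})"
proof -
  have ig: "inv g \<in> carrier G" by (rule inv_closed[OF g(1)])
  have ig': "inv g \<notin> H"
  proof
    assume "inv g \<in> H"
    from H_inv[OF this] show False using g by simp
  qed
  obtain F1 where F1: "finite F1" "\<forall>x\<in>carrier G. distH (inv g \<otimes> x) \<le> distH x \<longrightarrow> proj x \<subseteq> F1"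
    using proj_far_coset[OF g] by (elim exE conjE)
  obtain F2 where F2: "finite F2" "\<forall>x\<in>carrier G. distH (g \<otimes> x) \<le> distH x \<longrightarrow> proj x \<subseteq> F2"
    using proj_far_coset[OF ig ig'] unfolding inv_inv[OF g(1)] by (elim exE conjE)
  define F where "F = F1 \<union> F2"
  define B where "B = {x \<in> carrier G. proj x \<inter> F \<noteq> {}}"
  obtain Z where Z: "finite Z" "\<forall>x\<in>carrier G. \<forall>p\<in>proj x. \<forall>q\<in>proj x. inv p \<otimes> q \<in> Z"
    using proj_bounded by (elim exE conjE)
  \<comment> \<open>A common point of two translates has one projection in hF and one in kF, and
    their quotient lies in \<open>Z\<close>; solving for \<open>inv h \<otimes> k\<close> gives an
    element of F Z F^-1.\<close>
  define W where "W = (\<lambda>(p, z, q). p \<otimes> z \<otimes> inv q) ` (F \<times> Z \<times> F)"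
  have W: "finite W" using F1 F2 Z by (simp add: W_def F_def)
  have meet: "inv h \<otimes> k \<in> W"
    if hk: "h \<in> H" "k \<in> H" and ne: "(\<lambda>b. h \<otimes> b) ` B \<inter> (\<lambda>b. k \<otimes> b) ` B \<noteq> {}" for h k
  proof -
    obtain a b where ab: "a \<in> B" "b \<in> B" "h \<otimes> a = k \<otimes> b" using ne by blast
    obtain p where p: "p \<in> proj a" "p \<in> F" using ab by (auto simp: B_def)
    obtain q where q: "q \<in> proj b" "q \<in> F" using ab by (auto simp: B_def)
    have aG: "a \<in> carrier G" "b \<in> carrier G" using ab by (auto simp: B_def)
    have pqG: "p \<in> carrier G" "q \<in> carrier G" using p q HG by (auto simp: proj_def)
    have hkG: "h \<in> carrier G" "k \<in> carrier G" using hk HG by auto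
    have "h \<otimes> p \<in> proj (h \<otimes> a)" by (rule proj_translate[OF aG(1) hk(1) p(1)])
    moreover have "k \<otimes> q \<in> proj (h \<otimes> a)"
      unfolding ab(3) by (rule proj_translate[OF aG(2) hk(2) q(1)])
    ultimately have "inv (h \<otimes> p) \<otimes> (k \<otimes> q) \<in> Z"
      using Z(2) m_closed[OF hkG(1) aG(1)] by blast
    moreover have "inv h \<otimes> k = p \<otimes> (inv (h \<otimes> p) \<otimes> (k \<otimes> q)) \<otimes> inv q"
    proof -
      have "p \<otimes> (inv (h \<otimes> p) \<otimes> (k \<otimes> q)) \<otimes> inv q = (p \<otimes> inv p) \<otimes> (inv h \<otimes> k) \<otimes> (q \<otimes> inv q)"
        using pqG hkG by (simp only: inv_mult_group m_assoc m_closed inv_closed)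
      then show ?thesis using pqG hkG by simp
    qed
    ultimately show ?thesis using p(2) q(2) unfolding W_def by force
  qed
  show thesis
  proof (rule that[of B])
    show "B \<subseteq> carrier G" by (auto simp: B_def)
    fix a assume "a \<in> carrier G - B"
    then have a: "a \<in> carrier G" "proj a \<inter> F = {}" by (auto simp: B_def)
    have ga: "g \<otimes> a \<in> carrier G" using g a by simp
    have "\<not> distH (g \<otimes> a) \<le> distH a"
      using F2(2) a proj_nonempty[OF a(1)] unfolding F_def by blast
    then have "distH (inv g \<otimes> (g \<otimes> a)) \<le> distH (g \<otimes> a)"
      using g a by (simp add: m_assoc[symmetric])
    with F1(2) ga have "proj (g \<otimes> a) \<subseteq> F1" by blast
    then show "g \<otimes> a \<in> B" using proj_nonempty[OF ga] ga by (auto simp: B_def F_def)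
  next
    fix n
    show "\<exists>D\<subseteq>H. finite D \<and> card D = n \<and>
      (\<forall>h\<in>D. \<forall>k\<in>D. h \<noteq> k \<longrightarrow> (\<lambda>b. h \<otimes> b) ` B \<inter> (\<lambda>b. k \<otimes> b) ` B = {})"
    proof (induction n)
      case 0
      then show ?case by (intro exI[of _ "{}"]) simp
    next
      case (Suc n)
      then obtain D where D: "D \<subseteq> H" "finite D" "card D = n"
        and disj: "\<forall>h\<in>D. \<forall>k\<in>D. h \<noteq> k \<longrightarrow> (\<lambda>b. h \<otimes> b) ` B \<inter> (\<lambda>b. k \<otimes> b) ` B = {}"
        by (elim exE conjE)
      \<comment> \<open>Greedy choice: the next element only has to avoid a finite set, and
        \<open>meet\<close> makes its translate disjoint from the earlier ones.\<close>
      have fin: "finite (D \<union> (\<lambda>(d, w). d \<otimes> w) ` (D \<times> W))" using D W by simp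
      obtain h where h: "h \<in> H" "h \<notin> D" "h \<notin> (\<lambda>(d, w). d \<otimes> w) ` (D \<times> W)"
      proof -
        assume *: "\<And>h. h \<in> H \<Longrightarrow> h \<notin> D \<Longrightarrow> h \<notin> (\<lambda>(d, w). d \<otimes> w) ` (D \<times> W) \<Longrightarrow> thesis"
        have "\<not> H \<subseteq> D \<union> (\<lambda>(d, w). d \<otimes> w) ` (D \<times> W)"
          using inf finite_subset[OF _ fin] by blast
        then show thesis using * by blast
      qed
      have new: "(\<lambda>b. d \<otimes> b) ` B \<inter> (\<lambda>b. h \<otimes> b) ` B = {}" if d: "d \<in> D" for d
      proof (rule ccontr)
        assume "(\<lambda>b. d \<otimes> b) ` B \<inter> (\<lambda>b. h \<otimes> b) ` B \<noteq> {}"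
        then have "inv d \<otimes> h \<in> W" using d D h by (intro meet) auto
        moreover have "h = d \<otimes> (inv d \<otimes> h)" using d D h HG by (auto simp: m_assoc[symmetric] subset_iff)
        ultimately show False using h(3) d by force
      qed
      have "\<forall>a\<in>insert h D. \<forall>b\<in>insert h D. a \<noteq> b \<longrightarrow> (\<lambda>x. a \<otimes> x) ` B \<inter> (\<lambda>x. b \<otimes> x) ` B = {}"
      proof (intro ballI impI)
        fix a b assume ab: "a \<in> insert h D" "b \<in> insert h D" "a \<noteq> b"
        consider "a = h" "b \<in> D" | "b = h" "a \<in> D" | "a \<in> D" "b \<in> D" using ab by blast
        then show "(\<lambda>x. a \<otimes> x) ` B \<inter> (\<lambda>x. b \<otimes> x) ` B = {}"
        proof cases
          case 1
          then show ?thesis using new[of b] by (simp only: Int_commute)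
        next
          case 2
          then show ?thesis using new[of a] by simp
        next
          case 3
          then show ?thesis using disj ab(3) by simp
        qed
      qed
      then show ?case using D h by (intro exI[of _ "insert h D"]) simp
    qed
  qed
qed

end

theorem corollary2:
  fixes G :: "('a, 'm) monoid_scheme" and H :: "'a set"
  assumes "group G"
    and "subgroup H G"
    and "infinite H"
    and "amenable_group (G\<lparr>carrier := H\<rparr>)"
    and "hyperbolically_embedded H G"
  shows "maximal_amenable_subalgebra (carrier G) (subgroup_vN G H) (group_vN G)"
proof -
  interpret group G by fact
  obtain X where X: "X \<subseteq> carrier G" "generate G (X \<union> H) = carrier G"
      "gromov_hyperbolic (carrier G) (cayley_dist G X H)"
      "\<forall>n. finite {h \<in> H. \<exists>k\<le>n.
           edge_path G (cayley_edges G X H - subgroup_edges H) \<one>\<^bsub>G\<^esub> k h}"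
    using assms(5) unfolding hyperbolically_embedded_def by (elim exE conjE)
  obtain c where c: "0 \<le> c"
    "\<forall>w\<in>carrier G. \<forall>x\<in>carrier G. \<forall>y\<in>carrier G. \<forall>z\<in>carrier G.
      min (gromov_product (cayley_dist G X H) w x y) (gromov_product (cayley_dist G X H) w y z) - c
        \<le> gromov_product (cayley_dist G X H) w x z"
    using X(3) unfolding gromov_hyperbolic_def by (elim exE conjE)
  interpret hyperbolic_embedding G H X c
  proof (intro hyperbolic_embedding.intro hyperbolic_embedding_axioms.intro)
    fix w x y z
    assume "w \<in> carrier G" "x \<in> carrier G" "y \<in> carrier G" "z \<in> carrier G"
    then show "min (gromov_product (cayley_dist G X H) w x y) (gromov_product (cayley_dist G X H) w y z) - c
        \<le> gromov_product (cayley_dist G X H) w x z"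
      by (rule c(2)[rule_format])
  qed (use assms(1,2) X c(1) in simp_all)
  have singular: "\<exists>B. small H B \<and> (\<forall>a\<in>carrier G - B. g \<otimes>\<^bsub>G\<^esub> a \<in> B)"
    if g: "g \<in> carrier G" "g \<notin> H" for g
  proof (rule small_set_exists[OF g assms(3)])
    fix B assume "B \<subseteq> carrier G" "\<And>a. a \<in> carrier G - B \<Longrightarrow> g \<otimes>\<^bsub>G\<^esub> a \<in> B"
      "\<And>n. \<exists>D\<subseteq>H. finite D \<and> card D = n \<and> (\<forall>h\<in>D. \<forall>k\<in>D. h \<noteq> k \<longrightarrow>
        (\<lambda>b. h \<otimes>\<^bsub>G\<^esub> b) ` B \<inter> (\<lambda>b. k \<otimes>\<^bsub>G\<^esub> b) ` B = {})"
    then show ?thesis by (intro exI[of _ B]) (simp add: small_def)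
  qed
  show ?thesis
    unfolding maximal_amenable_subalgebra_def von_neumann_subalgebra_def
  proof (intro conjI allI impI)
    show "von_neumann_algebra (carrier G) (subgroup_vN G H)"
      by (rule subgroup_von_neumann_algebra[OF assms(2)])
    show "von_neumann_algebra (carrier G) (group_vN G)"
      by (rule subgroup_von_neumann_algebra[OF subgroup_self])
    show "subgroup_vN G H \<subseteq> group_vN G" by (rule subgroup_vN_subset[OF subgroup.subset[OF assms(2)]])
    show "amenable_vN (carrier G) (subgroup_vN G H)"
      by (rule amenable_subgroup_vN[OF assms(2,4)])
    fix Q
    assume "(von_neumann_algebra (carrier G) Q \<and> von_neumann_algebra (carrier G) (group_vN G) \<and>
      Q \<subseteq> group_vN G) \<and> amenable_vN (carrier G) Q \<and> subgroup_vN G H \<subseteq> Q"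
    then show "Q = subgroup_vN G H"
      by (elim conjE) (rule maximal_amenable_criterion[OF assms(2) _ _ _ _ singular])
  qed
qed

end
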